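(* Let $M$ be a Cartan-Hadamard manifold of dimension $n\ge2$ with a fixed pole $o\in M$, and suppose that for some $\bar\beta>0$ $$\mathrm{Ric}_o(x)\ge -(n-1)\frac{\bar\beta}{1+r^2(x)}\quad\text{for all }x\in M\setminus\{o\}.$$ Let $C_1>1$ be a constant such that $\Delta r(x)\le \frac{C_1(n-1)}{r(x)}$ for all $x\in M\setminus\{o\}$. Let $p>1$, let $b$ be a $C^1$ vector field on $M$ with $b\in L^\infty(M)$, and let $u_0\in C(M)$ be bounded with $u_0\ge0$. Suppose that there are $\hat C\ge0$ and $\sigma>0$ such that $$\operatorname{div}b(x)\le\hat C\quad\text{for all }x\in M,\qquad \underline b(x)\ge-\frac{\sigma}{r(x)}\quad\text{for all }x\in M\setminus\{o\}.$$ Let $a>0$, let $$\lambda\ge 2a\,[1+C_1(n-1)+\sigma]+\hat C,$$ let $\eta(x):=e^{-a\,r(x)^2}$ for $x\in M$, and set $k:=1/\int_M\eta\,d\mu$. Suppose that $$k\int_M u_0(x)\,\eta(x)\,d\mu>\lambda^{\frac1{p-1}} .$$ Then the Cauchy problem $$\partial_t u=\Delta u+\langle b(x),\nabla u\rangle+u^p\ \text{ in }M\times(0,T),\qquad u=u_0\ \text{ in }M\times\{0\}$$ does not admit global solutions: there is no nonnegative classical solution $u$ with $T=+\infty$ such that $u\in L^\infty(M\times(0,\tau))$ for each $0<\tau<T$ and $\partial_t u(\cdot,t)\,\eta\in L^1(M)$ for every $t\in(0,T)$.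
   Context: A Cartan-Hadamard manifold is a simply connected complete noncompact Riemannian manifold with nonpositive sectional curvatures; $g=\langle\cdot,\cdot\rangle$ is its metric, $\Delta$ the Laplace-Beltrami operator, $\nabla$ the gradient, $d\mu$ the Riemannian volume element. A point $o\in M$ is fixed; $r(x)=\operatorname{dist}(x,o)$, and $\frac{\partial}{\partial r}$ is the unit radial vector field on $M\setminus\{o\}$. For $x\neq o$, $\mathrm{Ric}_o(x)$ is the Ricci curvature at $x$ in the radial direction $\frac{\partial}{\partial r}$. The radial component of $b$ is $\underline b(x):=\langle b(x),\frac{\partial}{\partial r}\rangle$. Under the stated Ricci bound, Laplacian comparison provides a constant $C_1>1$ with $\frac{n-1}{r}\le\Delta r\le\frac{C_1(n-1)}{r}$ on $M\setminus\{o\}$, and $\eta\in L^1(M)$. A classical solution on $M\times(0,T)$ is a function that is $C^2$ in $x$ and $C^1$ in $t$ in $M\times(0,T)$, continuous on $M\times[0,T)$, satisfying the equation and initial condition pointwise; it is global if $T=+\infty$. *)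

theory Defs
  imports "HOL-Analysis.Analysis"
begin

section \<open>Partial derivatives and $C^k$ maps on open subsets of Euclidean space\<close>

definition pd :: "'n \<Rightarrow> (real^'n \<Rightarrow> 'b::real_normed_vector) \<Rightarrow> real^'n \<Rightarrow> 'b" where
  "pd i f y = frechet_derivative f (at y) (axis i 1)"

text \<open>Only used for open sets \<open>S\<close>.\<close>

primrec Ck_on :: "nat \<Rightarrow> (real^'n \<Rightarrow> 'b::real_normed_vector) \<Rightarrow> (real^'n) set \<Rightarrow> bool" where
  "Ck_on 0 f S \<longleftrightarrow> continuous_on S f"
| "Ck_on (Suc k) f S \<longleftrightarrow> f differentiable_on S \<and> (\<forall>i. Ck_on k (pd i f) S)"

definition smooth_on :: "(real^'n \<Rightarrow> 'b::real_normed_vector) \<Rightarrow> (real^'n) set \<Rightarrow> bool" where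
  "smooth_on f S \<longleftrightarrow> (\<forall>k. Ck_on k f S)"


section \<open>Smooth manifolds\<close>

text \<open>The underlying space of a manifold is a whole type \<open>'m\<close> (in the theorem: Hausdorff and second
  countable); its dimension is \<open>CARD('n)\<close>. A chart is a pair of a domain and a coordinate map, whose
  values outside the domain are irrelevant. A smooth structure is a maximal atlas.\<close>

type_synonym ('m, 'n) chart = "'m set \<times> ('m \<Rightarrow> real^'n)"

definition chart_inv :: "('m, 'n::finite) chart \<Rightarrow> real^'n \<Rightarrow> 'm" where
  "chart_inv c = inv_into (fst c) (snd c)"

definition is_chart :: "('m::topological_space, 'n::finite) chart \<Rightarrow> bool" where
  "is_chart c \<longleftrightarrow> open (fst c) \<and> open (snd c ` fst c)
     \<and> homeomorphism (fst c) (snd c ` fst c) (snd c) (chart_inv c)"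

definition smooth_compatible :: "('m, 'n::finite) chart \<Rightarrow> ('m, 'n) chart \<Rightarrow> bool" where
  "smooth_compatible c d \<longleftrightarrow>
     smooth_on (snd d \<circ> chart_inv c) (snd c ` (fst c \<inter> fst d))
   \<and> smooth_on (snd c \<circ> chart_inv d) (snd d ` (fst c \<inter> fst d))"

definition smooth_structure :: "('m::topological_space, 'n::finite) chart set \<Rightarrow> bool" where
  "smooth_structure A \<longleftrightarrow>
     (\<forall>c\<in>A. is_chart c) \<and> (\<Union>c\<in>A. fst c) = UNIV
   \<and> (\<forall>c\<in>A. \<forall>d\<in>A. smooth_compatible c d)
   \<and> (\<forall>c. is_chart c \<and> (\<forall>d\<in>A. smooth_compatible c d) \<longrightarrow> c \<in> A)"

definition chart_at :: "('m, 'n::finite) chart set \<Rightarrow> 'm \<Rightarrow> ('m, 'n) chart" where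
  "chart_at A p = (SOME c. c \<in> A \<and> p \<in> fst c)"

text \<open>A tangent vector at \<open>p\<close> is the family of its component vectors in all charts around \<open>p\<close>,
  related by the differentials of the coordinate changes; it is set to \<open>0\<close> on all other arguments so
  that equality of tangent vectors is equality of functions. Linear operations are pointwise.\<close>

type_synonym ('m, 'n) tvec = "('m, 'n) chart \<Rightarrow> real^'n"

definition tangent_space :: "('m, 'n::finite) chart set \<Rightarrow> 'm \<Rightarrow> ('m, 'n) tvec set" where
  "tangent_space A p = {v.
     (\<forall>c\<in>A. \<forall>d\<in>A. p \<in> fst c \<inter> fst d \<longrightarrow>
        v d = frechet_derivative (snd d \<circ> chart_inv c) (at (snd c p)) (v c))
   \<and> (\<forall>c. \<not> (c \<in> A \<and> p \<in> fst c) \<longrightarrow> v c = 0)}"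

text \<open>The tangent vector at \<open>p\<close> with components \<open>w\<close> in the chart \<open>c\<close>.\<close>

definition tvec_of :: "('m, 'n::finite) chart set \<Rightarrow> ('m, 'n) chart \<Rightarrow> 'm \<Rightarrow> real^'n \<Rightarrow> ('m, 'n) tvec"
where
  "tvec_of A c p w = (\<lambda>d. if d \<in> A \<and> p \<in> fst d
     then frechet_derivative (snd d \<circ> chart_inv c) (at (snd c p)) w else 0)"

definition tscale :: "real \<Rightarrow> ('m, 'n::finite) tvec \<Rightarrow> ('m, 'n) tvec" where
  "tscale s v = (\<lambda>c. s *\<^sub>R v c)"

definition tadd :: "('m, 'n::finite) tvec \<Rightarrow> ('m, 'n) tvec \<Rightarrow> ('m, 'n) tvec" where
  "tadd v w = (\<lambda>c. v c + w c)"

definition velocity :: "('m, 'n::finite) chart set \<Rightarrow> (real \<Rightarrow> 'm) \<Rightarrow> real \<Rightarrow> ('m, 'n) tvec" where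
  "velocity A \<gamma> t = (\<lambda>c. if c \<in> A \<and> \<gamma> t \<in> fst c then vector_derivative (snd c \<circ> \<gamma>) (at t) else 0)"

definition C1_vector_field :: "('m, 'n::finite) chart set \<Rightarrow> ('m \<Rightarrow> ('m, 'n) tvec) \<Rightarrow> bool" where
  "C1_vector_field A X \<longleftrightarrow> (\<forall>p. X p \<in> tangent_space A p)
     \<and> (\<forall>c\<in>A. Ck_on 1 (\<lambda>y. X (chart_inv c y) c) (snd c ` fst c))"


section \<open>Riemannian metrics\<close>

type_synonym ('m, 'n) metric = "'m \<Rightarrow> ('m, 'n) tvec \<Rightarrow> ('m, 'n) tvec \<Rightarrow> real"

text \<open>The Gram matrix of the coordinate vector fields of the chart \<open>c\<close> at the point with coordinates \<open>y\<close>.\<close>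

definition gmat :: "('m, 'n::finite) chart set \<Rightarrow> ('m, 'n) metric \<Rightarrow> ('m, 'n) chart
    \<Rightarrow> real^'n \<Rightarrow> real^'n^'n" where
  "gmat A g c y = (let p = chart_inv c y in
     \<chi> i j. g p (tvec_of A c p (axis i 1)) (tvec_of A c p (axis j 1)))"

definition riemannian_metric :: "('m, 'n::finite) chart set \<Rightarrow> ('m, 'n) metric \<Rightarrow> bool" where
  "riemannian_metric A g \<longleftrightarrow>
     (\<forall>p. \<forall>v\<in>tangent_space A p. \<forall>w\<in>tangent_space A p. g p v w = g p w v)
   \<and> (\<forall>p. \<forall>v\<in>tangent_space A p. \<forall>w\<in>tangent_space A p. \<forall>z\<in>tangent_space A p. \<forall>s.
        g p (tadd (tscale s v) w) z = s * g p v z + g p w z)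
   \<and> (\<forall>p. \<forall>v\<in>tangent_space A p. v \<noteq> (\<lambda>_. 0) \<longrightarrow> g p v v > 0)
   \<and> (\<forall>c\<in>A. smooth_on (gmat A g c) (snd c ` fst c))"

definition riemannian_manifold ::
    "('m::topological_space, 'n::finite) chart set \<Rightarrow> ('m, 'n) metric \<Rightarrow> bool" where
  "riemannian_manifold A g \<longleftrightarrow> smooth_structure A \<and> riemannian_metric A g"

definition tnorm :: "('m, 'n::finite) metric \<Rightarrow> 'm \<Rightarrow> ('m, 'n) tvec \<Rightarrow> real" where
  "tnorm g p v = sqrt (g p v v)"

definition piecewise_C1_path ::
    "('m::topological_space, 'n::finite) chart set \<Rightarrow> (real \<Rightarrow> 'm) \<Rightarrow> bool" where
  "piecewise_C1_path A \<gamma> \<longleftrightarrow> path \<gamma> \<and> (\<exists>S. finite S \<and>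
     (\<forall>c\<in>A. (snd c \<circ> \<gamma>) C1_differentiable_on {t \<in> {0..1} - S. \<gamma> t \<in> fst c}))"

text \<open>The length is a Lebesgue integral with values in \<open>[0,\<infinity>]\<close>: the paths above may have unbounded
  speed near exceptional points, and then must not get length \<open>0\<close>.\<close>

definition curve_length ::
    "('m, 'n::finite) chart set \<Rightarrow> ('m, 'n) metric \<Rightarrow> (real \<Rightarrow> 'm) \<Rightarrow> ennreal" where
  "curve_length A g \<gamma> = (\<integral>\<^sup>+ t\<in>{0..1}. ennreal (tnorm g (\<gamma> t) (velocity A \<gamma> t)) \<partial>lborel)"

definition riem_dist :: "('m::topological_space, 'n::finite) chart set \<Rightarrow> ('m, 'n) metric
    \<Rightarrow> 'm \<Rightarrow> 'm \<Rightarrow> real" where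
  "riem_dist A g p q = enn2real
     (INF \<gamma>\<in>{\<gamma>. piecewise_C1_path A \<gamma> \<and> pathstart \<gamma> = p \<and> pathfinish \<gamma> = q}. curve_length A g \<gamma>)"

text \<open>This property determines the Borel measure \<open>\<mu>\<close> uniquely, as \<open>'m\<close> is second countable.\<close>

definition riemannian_volume :: "('m::topological_space, 'n::finite) chart set \<Rightarrow> ('m, 'n) metric
    \<Rightarrow> 'm measure \<Rightarrow> bool" where
  "riemannian_volume A g \<mu> \<longleftrightarrow> sets \<mu> = sets borel \<and>
     (\<forall>c\<in>A. \<forall>B\<in>sets borel. B \<subseteq> fst c \<longrightarrow>
        emeasure \<mu> B = (\<integral>\<^sup>+ y\<in>snd c ` B. ennreal (sqrt (det (gmat A g c y))) \<partial>lborel))"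


section \<open>Gradient, divergence, Laplace-Beltrami operator\<close>

definition grad :: "('m, 'n::finite) chart set \<Rightarrow> ('m, 'n) metric \<Rightarrow> ('m \<Rightarrow> real)
    \<Rightarrow> 'm \<Rightarrow> ('m, 'n) tvec" where
  "grad A g f p = (\<lambda>c. if c \<in> A \<and> p \<in> fst c
     then matrix_inv (gmat A g c (snd c p)) *v (\<chi> j. pd j (f \<circ> chart_inv c) (snd c p)) else 0)"

definition divergence :: "('m, 'n::finite) chart set \<Rightarrow> ('m, 'n) metric
    \<Rightarrow> ('m \<Rightarrow> ('m, 'n) tvec) \<Rightarrow> 'm \<Rightarrow> real" where
  "divergence A g X p = (let c = chart_at A p; \<rho> = (\<lambda>y. sqrt (det (gmat A g c y))) in
     (\<Sum>i\<in>UNIV. pd i (\<lambda>y. \<rho> y * X (chart_inv c y) c $ i) (snd c p)) / \<rho> (snd c p))"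

definition laplacian :: "('m, 'n::finite) chart set \<Rightarrow> ('m, 'n) metric \<Rightarrow> ('m \<Rightarrow> real)
    \<Rightarrow> 'm \<Rightarrow> real" where
  "laplacian A g f = divergence A g (grad A g f)"


section \<open>Curvature\<close>

text \<open>\<open>christoffel A g c k i j y\<close> is $\Gamma^k_{ij}$, and \<open>riem_coeff A g c l i j k y\<close> is the
  component along $\partial_l$ of $R(\partial_i,\partial_j)\partial_k$, where
  $R(X,Y)Z = \nabla_X\nabla_Y Z - \nabla_Y\nabla_X Z - \nabla_{[X,Y]}Z$.\<close>

definition christoffel :: "('m, 'n::finite) chart set \<Rightarrow> ('m, 'n) metric \<Rightarrow> ('m, 'n) chart
    \<Rightarrow> 'n \<Rightarrow> 'n \<Rightarrow> 'n \<Rightarrow> real^'n \<Rightarrow> real" where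
  "christoffel A g c k i j y = (\<Sum>l\<in>UNIV. matrix_inv (gmat A g c y) $ k $ l *
     (pd i (\<lambda>z. gmat A g c z $ j $ l) y + pd j (\<lambda>z. gmat A g c z $ i $ l) y
      - pd l (\<lambda>z. gmat A g c z $ i $ j) y)) / 2"

definition riem_coeff :: "('m, 'n::finite) chart set \<Rightarrow> ('m, 'n) metric \<Rightarrow> ('m, 'n) chart
    \<Rightarrow> 'n \<Rightarrow> 'n \<Rightarrow> 'n \<Rightarrow> 'n \<Rightarrow> real^'n \<Rightarrow> real" where
  "riem_coeff A g c l i j k y =
     pd i (christoffel A g c l j k) y - pd j (christoffel A g c l i k) y
     + (\<Sum>m\<in>UNIV. christoffel A g c l i m y * christoffel A g c m j k y
                - christoffel A g c l j m y * christoffel A g c m i k y)"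

text \<open>The curvature of the plane spanned by \<open>v\<close> and \<open>w\<close>,
  $\langle R(v,w)w,v\rangle / (|v|^2|w|^2-\langle v,w\rangle^2)$.\<close>

definition sectional_curvature :: "('m, 'n::finite) chart set \<Rightarrow> ('m, 'n) metric
    \<Rightarrow> 'm \<Rightarrow> ('m, 'n) tvec \<Rightarrow> ('m, 'n) tvec \<Rightarrow> real" where
  "sectional_curvature A g p v w = (let c = chart_at A p; y = snd c p in
     (\<Sum>i\<in>UNIV. \<Sum>j\<in>UNIV. \<Sum>k\<in>UNIV. \<Sum>l\<in>UNIV. \<Sum>m\<in>UNIV.
        riem_coeff A g c l i j k y * v c $ i * w c $ j * w c $ k * gmat A g c y $ l $ m * v c $ m)
     / (g p v v * g p w w - (g p v w)\<^sup>2))"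

text \<open>$\mathrm{Ric}(v,w)$ is the trace of $z \mapsto R(z,v)w$.\<close>

definition ricci :: "('m, 'n::finite) chart set \<Rightarrow> ('m, 'n) metric
    \<Rightarrow> 'm \<Rightarrow> ('m, 'n) tvec \<Rightarrow> ('m, 'n) tvec \<Rightarrow> real" where
  "ricci A g p v w = (let c = chart_at A p; y = snd c p in
     (\<Sum>i\<in>UNIV. \<Sum>j\<in>UNIV. \<Sum>k\<in>UNIV. riem_coeff A g c i i j k y * v c $ j * w c $ k))"

definition nonpositive_curvature :: "('m, 'n::finite) chart set \<Rightarrow> ('m, 'n) metric \<Rightarrow> bool" where
  "nonpositive_curvature A g \<longleftrightarrow>
     (\<forall>p. \<forall>v\<in>tangent_space A p. \<forall>w\<in>tangent_space A p.
        g p v v * g p w w - (g p v w)\<^sup>2 \<noteq> 0 \<longrightarrow> sectional_curvature A g p v w \<le> 0)"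

definition cartan_hadamard ::
    "('m::topological_space, 'n::finite) chart set \<Rightarrow> ('m, 'n) metric \<Rightarrow> bool" where
  "cartan_hadamard A g \<longleftrightarrow> riemannian_manifold A g
     \<and> simply_connected (UNIV :: 'm set)
     \<and> Metric_space.mcomplete UNIV (riem_dist A g)
     \<and> \<not> compact (UNIV :: 'm set)
     \<and> nonpositive_curvature A g"


section \<open>Geodesics, exponential map, poles, the radial field\<close>

definition geodesic :: "('m::topological_space, 'n::finite) chart set \<Rightarrow> ('m, 'n) metric
    \<Rightarrow> (real \<Rightarrow> 'm) \<Rightarrow> bool" where
  "geodesic A g \<gamma> \<longleftrightarrow> continuous_on UNIV \<gamma> \<and>
     (\<forall>c\<in>A. \<forall>t. \<gamma> t \<in> fst c \<longrightarrow>
        (let y = snd c \<circ> \<gamma>; y' = (\<lambda>s. vector_derivative y (at s)) in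
          y differentiable (at t) \<and>
          (y' has_vector_derivative
             (\<chi> k. - (\<Sum>i\<in>UNIV. \<Sum>j\<in>UNIV. christoffel A g c k i j (y t) * y' t $ i * y' t $ j))) (at t)))"

definition is_exponential_map :: "('m::topological_space, 'n::finite) chart set \<Rightarrow> ('m, 'n) metric
    \<Rightarrow> 'm \<Rightarrow> (('m, 'n) tvec \<Rightarrow> 'm) \<Rightarrow> bool" where
  "is_exponential_map A g p E \<longleftrightarrow> E (\<lambda>_. 0) = p \<and>
     (\<forall>v\<in>tangent_space A p. geodesic A g (\<lambda>t. E (tscale t v)) \<and> velocity A (\<lambda>t. E (tscale t v)) 0 = v)"

text \<open>On the tangent space at \<open>p\<close> there is at most one such map, by uniqueness of geodesics.\<close>

definition riem_exp :: "('m::topological_space, 'n::finite) chart set \<Rightarrow> ('m, 'n) metric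
    \<Rightarrow> 'm \<Rightarrow> ('m, 'n) tvec \<Rightarrow> 'm" where
  "riem_exp A g p = (SOME E. is_exponential_map A g p E)"

text \<open>A pole is a point whose exponential map is defined on the whole tangent space and is a
  diffeomorphism onto the manifold. The tangent space is identified with \<open>real^'n\<close> by the components in
  one chart; a bijection from \<open>real^'n\<close> onto the manifold is a diffeomorphism iff its inverse is a
  (global) chart of the maximal atlas.\<close>

definition riem_pole :: "('m::topological_space, 'n::finite) chart set \<Rightarrow> ('m, 'n) metric
    \<Rightarrow> 'm \<Rightarrow> bool" where
  "riem_pole A g p \<longleftrightarrow> is_exponential_map A g p (riem_exp A g p) \<and>
     (let F = (\<lambda>w. riem_exp A g p (tvec_of A (chart_at A p) p w)) in bij F \<and> (UNIV, inv F) \<in> A)"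

text \<open>$\partial/\partial r$ in polar coordinates around the pole \<open>p\<close>: at $\exp_p v \neq p$ it is the
  velocity at time $|v|$ of the unit speed geodesic $t \mapsto \exp_p(t\,v/|v|)$.\<close>

definition radial_field :: "('m::topological_space, 'n::finite) chart set \<Rightarrow> ('m, 'n) metric
    \<Rightarrow> 'm \<Rightarrow> 'm \<Rightarrow> ('m, 'n) tvec" where
  "radial_field A g p x = (let v = inv_into (tangent_space A p) (riem_exp A g p) x; \<rho> = tnorm g p v in
     velocity A (\<lambda>t. riem_exp A g p (tscale (t / \<rho>) v)) \<rho>)"


section \<open>Essentially bounded functions and classical solutions\<close>

definition ess_bounded :: "'a measure \<Rightarrow> ('a \<Rightarrow> real) \<Rightarrow> bool" where
  "ess_bounded M f \<longleftrightarrow> f \<in> borel_measurable M \<and> (\<exists>K. AE z in M. \<bar>f z\<bar> \<le> K)"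

text \<open>$C^{2,1}$: the derivatives in question exist and are jointly continuous in space and time.
  \<open>I\<close> is an open set of times.\<close>

definition C21_on :: "('m, 'n::finite) chart set \<Rightarrow> real set \<Rightarrow> ('m \<Rightarrow> real \<Rightarrow> real) \<Rightarrow> bool" where
  "C21_on A I u \<longleftrightarrow> (\<forall>x. \<forall>t\<in>I. u x differentiable (at t)) \<and>
     (\<forall>c\<in>A. let U = snd c ` fst c; v = (\<lambda>t y. u (chart_inv c y) t) in
        (\<forall>t\<in>I. Ck_on 2 (v t) U)
      \<and> continuous_on (U \<times> I) (\<lambda>(y, t). deriv (u (chart_inv c y)) t)
      \<and> (\<forall>i. continuous_on (U \<times> I) (\<lambda>(y, t). pd i (v t) y))
      \<and> (\<forall>i j. continuous_on (U \<times> I) (\<lambda>(y, t). pd i (pd j (v t)) y)))"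

text \<open>Classical solutions on $M\times(0,T)$, $0 < T \le \infty$, of
  $\partial_t u = \Delta u + \langle b,\nabla u\rangle + u^q$, $u(\cdot,0) = u_0$. As \<open>powr\<close> is the
  intended power for nonnegative bases only, this is meant for nonnegative \<open>u\<close>.\<close>

definition classical_solution :: "('m::topological_space, 'n::finite) chart set \<Rightarrow> ('m, 'n) metric
    \<Rightarrow> ('m \<Rightarrow> ('m, 'n) tvec) \<Rightarrow> real \<Rightarrow> ('m \<Rightarrow> real) \<Rightarrow> ereal \<Rightarrow> ('m \<Rightarrow> real \<Rightarrow> real) \<Rightarrow> bool" where
  "classical_solution A g b q u\<^sub>0 T u \<longleftrightarrow>
     C21_on A {t. 0 < t \<and> ereal t < T} u
   \<and> continuous_on (UNIV \<times> {t. 0 \<le> t \<and> ereal t < T}) (\<lambda>(x, t). u x t)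
   \<and> (\<forall>x t. 0 < t \<and> ereal t < T \<longrightarrow>
        deriv (u x) t = laplacian A g (\<lambda>z. u z t) x + g x (b x) (grad A g (\<lambda>z. u z t) x) + u x t powr q)
   \<and> (\<forall>x. u x 0 = u\<^sub>0 x)"

text \<open>The class of solutions whose global existence is at issue: nonnegative classical solutions, bounded
  on $M\times(0,\tau)$ for $\tau < T$, with $\partial_t u(\cdot,t)\,\eta \in L^1(M)$.\<close>

definition admissible_solution :: "('m::topological_space, 'n::finite) chart set \<Rightarrow> ('m, 'n) metric
    \<Rightarrow> 'm measure \<Rightarrow> ('m \<Rightarrow> ('m, 'n) tvec) \<Rightarrow> real \<Rightarrow> ('m \<Rightarrow> real) \<Rightarrow> ('m \<Rightarrow> real)
    \<Rightarrow> ereal \<Rightarrow> ('m \<Rightarrow> real \<Rightarrow> real) \<Rightarrow> bool" where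
  "admissible_solution A g \<mu> b q \<eta> u\<^sub>0 T u \<longleftrightarrow>
     classical_solution A g b q u\<^sub>0 T u
   \<and> (\<forall>x t. 0 \<le> t \<and> ereal t < T \<longrightarrow> 0 \<le> u x t)
   \<and> (\<forall>\<tau>. 0 < \<tau> \<and> ereal \<tau> < T \<longrightarrow>
        ess_bounded (\<mu> \<Otimes>\<^sub>M restrict_space lborel {0<..<\<tau>}) (\<lambda>(x, t). u x t))
   \<and> (\<forall>t. 0 < t \<and> ereal t < T \<longrightarrow> integrable \<mu> (\<lambda>x. deriv (u x) t * \<eta> x))"

end

theory Submission
  imports Defs
begin

text \<open>
  Let \<open>\<Phi>(t) = k \<integral> u(\<sqdot>,t) \<eta> d\<mu>\<close>. Integrating by parts formally and using
  \<open>\<Delta>r \<le> C\<^sub>1 (n - 1) / r\<close>, \<open>\<langle>b, \<partial>\<^sub>r\<rangle> \<ge> - \<sigma> / r\<close>, \<open>div b \<le> C\<^sub>d\<close> and Jensen's inequality gives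
  \<open>\<Phi>' \<ge> \<Phi>\<^sup>q - lam \<Phi>\<close>, whose solutions blow up in finite time when \<open>\<Phi>(0)\<^sup>q\<^sup>-\<^sup>1 > lam\<close>.

  To avoid boundary terms at infinity, \<open>\<eta>\<close> is replaced by compactly supported functions \<open>P(r\<^sup>2)\<close> with \<open>P\<close>
  convex, decreasing and increasing to \<open>s \<mapsto> exp (- a s)\<close>. Since \<open>P'' \<ge> 0\<close>, the differential inequality survives
  up to an error that tends to zero as \<open>u\<close> is bounded on \<open>M \<times> (0,\<tau>)\<close>.

  The exponential map at the pole is a global chart, so that all integrals live on \<open>\<real>\<^sup>n\<close>. The geometric input is the
  Gauss lemma \<open>G(w) w = G(0) w\<close>, which identifies \<open>r\<^sup>2\<close> with the quadratic form \<open>G(0)\<close> and \<open>\<nabla>r\<close> with the radial field,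
  and the independence of the divergence of the chart.
\<close>

section \<open>Partial derivatives\<close>

text \<open>Multiplying \<eta> by a cutoff would leave second derivatives of the cutoff against u,
  whose decay needs an argument of its own. With a convex profile P of r^2 the only second-order
  term is 4 r^2 P'' u, which has the favourable sign and is dropped. The rest involves P and P'
  alone, and these are dominated by \<open>exp (- a * s)\<close> and its derivative, so that
  truncation does not change the constant \<open>lam\<close>; the sole error is the mass lost by
  truncation. The blow-up time is bounded in terms of \<open>q\<close>, \<open>lam\<close> and a
  threshold strictly between the critical value and \<Phi>(0). Hence a time \<tau> can be fixed
  beforehand, then the bound of u up to \<tau>, and only then the truncation. Profiles are functions
  of r^2 because r^2 is a polynomial in normal coordinates: the test functions stay C^2 at the pole.
  Bounds with a factor 1/r hold off the pole only, and the pole is a null set.\<close>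

lemma has_derivative_pd:
  fixes f :: "real^'n \<Rightarrow> 'b::real_normed_vector"
  assumes "f differentiable at y"
  shows "(f has_derivative (\<lambda>h. \<Sum>i\<in>UNIV. h $ i *\<^sub>R pd i f y)) (at y)"
proof -
  have D: "(f has_derivative frechet_derivative f (at y)) (at y)"
    using assms by (simp add: frechet_derivative_works)
  then interpret linear "frechet_derivative f (at y)"
    by (rule has_derivative_linear)
  have "frechet_derivative f (at y) h = (\<Sum>i\<in>UNIV. h $ i *\<^sub>R pd i f y)" for h
  proof -
    have "h = (\<Sum>i\<in>UNIV. h $ i *\<^sub>R axis i 1)"
      by (metis basis_expansion scalar_mult_eq_scaleR)
    then have "frechet_derivative f (at y) h = frechet_derivative f (at y) (\<Sum>i\<in>UNIV. h $ i *\<^sub>R axis i 1)"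
      by simp
    then show ?thesis
      by (simp add: sum scale pd_def)
  qed
  then have "frechet_derivative f (at y) = (\<lambda>h. \<Sum>i\<in>UNIV. h $ i *\<^sub>R pd i f y)"
    by blast
  then show ?thesis using D by simp
qed

lemma frechet_derivative_pd:
  fixes f :: "real^'n \<Rightarrow> 'b::real_normed_vector"
  assumes "f differentiable at y"
  shows "frechet_derivative f (at y) h = (\<Sum>i\<in>UNIV. h $ i *\<^sub>R pd i f y)"
  by (subst frechet_derivative_at[OF has_derivative_pd[OF assms], symmetric]) simp

lemma pd_eqI: "(f has_derivative f') (at y) \<Longrightarrow> pd i f y = f' (axis i 1)"
  unfolding pd_def by (metis frechet_derivative_at)

lemma sum_axis [simp]:
  fixes D :: "'n::finite \<Rightarrow> 'b::real_vector"
  shows "(\<Sum>j\<in>UNIV. axis i (1::real) $ j *\<^sub>R D j) = D i"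
proof -
  have "(\<Sum>j\<in>UNIV. axis i (1::real) $ j *\<^sub>R D j) = (\<Sum>j\<in>UNIV. if j = i then D j else 0)"
    by (intro sum.cong) (auto simp: axis_def)
  then show ?thesis by simp
qed

lemma pd_eq_sumI:
  fixes f :: "real^'n \<Rightarrow> 'b::real_normed_vector"
  assumes "(f has_derivative (\<lambda>h. \<Sum>i\<in>UNIV. h $ i *\<^sub>R D i)) (at y)"
  shows "pd i f y = D i"
  by (subst pd_eqI[OF assms]) simp

text \<open>Both sides are choices from the set of derivatives at \<open>y\<close>, and this set
  depends only on the values near \<open>y\<close>; so the equality covers nondifferentiable
  functions too.\<close>

lemma pd_cong_open:
  assumes "open S" "y \<in> S" "\<And>z. z \<in> S \<Longrightarrow> f z = h z"
  shows "pd i f y = pd i h y"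
proof -
  have "(f has_derivative F) (at y) \<longleftrightarrow> (h has_derivative F) (at y)" for F
    using has_derivative_transform_within_open[OF _ assms(1,2), of f F UNIV h]
      has_derivative_transform_within_open[OF _ assms(1,2), of h F UNIV f] assms(3) by metis
  then show ?thesis unfolding pd_def frechet_derivative_def by simp
qed

lemma Ck_Suc_cong_open:
  assumes "open S" "\<And>z. z \<in> S \<Longrightarrow> f z = h z" "Ck_on k f S"
  shows "Ck_on k h S"
  using assms(2,3)
proof (induction k arbitrary: f h)
  case 0
  then show ?case by (auto cong: continuous_on_cong)
next
  case (Suc k)
  have "h differentiable_on S"
    unfolding differentiable_on_def
  proof
    fix x assume x: "x \<in> S"
    then have "f differentiable (at x within S)"
      using Suc.prems(2) by (simp add: differentiable_on_def)
    then show "h differentiable (at x within S)"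
      unfolding differentiable_def using has_derivative_transform[OF x, of h f] Suc.prems(1) by metis
  qed
  moreover have "Ck_on k (pd i h) S" for i
  proof (rule Suc.IH[of "pd i f"])
    show "pd i f z = pd i h z" if "z \<in> S" for z
      by (rule pd_cong_open[OF assms(1) that Suc.prems(1)])
    show "Ck_on k (pd i f) S" using Suc.prems(2) by simp
  qed
  ultimately show ?case by simp
qed

lemma Ck_on_subset: "Ck_on k f S \<Longrightarrow> T \<subseteq> S \<Longrightarrow> Ck_on k f T"
proof (induction k arbitrary: f)
  case 0
  then show ?case using continuous_on_subset by auto
next
  case (Suc k)
  have "f differentiable_on T"
    using Suc.prems differentiable_on_subset[of f S T] by simp
  moreover have "Ck_on k (pd i f) T" for i
    by (rule Suc.IH) (use Suc.prems in simp_all)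
  ultimately show ?case by simp
qed

section \<open>Closure properties of the class C^1\<close>

abbreviation C1_on :: "(real^'n \<Rightarrow> 'b::real_normed_vector) \<Rightarrow> (real^'n) set \<Rightarrow> bool" where
  "C1_on f S \<equiv> Ck_on (Suc 0) f S"

text \<open>One derivative formula with freely named coefficients \<open>D\<close> yields
  differentiability and the values of \<open>pd\<close> together, so each closure property below
  reduces to such a formula.\<close>

lemma C1_onI:
  fixes f :: "real^'n \<Rightarrow> 'b::real_normed_vector"
  assumes S: "open S"
    and D: "\<And>y. y \<in> S \<Longrightarrow> (f has_derivative (\<lambda>h. \<Sum>i\<in>UNIV. h $ i *\<^sub>R D i y)) (at y)"
    and "\<And>i. continuous_on S (D i)"
  shows "C1_on f S"
proof -
  have "f differentiable_on S"
    using D by (blast intro: differentiable_at_imp_differentiable_on differentiableI)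
  moreover have "continuous_on S (pd i f)" for i
    by (rule continuous_on_eq[OF assms(3)]) (rule pd_eq_sumI[OF D, symmetric])
  ultimately show ?thesis by simp
qed

lemma C1_on_differentiable: "C1_on f S \<Longrightarrow> open S \<Longrightarrow> y \<in> S \<Longrightarrow> f differentiable at y"
  by (simp add: differentiable_on_eq_differentiable_at)

lemma C1_on_has_derivative:
  "C1_on f S \<Longrightarrow> open S \<Longrightarrow> y \<in> S \<Longrightarrow> (f has_derivative (\<lambda>h. \<Sum>i\<in>UNIV. h $ i *\<^sub>R pd i f y)) (at y)"
  using C1_on_differentiable has_derivative_pd by blast

lemma C1_on_pd: "C1_on f S \<Longrightarrow> continuous_on S (pd i f)"
  by simp

lemma C1_on_continuous: "C1_on f S \<Longrightarrow> continuous_on S f"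
  by (simp add: differentiable_imp_continuous_on)

lemma Ck_on_2_pd: "Ck_on 2 f S \<Longrightarrow> C1_on (pd i f) S"
  by (simp add: numeral_2_eq_2)

lemma Ck_on_C1: "Ck_on (Suc (Suc k)) f S \<Longrightarrow> C1_on f S"
  by (simp add: differentiable_imp_continuous_on)

lemma Ck_on_2_C1: "Ck_on 2 f S \<Longrightarrow> C1_on f S"
  by (metis Ck_on_C1 numeral_2_eq_2)

lemma smooth_on_C1: "smooth_on f S \<Longrightarrow> C1_on f S"
  unfolding smooth_on_def by blast

lemma smooth_on_Ck2: "smooth_on f S \<Longrightarrow> Ck_on 2 f S"
  unfolding smooth_on_def by blast

lemma C1_on_const [intro]: "open S \<Longrightarrow> C1_on (\<lambda>y. c) S"
  by (rule C1_onI[where D="\<lambda>_ _. 0"]) (auto intro!: derivative_eq_intros)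

lemma C1_on_compose_linear:
  assumes "open S" "bounded_linear L" "C1_on f S"
  shows "C1_on (\<lambda>y. L (f y)) S"
proof (rule C1_onI[where D="\<lambda>i y. L (pd i f y)"])
  interpret L: bounded_linear L by fact
  show "((\<lambda>y. L (f y)) has_derivative (\<lambda>h. \<Sum>i\<in>UNIV. h $ i *\<^sub>R L (pd i f y))) (at y)" if "y \<in> S" for y
    using L.has_derivative[OF C1_on_has_derivative[OF assms(3,1) that]]
    by (simp add: L.sum L.scale)
  show "continuous_on S (\<lambda>y. L (pd i f y))" for i
    using C1_on_pd[OF assms(3)] by (rule L.continuous_on)
qed fact

lemma C1_on_nth: "open S \<Longrightarrow> C1_on f S \<Longrightarrow> C1_on (\<lambda>y. f y $ i) S"
  using C1_on_compose_linear bounded_linear_vec_nth by blast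

lemma pd_nth:
  "f differentiable at y \<Longrightarrow> pd i (\<lambda>y. f y $ k) y = pd i f y $ k"
  using pd_eq_sumI[of "\<lambda>y. f y $ k" "\<lambda>i. pd i f y $ k" y i]
    bounded_linear.has_derivative[OF bounded_linear_vec_nth has_derivative_pd, of f y k]
  by (simp add: sum_component)

lemma C1_on_add:
  assumes S: "open S" and f: "C1_on f S" and g: "C1_on g S"
  shows "C1_on (\<lambda>y. f y + g y) S"
  using C1_on_pd[OF f] C1_on_pd[OF g]
  by (intro C1_onI[OF S, where D="\<lambda>i y. pd i f y + pd i g y"])
    (auto intro!: continuous_intros derivative_eq_intros C1_on_has_derivative[OF f S] C1_on_has_derivative[OF g S]
      simp: sum.distrib scaleR_add_right)

lemma C1_on_sum:
  assumes S: "open S" and "\<And>k. k \<in> K \<Longrightarrow> C1_on (f k) S"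
  shows "C1_on (\<lambda>y. \<Sum>k\<in>K. f k y) S"
proof (cases "finite K")
  case True
  then show ?thesis using assms(2)
    by (induction K) (auto intro!: C1_on_add[OF S] C1_on_const[OF S] simp del: Ck_on.simps)
next
  case False
  then show ?thesis using C1_on_const[OF S] by auto
qed

lemma C1_on_vec:
  fixes f :: "real^'n \<Rightarrow> real^'k"
  assumes S: "open S" and f: "\<And>k. C1_on (\<lambda>y. f y $ k) S"
  shows "C1_on f S"
proof -
  have eq: "(\<Sum>k\<in>UNIV. x $ k *\<^sub>R axis k 1) = x" for x :: "real^'k"
    by (metis basis_expansion scalar_mult_eq_scaleR)
  have "C1_on (\<lambda>y. \<Sum>k\<in>UNIV. f y $ k *\<^sub>R axis k (1::real)) S"
    by (intro C1_on_sum[OF S] C1_on_compose_linear[OF S _ f, of "\<lambda>t. t *\<^sub>R axis _ 1"])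
      (rule bounded_linear_scaleR_left)
  then show ?thesis by (simp only: eq)
qed

lemma C1_on_mult:
  fixes f g :: "real^'n \<Rightarrow> real"
  assumes S: "open S" and f: "C1_on f S" and g: "C1_on g S"
  shows "C1_on (\<lambda>y. f y * g y) S"
proof (rule C1_onI[OF S, where D="\<lambda>i y. f y * pd i g y + pd i f y * g y"])
  show "((\<lambda>y. f y * g y) has_derivative
     (\<lambda>h. \<Sum>i\<in>UNIV. h $ i *\<^sub>R (f y * pd i g y + pd i f y * g y))) (at y)" if "y \<in> S" for y
    using has_derivative_mult[OF C1_on_has_derivative[OF f S that] C1_on_has_derivative[OF g S that]]
    by (simp add: sum_distrib_left sum_distrib_right sum.distrib algebra_simps)
  show "continuous_on S (\<lambda>y. f y * pd i g y + pd i f y * g y)" for i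
    by (intro continuous_intros C1_on_pd f g C1_on_continuous[OF f] C1_on_continuous[OF g])
qed

lemma C1_on_prod:
  fixes f :: "'k \<Rightarrow> real^'n \<Rightarrow> real"
  assumes S: "open S" and "\<And>k. k \<in> K \<Longrightarrow> C1_on (f k) S"
  shows "C1_on (\<lambda>y. \<Prod>k\<in>K. f k y) S"
proof (cases "finite K")
  case True
  then show ?thesis using assms(2)
    by (induction K) (auto intro!: C1_on_mult[OF S] C1_on_const[OF S] simp del: Ck_on.simps)
next
  case False
  then show ?thesis using C1_on_const[OF S] by auto
qed

lemma C1_on_real_compose:
  fixes f :: "real^'n \<Rightarrow> real"
  assumes S: "open S" and f: "C1_on f S"
    and h: "\<And>y. y \<in> S \<Longrightarrow> (h has_field_derivative h' (f y)) (at (f y))"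
    and h': "continuous_on (f ` S) h'"
  shows "C1_on (\<lambda>y. h (f y)) S"
proof (rule C1_onI[OF S, where D="\<lambda>i y. h' (f y) * pd i f y"])
  show "((\<lambda>y. h (f y)) has_derivative (\<lambda>k. \<Sum>i\<in>UNIV. k $ i *\<^sub>R (h' (f y) * pd i f y))) (at y)"
    if "y \<in> S" for y
    using has_derivative_compose[OF C1_on_has_derivative[OF f S that] h[OF that, unfolded has_field_derivative_def]]
    by (simp add: sum_distrib_left mult_ac)
  show "continuous_on S (\<lambda>y. h' (f y) * pd i f y)" for i
    using continuous_on_compose[OF C1_on_continuous[OF f] h']
    by (intro continuous_intros C1_on_pd[OF f]) (simp add: o_def)
qed

section \<open>Sum, product and chain rules for \<open>pd\<close>\<close>

lemma pd_compose_real: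
  fixes f :: "real^'n \<Rightarrow> real"
  assumes "f differentiable at y" "(h has_field_derivative h') (at (f y))"
  shows "pd i (\<lambda>y. h (f y)) y = h' * pd i f y"
  by (rule pd_eq_sumI[OF has_derivative_eq_rhs[OF has_derivative_compose[OF has_derivative_pd[OF assms(1)]
    assms(2)[unfolded has_field_derivative_def]]]])
    (simp add: sum_distrib_left mult_ac)

lemma pd_mult:
  fixes f g :: "real^'n \<Rightarrow> real"
  assumes "f differentiable at y" "g differentiable at y"
  shows "pd i (\<lambda>y. f y * g y) y = f y * pd i g y + pd i f y * g y"
  by (rule pd_eq_sumI[OF has_derivative_eq_rhs[OF has_derivative_mult[OF has_derivative_pd[OF assms(1)] has_derivative_pd[OF assms(2)]]]])
    (simp add: sum_distrib_left sum_distrib_right sum.distrib algebra_simps)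

lemma pd_add:
  assumes "f differentiable at y" "g differentiable at y"
  shows "pd i (\<lambda>y. f y + g y) y = pd i f y + pd i g y"
  by (rule pd_eq_sumI[OF has_derivative_eq_rhs[OF has_derivative_add[OF has_derivative_pd[OF assms(1)] has_derivative_pd[OF assms(2)]]]])
    (simp add: sum.distrib scaleR_add_right)

lemma pd_sum:
  assumes "finite K" "\<And>k. k \<in> K \<Longrightarrow> f k differentiable at y"
  shows "pd i (\<lambda>y. \<Sum>k\<in>K. f k y) y = (\<Sum>k\<in>K. pd i (f k) y)"
proof (rule pd_eq_sumI[OF has_derivative_eq_rhs[OF has_derivative_sum[where f'="\<lambda>k h. \<Sum>i\<in>UNIV. h $ i *\<^sub>R pd i (f k) y"]]])
  show "(f k has_derivative (\<lambda>h. \<Sum>i\<in>UNIV. h $ i *\<^sub>R pd i (f k) y)) (at y)" if "k \<in> K" for k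
    by (rule has_derivative_pd[OF assms(2)[OF that]])
  show "(\<lambda>x. \<Sum>i\<in>K. \<Sum>j\<in>UNIV. x $ j *\<^sub>R pd j (f i) y) =
    (\<lambda>h. \<Sum>i\<in>UNIV. h $ i *\<^sub>R (\<Sum>k\<in>K. pd i (f k) y))"
    by (subst sum.swap) (simp add: scaleR_sum_right)
qed

lemma pd_const [simp]: "pd i (\<lambda>y. c) y = 0"
  by (rule pd_eq_sumI[where D="\<lambda>_. 0"]) (auto intro!: derivative_eq_intros)

lemma pd_coord [simp]: "pd i (\<lambda>y. y $ k) y = (if i = k then 1 else 0)"
  using pd_eqI[OF bounded_linear_imp_has_derivative[OF bounded_linear_vec_nth], of i k y]
  by (simp add: axis_def eq_commute)

lemma coord_differentiable: "(\<lambda>y. y $ i) differentiable at (y :: real^'k)"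
  by (rule bounded_linear_imp_differentiable[OF bounded_linear_vec_nth])

lemma coord_C1: "open S \<Longrightarrow> C1_on (\<lambda>y::real^'k. y $ i) S"
  by (auto intro!: differentiable_at_imp_differentiable_on coord_differentiable cong: continuous_on_cong)

lemma has_derivative_chain_pd:
  fixes f :: "real^'k \<Rightarrow> 'b::real_normed_vector" and T :: "real^'n \<Rightarrow> real^'k"
  assumes "T differentiable at y" "f differentiable at (T y)"
  shows "((\<lambda>z. f (T z)) has_derivative
    (\<lambda>h. \<Sum>i\<in>UNIV. h $ i *\<^sub>R (\<Sum>k\<in>UNIV. (pd i T y $ k) *\<^sub>R pd k f (T y)))) (at y)"
proof (rule has_derivative_eq_rhs[OF has_derivative_compose[OF has_derivative_pd[OF assms(1)] has_derivative_pd[OF assms(2)]]])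
  show "(\<lambda>h. \<Sum>k\<in>UNIV. (\<Sum>i\<in>UNIV. h $ i *\<^sub>R pd i T y) $ k *\<^sub>R pd k f (T y)) =
    (\<lambda>h. \<Sum>i\<in>UNIV. h $ i *\<^sub>R (\<Sum>k\<in>UNIV. (pd i T y $ k) *\<^sub>R pd k f (T y)))"
    by (simp add: sum_component scaleR_sum_left scaleR_sum_right)
      (subst sum.swap, simp)
qed

lemma pd_chain:
  fixes f :: "real^'k \<Rightarrow> 'b::real_normed_vector" and T :: "real^'n \<Rightarrow> real^'k"
  assumes "T differentiable at y" "f differentiable at (T y)"
  shows "pd i (\<lambda>z. f (T z)) y = (\<Sum>k\<in>UNIV. (pd i T y $ k) *\<^sub>R pd k f (T y))"
  by (rule pd_eq_sumI[OF has_derivative_chain_pd[OF assms]])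

lemma C1_on_compose:
  fixes f :: "real^'k \<Rightarrow> 'b::real_normed_vector" and T :: "real^'n \<Rightarrow> real^'k"
  assumes S: "open S" and U: "open U" and T: "C1_on T S" and f: "C1_on f U" and TU: "T ` S \<subseteq> U"
  shows "C1_on (\<lambda>z. f (T z)) S"
proof (rule C1_onI[OF S])
  show "((\<lambda>z. f (T z)) has_derivative
    (\<lambda>h. \<Sum>i\<in>UNIV. h $ i *\<^sub>R (\<Sum>k\<in>UNIV. (pd i T y $ k) *\<^sub>R pd k f (T y)))) (at y)" if "y \<in> S" for y
    using that TU by (intro has_derivative_chain_pd C1_on_differentiable[OF T S] C1_on_differentiable[OF f U]) auto
  have "continuous_on S (\<lambda>y. pd k f (T y))" for k
    using continuous_on_compose2[OF C1_on_pd[OF f] C1_on_continuous[OF T] TU] .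
  then show "continuous_on S (\<lambda>y. \<Sum>k\<in>UNIV. (pd i T y $ k) *\<^sub>R pd k f (T y))" for i
    by (intro continuous_intros C1_on_pd[OF T])
qed

section \<open>Regularity of determinants, quotients, square roots and inverse matrices\<close>

lemma C1_on_det:
  fixes M :: "real^'n \<Rightarrow> real^'k^'k"
  assumes "open S" "\<And>i j. C1_on (\<lambda>y. M y $ i $ j) S"
  shows "C1_on (\<lambda>y. det (M y)) S"
  unfolding det_def using assms
  by (intro C1_on_sum C1_on_mult C1_on_prod C1_on_const)

lemma C1_on_divide:
  fixes f g :: "real^'n \<Rightarrow> real"
  assumes S: "open S" and f: "C1_on f S" and g: "C1_on g S" and nz: "\<And>y. y \<in> S \<Longrightarrow> g y \<noteq> 0"
  shows "C1_on (\<lambda>y. f y / g y) S"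
proof -
  have "C1_on (\<lambda>y. inverse (g y)) S"
    by (rule C1_on_real_compose[OF S g, where h'="\<lambda>x. - (inverse x ^ 2)"])
      (use nz in \<open>auto intro!: derivative_eq_intros continuous_intros simp: power2_eq_square\<close>)
  from C1_on_mult[OF S f this] show ?thesis by (simp add: divide_inverse)
qed

lemma C1_on_sqrt:
  fixes g :: "real^'n \<Rightarrow> real"
  assumes S: "open S" and g: "C1_on g S" and pos: "\<And>y. y \<in> S \<Longrightarrow> g y > 0"
  shows "C1_on (\<lambda>y. sqrt (g y)) S"
  by (rule C1_on_real_compose[OF S g, where h'="\<lambda>x. inverse (sqrt x) / 2"])
    (use pos in \<open>auto intro!: DERIV_real_sqrt continuous_intros simp: less_imp_neq[symmetric]\<close>)

lemma
  fixes M :: "real^'n^'n" assumes "det M \<noteq> 0"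
  shows matrix_inv_right: "M ** matrix_inv M = mat 1"
    and matrix_inv_left: "matrix_inv M ** M = mat 1"
proof -
  have "\<exists>N. M ** N = mat 1 \<and> N ** M = mat 1"
    using assms by (simp add: invertible_det_nz[symmetric] invertible_def)
  from someI_ex[OF this] show "M ** matrix_inv M = mat 1" "matrix_inv M ** M = mat 1"
    by (simp_all add: matrix_inv_def)
qed

text \<open>Cramer's rule. It shows the entries of \<open>matrix_inv\<close>, which is defined by
  choice, to be quotients of determinants, and thus as regular as the entries of
  \<open>M\<close>.\<close>

lemma matrix_inv_entry:
  fixes M :: "real^'n^'n" assumes "det M \<noteq> 0"
  shows "matrix_inv M $ k $ l = det (\<chi> i j. if j = k then axis l 1 $ i else M $ i $ j) / det M"
proof -
  have "M *v (matrix_inv M *v axis l 1) = axis l 1"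
    by (simp add: matrix_vector_mul_assoc matrix_inv_right[OF assms])
  from this[unfolded cramer[OF assms]] have "(matrix_inv M *v axis l 1) $ k = det (\<chi> i j. if j = k then axis l 1 $ i else M $ i $ j) / det M"
    by simp
  moreover have "(matrix_inv M *v axis l 1) $ k = matrix_inv M $ k $ l"
    by (simp add: matrix_vector_mult_basis column_def)
  ultimately show ?thesis by simp
qed

lemma C1_on_matrix_inv:
  fixes M :: "real^'n \<Rightarrow> real^'k^'k"
  assumes S: "open S" and M: "\<And>i j. C1_on (\<lambda>y. M y $ i $ j) S" and nz: "\<And>y. y \<in> S \<Longrightarrow> det (M y) \<noteq> 0"
  shows "C1_on (\<lambda>y. matrix_inv (M y) $ k $ l) S"
proof -
  have "C1_on (\<lambda>y. det (\<chi> i j. if j = k then axis l 1 $ i else M y $ i $ j) / det (M y)) S"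
  proof (intro C1_on_divide[OF S] C1_on_det[OF S] M nz)
    show "C1_on (\<lambda>y. (\<chi> i j. if j = k then axis l 1 $ i else M y $ i $ j) $ i $ j) S" for i j
      using M[of i j] C1_on_const[OF S] by (cases "j = k") (simp_all del: Ck_on.simps)
  qed
  then show ?thesis
    by (rule Ck_Suc_cong_open[OF S, rotated]) (simp add: matrix_inv_entry nz)
qed

subsection \<open>Symmetry of second derivatives\<close>

lemma DERIV_pd_line:
  fixes f :: "real^'n \<Rightarrow> real"
  assumes "f differentiable at (y + s *\<^sub>R axis i 1)"
  shows "((\<lambda>s. f (y + s *\<^sub>R axis i 1)) has_real_derivative pd i f (y + s *\<^sub>R axis i 1)) (at s)"
proof -
  have "((\<lambda>s. y + s *\<^sub>R axis i 1) has_derivative (\<lambda>h. h *\<^sub>R axis i 1)) (at s)"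
    by (auto intro!: derivative_eq_intros)
  note D = has_derivative_compose[OF this has_derivative_pd[OF assms]]
  have "(\<Sum>k\<in>UNIV. (h *\<^sub>R axis i (1::real)) $ k *\<^sub>R p k) = p i * h" for h :: real and p :: "'n \<Rightarrow> real"
  proof -
    have "(\<Sum>k\<in>UNIV. (h *\<^sub>R axis i (1::real)) $ k *\<^sub>R p k) = h * (\<Sum>k\<in>UNIV. axis i (1::real) $ k *\<^sub>R p k)"
      by (simp add: sum_distrib_left mult.assoc)
    then show ?thesis by (simp only: sum_axis) (simp add: mult.commute)
  qed
  with D show ?thesis
    by (simp only: has_field_derivative_def)
qed

text \<open>Two applications of the mean value theorem, first in direction \<open>i\<close>, then in
  direction \<open>j\<close>. The radius \<open>2 * h\<close> contains the parallelogram with sides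
  \<open>h\<close> by the triangle inequality, also for \<open>i = j\<close>.\<close>

lemma second_difference:
  fixes f :: "real^'n \<Rightarrow> real"
  assumes S: "open S" and f: "Ck_on 2 f S" and h: "0 < h" and B: "cball y (2 * h) \<subseteq> S"
  obtains z where "z \<in> cball y (2 * h)"
    "f (y + h *\<^sub>R axis i 1 + h *\<^sub>R axis j 1) - f (y + h *\<^sub>R axis i 1) - (f (y + h *\<^sub>R axis j 1) - f y)
      = h\<^sup>2 * pd j (pd i f) z"
proof -
  have inB: "y + s *\<^sub>R axis i 1 + t *\<^sub>R axis j 1 \<in> cball y (2 * h)" if "0 \<le> s" "s \<le> h" "0 \<le> t" "t \<le> h" for s t
  proof -
    have "norm (s *\<^sub>R axis i (1::real) + t *\<^sub>R axis j 1) \<le> s + t"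
      using that norm_triangle_ineq[of "s *\<^sub>R axis i (1::real)" "t *\<^sub>R axis j 1"] by simp
    then show ?thesis using that by (simp only: mem_cball dist_norm norm_minus_commute[of y]) (simp add: add.assoc)
  qed
  note fd = C1_on_differentiable[OF Ck_on_2_C1[OF f] S]
  note pfd = C1_on_differentiable[OF Ck_on_2_pd[OF f] S]
  \<comment> \<open>The difference in direction \<open>j\<close>, as a function of the step in
    direction \<open>i\<close>.\<close>
  define \<phi> where "\<phi> s = f (y + h *\<^sub>R axis j 1 + s *\<^sub>R axis i 1) - f (y + s *\<^sub>R axis i 1)" for s
  have "\<exists>\<xi>. 0 < \<xi> \<and> \<xi> < h \<and> \<phi> h - \<phi> 0 = (h - 0) * (pd i f (y + h *\<^sub>R axis j 1 + \<xi> *\<^sub>R axis i 1) - pd i f (y + \<xi> *\<^sub>R axis i 1))"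
  proof (rule MVT2[OF h])
    fix s :: real assume s: "0 \<le> s" "s \<le> h"
    have "y + h *\<^sub>R axis j 1 + s *\<^sub>R axis i 1 \<in> S" "y + s *\<^sub>R axis i 1 \<in> S"
      using B inB[of s h] inB[of s 0] s h by (auto simp: algebra_simps)
    then show "(\<phi> has_real_derivative pd i f (y + h *\<^sub>R axis j 1 + s *\<^sub>R axis i 1) - pd i f (y + s *\<^sub>R axis i 1)) (at s)"
      unfolding \<phi>_def by (intro DERIV_diff DERIV_pd_line fd)
  qed
  then obtain \<xi> where \<xi>: "0 < \<xi>" "\<xi> < h"
    "\<phi> h - \<phi> 0 = h * (pd i f (y + h *\<^sub>R axis j 1 + \<xi> *\<^sub>R axis i 1) - pd i f (y + \<xi> *\<^sub>R axis i 1))"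
    by auto
  define \<psi> where "\<psi> t = pd i f (y + \<xi> *\<^sub>R axis i 1 + t *\<^sub>R axis j 1)" for t
  have "\<exists>\<zeta>. 0 < \<zeta> \<and> \<zeta> < h \<and> \<psi> h - \<psi> 0 = (h - 0) * pd j (pd i f) (y + \<xi> *\<^sub>R axis i 1 + \<zeta> *\<^sub>R axis j 1)"
  proof (rule MVT2[OF h])
    fix t :: real assume t: "0 \<le> t" "t \<le> h"
    have "y + \<xi> *\<^sub>R axis i 1 + t *\<^sub>R axis j 1 \<in> S"
      using B inB[of \<xi> t] t \<xi> by auto
    then show "(\<psi> has_real_derivative pd j (pd i f) (y + \<xi> *\<^sub>R axis i 1 + t *\<^sub>R axis j 1)) (at t)"
      unfolding \<psi>_def by (intro DERIV_pd_line pfd)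
  qed
  then obtain \<zeta> where \<zeta>: "0 < \<zeta>" "\<zeta> < h"
    "\<psi> h - \<psi> 0 = h * pd j (pd i f) (y + \<xi> *\<^sub>R axis i 1 + \<zeta> *\<^sub>R axis j 1)"
    by auto
  show ?thesis
  proof
    show "y + \<xi> *\<^sub>R axis i 1 + \<zeta> *\<^sub>R axis j 1 \<in> cball y (2 * h)"
      using inB \<xi> \<zeta> by auto
    have "\<phi> h - \<phi> 0 = h * (\<psi> h - \<psi> 0)"
      using \<xi>(3) by (simp add: \<psi>_def algebra_simps)
    then show "f (y + h *\<^sub>R axis i 1 + h *\<^sub>R axis j 1) - f (y + h *\<^sub>R axis i 1) - (f (y + h *\<^sub>R axis j 1) - f y)
      = h\<^sup>2 * pd j (pd i f) (y + \<xi> *\<^sub>R axis i 1 + \<zeta> *\<^sub>R axis j 1)"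
      by (simp add: \<zeta>(3) \<phi>_def power2_eq_square algebra_simps)
  qed
qed

text \<open>The second difference is symmetric in \<open>i\<close> and \<open>j\<close>, so it
  equals h^2 times either mixed derivative, taken at two points close to \<open>y\<close>.
  Continuity of both mixed derivatives at \<open>y\<close> does the rest.\<close>

lemma pd_symmetric:
  fixes f :: "real^'n \<Rightarrow> real"
  assumes S: "open S" and f: "Ck_on 2 f S" and y: "y \<in> S"
  shows "pd i (pd j f) y = pd j (pd i f) y"
proof (rule ccontr)
  assume ne: "\<not> ?thesis"
  \<comment> \<open>Half of the supposed gap: the mixed derivatives agree when taken at
    \<open>z\<close> and \<open>w\<close>, and each differs from its value at \<open>y\<close> by
    less than \<open>e\<close>, which cannot bridge the gap.\<close>
  define e where "e = \<bar>pd i (pd j f) y - pd j (pd i f) y\<bar> / 2"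
  have e: "e > 0" using ne by (simp add: e_def)
  have c: "continuous (at y) (pd k (pd l f))" for k l
    using C1_on_pd[OF Ck_on_2_pd[OF f]] S y by (simp add: continuous_on_eq_continuous_at)
  from c[of i j] e obtain d1 where d1: "d1 > 0" "\<And>z. dist z y < d1 \<Longrightarrow> dist (pd i (pd j f) z) (pd i (pd j f) y) < e"
    unfolding continuous_at_eps_delta by metis
  from c[of j i] e obtain d2 where d2: "d2 > 0" "\<And>z. dist z y < d2 \<Longrightarrow> dist (pd j (pd i f) z) (pd j (pd i f) y) < e"
    unfolding continuous_at_eps_delta by metis
  obtain d3 where d3: "d3 > 0" "cball y d3 \<subseteq> S"
    using S y open_contains_cball by blast
  define h where "h = min d1 (min d2 d3) / 4"
  have h: "h > 0" "2 * h < d1" "2 * h < d2" "2 * h \<le> d3"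
    using d1(1) d2(1) d3(1) by (auto simp: h_def)
  have B: "cball y (2 * h) \<subseteq> S" using h d3 by (meson cball_subset_cball_iff order_trans subset_cball)
  obtain z where z: "z \<in> cball y (2 * h)"
    "f (y + h *\<^sub>R axis i 1 + h *\<^sub>R axis j 1) - f (y + h *\<^sub>R axis i 1) - (f (y + h *\<^sub>R axis j 1) - f y)
      = h\<^sup>2 * pd j (pd i f) z"
    by (rule second_difference[OF S f h(1) B])
  obtain w where w: "w \<in> cball y (2 * h)"
    "f (y + h *\<^sub>R axis j 1 + h *\<^sub>R axis i 1) - f (y + h *\<^sub>R axis j 1) - (f (y + h *\<^sub>R axis i 1) - f y)
      = h\<^sup>2 * pd i (pd j f) w"
    by (rule second_difference[OF S f h(1) B])
  have "h\<^sup>2 * pd j (pd i f) z = h\<^sup>2 * pd i (pd j f) w"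
    by (simp add: z(2)[symmetric] w(2)[symmetric] algebra_simps)
  then have "pd j (pd i f) z = pd i (pd j f) w" using h(1) by simp
  moreover have "dist (pd i (pd j f) w) (pd i (pd j f) y) < e"
    using w h by (intro d1(2)) (auto simp: dist_commute)
  moreover have "dist (pd j (pd i f) z) (pd j (pd i f) y) < e"
    using z h by (intro d2(2)) (auto simp: dist_commute)
  ultimately show False by (simp add: e_def dist_real_def abs_if split: if_splits)
qed

subsection \<open>Derivative of the determinant\<close>

lemma pd_prod:
  fixes f :: "'k \<Rightarrow> real^'n \<Rightarrow> real"
  assumes "finite K" "\<And>k. k \<in> K \<Longrightarrow> f k differentiable at y"
  shows "pd i (\<lambda>y. \<Prod>k\<in>K. f k y) y = (\<Sum>k\<in>K. pd i (f k) y * (\<Prod>j\<in>K - {k}. f j y))"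
proof (rule pd_eq_sumI[OF has_derivative_eq_rhs[OF has_derivative_prod[where f'="\<lambda>k h. \<Sum>i\<in>UNIV. h $ i *\<^sub>R pd i (f k) y"]]])
  show "(f k has_derivative (\<lambda>h. \<Sum>i\<in>UNIV. h $ i *\<^sub>R pd i (f k) y)) (at y)" if "k \<in> K" for k
    by (rule has_derivative_pd[OF assms(2)[OF that]])
  show "(\<lambda>h. \<Sum>i\<in>K. (\<Sum>j\<in>UNIV. h $ j *\<^sub>R pd j (f i) y) * (\<Prod>j\<in>K - {i}. f j y)) =
    (\<lambda>h. \<Sum>i\<in>UNIV. h $ i *\<^sub>R (\<Sum>k\<in>K. pd i (f k) y * (\<Prod>j\<in>K - {k}. f j y)))"
    by (subst sum_distrib_right, subst sum.swap) (simp add: sum_distrib_left mult.assoc)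
qed

text \<open>By linearity in row \<open>k\<close>, every summand other than the \<open>k\<close>-th
  gives a matrix with two equal rows.\<close>

lemma det_replace_row:
  fixes A :: "real^'k^'k"
  shows "det (\<chi> i. if i = k then (\<Sum>m\<in>UNIV. c m *s A $ m) else A $ i) = c k * det A"
proof -
  have "det (\<chi> i. if i = k then (\<Sum>m\<in>UNIV. c m *s A $ m) else A $ i)
     = (\<Sum>m\<in>UNIV. c m * det (\<chi> i. if i = k then A $ m else A $ i))"
    by (simp add: det_linear_row_sum det_row_mul)
  also have "\<dots> = (\<Sum>m\<in>UNIV. if m = k then c m * det A else 0)"
  proof (rule sum.cong)
    fix m
    show "c m * det (\<chi> i. if i = k then A $ m else A $ i) = (if m = k then c m * det A else 0)"
    proof (cases "m = k")
      case True
      then have "(\<chi> i. if i = k then A $ m else A $ i) = A"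
        by (simp add: vec_eq_iff)
      then show ?thesis using True by simp
    next
      case False
      have "det (\<chi> i. if i = k then A $ m else A $ i) = 0"
        by (rule det_identical_rows[OF False]) (use False in \<open>simp add: row_def vec_eq_iff\<close>)
      then show ?thesis using False by simp
    qed
  qed simp
  finally show ?thesis by simp
qed

text \<open>Jacobi's formula. The product rule in the Leibniz expansion gives a sum of determinants,
  in each of which one row is replaced by its derivative.\<close>

lemma pd_det:
  fixes M :: "real^'n \<Rightarrow> real^'k^'k"
  assumes M: "\<And>i j. (\<lambda>y. M y $ i $ j) differentiable at y" and B: "B ** M y = mat 1"
  shows "pd m (\<lambda>y. det (M y)) y = det (M y) * (\<Sum>k\<in>UNIV. \<Sum>l\<in>UNIV. B $ l $ k * pd m (\<lambda>y. M y $ k $ l) y)"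
proof -
  define D where "D k l = pd m (\<lambda>y. M y $ k $ l) y" for k l
  have sumswap: "pd m (\<lambda>y. det (M y)) y = (\<Sum>k\<in>UNIV. \<Sum>p | p permutes UNIV.
      of_int (sign p) * (D k (p k) * (\<Prod>j\<in>UNIV - {k}. M y $ j $ p j)))"
  proof -
    have dp: "(\<lambda>y. \<Prod>i\<in>UNIV. M y $ i $ p i) differentiable at y" for p
      unfolding differentiable_def
      by (rule exI, rule has_derivative_prod) (rule has_derivative_pd[OF M])
    have "pd m (\<lambda>y. det (M y)) y = (\<Sum>p | p permutes UNIV. pd m (\<lambda>y. of_int (sign p) * (\<Prod>i\<in>UNIV. M y $ i $ p i)) y)"
      unfolding det_def
      by (rule pd_sum) (auto simp: finite_permutations intro!: derivative_intros M dp)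
    also have "\<dots> = (\<Sum>p | p permutes UNIV. of_int (sign p) * pd m (\<lambda>y. \<Prod>i\<in>UNIV. M y $ i $ p i) y)"
      by (intro sum.cong refl, subst pd_mult) (auto intro!: derivative_intros dp)
    also have "\<dots> = (\<Sum>p | p permutes UNIV. of_int (sign p) * (\<Sum>k\<in>UNIV. D k (p k) * (\<Prod>j\<in>UNIV - {k}. M y $ j $ p j)))"
      by (intro sum.cong refl, subst pd_prod) (auto intro!: M simp: D_def)
    also have "\<dots> = (\<Sum>k\<in>UNIV. \<Sum>p | p permutes UNIV.
      of_int (sign p) * (D k (p k) * (\<Prod>j\<in>UNIV - {k}. M y $ j $ p j)))"
      by (simp add: sum_distrib_left) (rule sum.swap)
    finally show ?thesis .
  qed
  have "(\<Sum>p | p permutes UNIV. of_int (sign p) * (D k (p k) * (\<Prod>j\<in>UNIV - {k}. M y $ j $ p j)))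
     = det (\<chi> i. if i = k then (\<chi> l. D k l) else M y $ i)" for k
    unfolding det_def
  proof (intro sum.cong refl arg_cong2[where f="(*)"])
    fix p
    have "(\<Prod>i\<in>UNIV. (\<chi> i. if i = k then (\<chi> l. D k l) else M y $ i) $ i $ p i)
       = D k (p k) * (\<Prod>i\<in>UNIV - {k}. (\<chi> i. if i = k then (\<chi> l. D k l) else M y $ i) $ i $ p i)"
      by (subst prod.remove[of _ k]) auto
    then show "D k (p k) * (\<Prod>j\<in>UNIV - {k}. M y $ j $ p j)
       = (\<Prod>i\<in>UNIV. (\<chi> i. if i = k then (\<chi> l. D k l) else M y $ i) $ i $ p i)"
      by simp
  qed
  \<comment> \<open>As \<open>B\<close> inverts \<open>M y\<close>, the row of derivatives is
    recovered by multiplying it with \<open>B\<close> and then with \<open>M y\<close>. This writes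
    it as a combination of the rows of \<open>M y\<close>, from which \<open>det_replace_row\<close>
    extracts one coefficient.\<close>
  moreover have "(\<chi> l. D k l) = (\<Sum>i\<in>UNIV. (\<Sum>l\<in>UNIV. D k l * B $ l $ i) *s M y $ i)" for k
  proof -
    have "(\<Sum>i\<in>UNIV. (\<Sum>l\<in>UNIV. D k l * B $ l $ i) * M y $ i $ j) = D k j" for j
    proof -
      have "(\<Sum>i\<in>UNIV. (\<Sum>l\<in>UNIV. D k l * B $ l $ i) * M y $ i $ j)
         = (\<Sum>l\<in>UNIV. D k l * (B ** M y) $ l $ j)"
        unfolding matrix_matrix_mult_def
        by (simp add: sum_distrib_left sum_distrib_right mult.assoc) (rule sum.swap)
      also have "\<dots> = (\<Sum>l\<in>UNIV. if l = j then D k l else 0)"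
        by (intro sum.cong) (auto simp: B mat_def)
      finally show ?thesis by simp
    qed
    then show ?thesis by (simp add: vec_eq_iff sum_component)
  qed
  ultimately have "(\<Sum>p | p permutes UNIV. of_int (sign p) * (D k (p k) * (\<Prod>j\<in>UNIV - {k}. M y $ j $ p j)))
     = (\<Sum>l\<in>UNIV. D k l * B $ l $ k) * det (M y)" for k
    using det_replace_row[of k "\<lambda>i. \<Sum>l\<in>UNIV. D k l * B $ l $ i" "M y"] by (simp only:)
  then show ?thesis
    by (simp add: sumswap sum_distrib_left sum_distrib_right D_def mult_ac)
qed

section \<open>Charts, tangent vectors and the metric in coordinates\<close>

text \<open>On the segment from the identity to \<open>G\<close> all matrices are positive definite,
  hence injective, so the determinant keeps the sign that it has at the identity.\<close>

lemma posdef_det_pos: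
  fixes G :: "real^'n^'n"
  assumes "\<And>v. v \<noteq> 0 \<Longrightarrow> inner v (G *v v) > 0"
  shows "det G > 0"
proof (rule ccontr)
  assume neg: "\<not> det G > 0"
  define M where "M t = (\<chi> i j. (1 - t) * mat 1 $ i $ j + t * G $ i $ j)" for t
  have Mv: "M t *v v = (1 - t) *\<^sub>R v + t *\<^sub>R (G *v v)" for t v
  proof -
    have "M t *v v = (1 - t) *\<^sub>R (mat 1 *v v) + t *\<^sub>R (G *v v)"
      by (simp add: vec_eq_iff matrix_vector_mult_def M_def sum_distrib_left sum.distrib
          distrib_right mult.assoc)
    then show ?thesis by simp
  qed
  have ne: "det (M t) \<noteq> 0" if "0 \<le> t" "t \<le> 1" for t
  proof
    assume "det (M t) = 0"
    then obtain v where v: "v \<noteq> 0" "M t *v v = 0"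
      by (metis invertible_det_nz invertible_left_inverse matrix_left_invertible_ker)
    have "0 = inner v (M t *v v)" using v by simp
    also have "\<dots> = (1 - t) * inner v v + t * inner v (G *v v)"
      by (simp add: Mv inner_add_right)
    also have "\<dots> > 0"
    proof (cases "t = 0")
      case True then show ?thesis using v by simp
    next
      case False
      then have "t * inner v (G *v v) > 0" using that assms[OF v(1)] by simp
      moreover have "(1 - t) * inner v v \<ge> 0" using that by simp
      ultimately show ?thesis by simp
    qed
    finally show False by simp
  qed
  have "continuous_on {0..1} (\<lambda>t. det (M t))"
    unfolding det_def M_def by (intro continuous_intros)
  moreover have "M 1 = G" "M 0 = mat 1"
    by (simp_all add: M_def vec_eq_iff)
  then have "det (M 1) \<le> 0" "0 \<le> det (M 0)"
    using neg by simp_all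
  ultimately have "\<exists>t\<ge>0. t \<le> 1 \<and> det (M t) = 0"
    by (intro IVT2') auto
  then show False using ne by blast
qed

definition trans_map :: "('m, 'n::finite) chart \<Rightarrow> ('m, 'n) chart \<Rightarrow> real^'n \<Rightarrow> real^'n" where
  "trans_map c d = snd d \<circ> chart_inv c"

locale riem_mfd =
  fixes A :: "('m::topological_space, 'n::finite) chart set" and g :: "('m, 'n) metric"
  assumes riem: "riemannian_manifold A g"
begin

lemma is_chartD: "c \<in> A \<Longrightarrow> is_chart c"
  using riem by (simp add: riemannian_manifold_def smooth_structure_def)

lemma chart_open: "c \<in> A \<Longrightarrow> open (fst c)" "c \<in> A \<Longrightarrow> open (snd c ` fst c)"
  using is_chartD by (simp_all add: is_chart_def)

lemma chart_homeo: "c \<in> A \<Longrightarrow> homeomorphism (fst c) (snd c ` fst c) (snd c) (chart_inv c)"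
  using is_chartD by (simp add: is_chart_def)

lemma chart_inv_left [simp]: "c \<in> A \<Longrightarrow> p \<in> fst c \<Longrightarrow> chart_inv c (snd c p) = p"
  using chart_homeo by (simp add: homeomorphism_def)

lemma chart_at_in: "chart_at A p \<in> A" "p \<in> fst (chart_at A p)"
proof -
  have "p \<in> (\<Union>c\<in>A. fst c)"
    using riem by (simp add: riemannian_manifold_def smooth_structure_def)
  then have "\<exists>c. c \<in> A \<and> p \<in> fst c" by blast
  from someI_ex[OF this] show "chart_at A p \<in> A" "p \<in> fst (chart_at A p)"
    unfolding chart_at_def by blast+
qed

lemma chart_image_open:
  assumes c: "c \<in> A" and N: "open N" "N \<subseteq> fst c"
  shows "open (snd c ` N)"
proof -
  have "openin (top_of_set (fst c)) N" using N by (simp add: openin_open_eq chart_open(1)[OF c])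
  then have "openin (top_of_set (snd c ` fst c)) (snd c ` N)"
    using homeomorphism_imp_open_map[OF chart_homeo[OF c]] by blast
  then show ?thesis using chart_open(2)[OF c] by (simp add: openin_open_eq)
qed

lemma overlap_open: "c \<in> A \<Longrightarrow> d \<in> A \<Longrightarrow> open (snd c ` (fst c \<inter> fst d))"
  by (rule chart_image_open) (auto simp: chart_open)

lemma trans_smooth: "c \<in> A \<Longrightarrow> d \<in> A \<Longrightarrow> smooth_on (trans_map c d) (snd c ` (fst c \<inter> fst d))"
  using riem by (auto simp: riemannian_manifold_def smooth_structure_def smooth_compatible_def trans_map_def)

lemma trans_map_eq [simp]: "c \<in> A \<Longrightarrow> p \<in> fst c \<Longrightarrow> trans_map c d (snd c p) = snd d p"
  by (simp add: trans_map_def)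

lemma trans_differentiable:
  "c \<in> A \<Longrightarrow> d \<in> A \<Longrightarrow> p \<in> fst c \<Longrightarrow> p \<in> fst d \<Longrightarrow> trans_map c d differentiable at (snd c p)"
  by (rule C1_on_differentiable[OF smooth_on_C1[OF trans_smooth] overlap_open]) auto

section \<open>Tangent vectors under changes of charts\<close>

definition Dtrans :: "('m, 'n) chart \<Rightarrow> ('m, 'n) chart \<Rightarrow> 'm \<Rightarrow> real^'n \<Rightarrow> real^'n" where
  "Dtrans c d p = frechet_derivative (trans_map c d) (at (snd c p))"

lemma Dtrans_has_derivative:
  "c \<in> A \<Longrightarrow> d \<in> A \<Longrightarrow> p \<in> fst c \<Longrightarrow> p \<in> fst d \<Longrightarrow>
    (trans_map c d has_derivative Dtrans c d p) (at (snd c p))"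
  unfolding Dtrans_def using trans_differentiable frechet_derivative_works by blast

lemma Dtrans_linear:
  "c \<in> A \<Longrightarrow> d \<in> A \<Longrightarrow> p \<in> fst c \<Longrightarrow> p \<in> fst d \<Longrightarrow> linear (Dtrans c d p)"
  using Dtrans_has_derivative has_derivative_linear by blast

text \<open>The chain rule on the triple overlap, where the coordinate changes compose.\<close>

lemma Dtrans_cocycle:
  assumes "c \<in> A" "d \<in> A" "e \<in> A" "p \<in> fst c" "p \<in> fst d" "p \<in> fst e"
  shows "Dtrans d e p (Dtrans c d p w) = Dtrans c e p w"
proof -
  let ?S = "snd c ` (fst c \<inter> (fst d \<inter> fst e))"
  have S: "open ?S"
    by (rule chart_image_open[OF assms(1)]) (auto intro!: open_Int chart_open assms)
  have "(trans_map d e has_derivative Dtrans d e p) (at (trans_map c d (snd c p)))"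
    using Dtrans_has_derivative[of d e p] assms by simp
  from has_derivative_compose[OF Dtrans_has_derivative[of c d p] this] assms
  have "((\<lambda>y. trans_map d e (trans_map c d y)) has_derivative (\<lambda>w. Dtrans d e p (Dtrans c d p w))) (at (snd c p))"
    by simp
  then have "(trans_map c e has_derivative (\<lambda>w. Dtrans d e p (Dtrans c d p w))) (at (snd c p))"
    by (rule has_derivative_transform_within_open[OF _ S]) (use assms in \<open>auto simp: trans_map_def\<close>)
  from frechet_derivative_at[OF this] show ?thesis
    unfolding Dtrans_def by metis
qed

lemma Dtrans_id:
  assumes "c \<in> A" "p \<in> fst c"
  shows "Dtrans c c p w = w"
proof -
  have "((\<lambda>y. y) has_derivative (\<lambda>w. w)) (at (snd c p))" by simp
  then have "(trans_map c c has_derivative (\<lambda>w. w)) (at (snd c p))"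
    by (rule has_derivative_transform_within_open[OF _ chart_open(2)[OF assms(1)]])
      (use assms in \<open>auto simp: trans_map_def\<close>)
  from frechet_derivative_at[OF this] show ?thesis
    unfolding Dtrans_def by metis
qed

lemma tangent_space_iff:
  "v \<in> tangent_space A p \<longleftrightarrow>
     (\<forall>c\<in>A. \<forall>d\<in>A. p \<in> fst c \<longrightarrow> p \<in> fst d \<longrightarrow> v d = Dtrans c d p (v c))
   \<and> (\<forall>c. \<not> (c \<in> A \<and> p \<in> fst c) \<longrightarrow> v c = 0)"
  unfolding tangent_space_def Dtrans_def trans_map_def by auto

lemma tvec_of_eq: "tvec_of A c p w d = (if d \<in> A \<and> p \<in> fst d then Dtrans c d p w else 0)"
  by (simp add: tvec_of_def Dtrans_def trans_map_def)

lemma tvec_of_tangent: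
  assumes "c \<in> A" "p \<in> fst c"
  shows "tvec_of A c p w \<in> tangent_space A p"
  using assms by (auto simp: tangent_space_iff tvec_of_eq Dtrans_cocycle)

lemma tvec_of_self: "c \<in> A \<Longrightarrow> p \<in> fst c \<Longrightarrow> tvec_of A c p w c = w"
  by (simp add: tvec_of_eq Dtrans_id)

lemma tvec_of_component:
  assumes "v \<in> tangent_space A p" "c \<in> A" "p \<in> fst c"
  shows "tvec_of A c p (v c) = v"
proof
  fix d
  show "tvec_of A c p (v c) d = v d"
    using assms unfolding tangent_space_iff tvec_of_eq by metis
qed

lemma tvec_of_linear:
  assumes "c \<in> A" "p \<in> fst c"
  shows "tvec_of A c p (s *\<^sub>R v + w) = tadd (tscale s (tvec_of A c p v)) (tvec_of A c p w)"
  using assms Dtrans_linear[of c _ p]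
  by (auto simp: tvec_of_eq tadd_def tscale_def linear_add linear_scale fun_eq_iff)

lemma tscale_tvec_of:
  assumes "c \<in> A" "p \<in> fst c"
  shows "tscale s (tvec_of A c p v) = tvec_of A c p (s *\<^sub>R v)"
  using assms Dtrans_linear[of c _ p]
  by (auto simp: tvec_of_eq tscale_def linear_scale fun_eq_iff)

lemma zero_tangent: "(\<lambda>_. 0) \<in> tangent_space A p"
  by (simp add: tangent_space_iff linear_0[OF Dtrans_linear])

lemma tvec_of_zero:
  assumes "c \<in> A" "p \<in> fst c"
  shows "tvec_of A c p 0 = (\<lambda>_. 0)"
  using tvec_of_component[OF zero_tangent assms] by simp

section \<open>The metric as a bilinear form on the components in a chart\<close>

definition bform :: "('m, 'n) chart \<Rightarrow> 'm \<Rightarrow> real^'n \<Rightarrow> real^'n \<Rightarrow> real" where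
  "bform c p v w = g p (tvec_of A c p v) (tvec_of A c p w)"

lemma metric_facts:
  "v \<in> tangent_space A p \<Longrightarrow> w \<in> tangent_space A p \<Longrightarrow> g p v w = g p w v"
  "v \<in> tangent_space A p \<Longrightarrow> w \<in> tangent_space A p \<Longrightarrow> z \<in> tangent_space A p \<Longrightarrow>
    g p (tadd (tscale s v) w) z = s * g p v z + g p w z"
  "v \<in> tangent_space A p \<Longrightarrow> v \<noteq> (\<lambda>_. 0) \<Longrightarrow> g p v v > 0"
  "c \<in> A \<Longrightarrow> smooth_on (gmat A g c) (snd c ` fst c)"
  using riem by (simp_all add: riemannian_manifold_def riemannian_metric_def)

lemma bform_sym: "c \<in> A \<Longrightarrow> p \<in> fst c \<Longrightarrow> bform c p v w = bform c p w v"
  unfolding bform_def by (intro metric_facts tvec_of_tangent)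

lemma bform_lin:
  assumes "c \<in> A" "p \<in> fst c"
  shows "bform c p (s *\<^sub>R v + w) z = s * bform c p v z + bform c p w z"
  unfolding bform_def tvec_of_linear[OF assms]
  using assms by (intro metric_facts tvec_of_tangent)

lemma bform_linear:
  assumes "c \<in> A" "p \<in> fst c"
  shows "linear (\<lambda>v. bform c p v z)"
proof -
  have 0: "bform c p 0 z = 0" using bform_lin[OF assms, of 1 0 0 z] by simp
  show ?thesis
  proof (rule linearI)
    show "bform c p (v + w) z = bform c p v z + bform c p w z" for v w
      using bform_lin[OF assms, of 1 v w z] by simp
    show "bform c p (s *\<^sub>R v) z = s *\<^sub>R bform c p v z" for s v
      using bform_lin[OF assms, of s v 0 z] 0 by simp
  qed
qed

lemma gmat_eq: "c \<in> A \<Longrightarrow> p \<in> fst c \<Longrightarrow> gmat A g c (snd c p) $ i $ j = bform c p (axis i 1) (axis j 1)"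
  by (simp add: gmat_def bform_def)

lemma bform_gmat:
  assumes "c \<in> A" "p \<in> fst c"
  shows "bform c p v w = (\<Sum>i\<in>UNIV. \<Sum>j\<in>UNIV. gmat A g c (snd c p) $ i $ j * v $ i * w $ j)"
proof -
  have expand: "bform c p x z = (\<Sum>i\<in>UNIV. x $ i * bform c p (axis i 1) z)" for x z
  proof -
    interpret linear "\<lambda>v. bform c p v z" by (rule bform_linear[OF assms])
    have "x = (\<Sum>i\<in>UNIV. x $ i *\<^sub>R axis i 1)"
      by (metis basis_expansion scalar_mult_eq_scaleR)
    then have "bform c p x z = bform c p (\<Sum>i\<in>UNIV. x $ i *\<^sub>R axis i 1) z" by simp
    then show ?thesis by (simp add: sum scale)
  qed
  show ?thesis
    by (subst expand, subst bform_sym[OF assms], subst expand, subst bform_sym[OF assms])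
      (simp add: gmat_eq[OF assms] sum_distrib_left mult_ac)
qed

lemma gmat_sym:
  assumes "c \<in> A" "p \<in> fst c"
  shows "gmat A g c (snd c p) $ i $ j = gmat A g c (snd c p) $ j $ i"
  using bform_sym[OF assms] by (simp add: gmat_eq[OF assms])

lemma bform_inner:
  assumes "c \<in> A" "p \<in> fst c"
  shows "bform c p v w = inner v (gmat A g c (snd c p) *v w)"
  by (simp add: bform_gmat[OF assms] inner_vec_def matrix_vector_mult_def sum_distrib_left mult_ac)

lemma bform_pos:
  assumes "c \<in> A" "p \<in> fst c" "v \<noteq> 0"
  shows "bform c p v v > 0"
  unfolding bform_def
proof (rule metric_facts(3)[OF tvec_of_tangent[OF assms(1,2)]])
  show "tvec_of A c p v \<noteq> (\<lambda>_. 0)"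
    using tvec_of_self[OF assms(1,2), of v] assms(3) by auto
qed

lemma gmat_det_pos:
  assumes "c \<in> A" "p \<in> fst c"
  shows "det (gmat A g c (snd c p)) > 0"
  by (rule posdef_det_pos) (simp add: bform_inner[OF assms, symmetric] bform_pos[OF assms])

lemma bform_change:
  assumes "c \<in> A" "d \<in> A" "p \<in> fst c" "p \<in> fst d"
  shows "bform c p v w = bform d p (Dtrans c d p v) (Dtrans c d p w)"
proof -
  have "tvec_of A c p v = tvec_of A d p (Dtrans c d p v)" for v
    using assms by (auto simp: tvec_of_eq fun_eq_iff Dtrans_cocycle)
  then show ?thesis by (simp add: bform_def)
qed

section \<open>Jacobian matrices and the transformation of the Gram matrix, the volume density and
  the gradient\<close>

definition Jac :: "('m, 'n) chart \<Rightarrow> ('m, 'n) chart \<Rightarrow> real^'n \<Rightarrow> real^'n^'n" where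
  "Jac c d y = (\<chi> k i. pd i (trans_map c d) y $ k)"

lemma Dtrans_Jac:
  assumes "c \<in> A" "d \<in> A" "p \<in> fst c" "p \<in> fst d"
  shows "Dtrans c d p v = Jac c d (snd c p) *v v"
  using frechet_derivative_pd[OF trans_differentiable[OF assms], of v]
  by (simp add: Dtrans_def Jac_def vec_eq_iff matrix_vector_mult_def sum_component mult.commute)

lemma Jac_inverse:
  assumes "c \<in> A" "d \<in> A" "p \<in> fst c" "p \<in> fst d"
  shows "Jac d c (snd d p) ** Jac c d (snd c p) = mat 1"
proof -
  have "(Jac d c (snd d p) ** Jac c d (snd c p)) *v v = mat 1 *v v" for v
    using Dtrans_cocycle[of c d c p v] assms
    by (simp add: Dtrans_id Dtrans_Jac matrix_vector_mul_assoc[symmetric])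
  then show ?thesis by (simp add: matrix_eq)
qed

lemma gmat_change:
  assumes "c \<in> A" "d \<in> A" "p \<in> fst c" "p \<in> fst d"
  shows "gmat A g c (snd c p) = transpose (Jac c d (snd c p)) ** gmat A g d (snd d p) ** Jac c d (snd c p)"
proof -
  let ?J = "Jac c d (snd c p)" and ?Gc = "gmat A g c (snd c p)" and ?Gd = "gmat A g d (snd d p)"
  have "inner v (?Gc *v w) = inner v ((transpose ?J ** ?Gd ** ?J) *v w)" for v w
  proof -
    have "inner v (?Gc *v w) = inner (?J *v v) (?Gd *v (?J *v w))"
      using bform_change[OF assms, of v w] assms
      by (simp add: bform_inner Dtrans_Jac)
    also have "\<dots> = inner v (transpose ?J *v (?Gd *v (?J *v w)))"
      by (metis dot_lmul_matrix inner_commute transpose_matrix_vector)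
    finally show ?thesis by (simp only: matrix_vector_mul_assoc matrix_mul_assoc)
  qed
  then have "?Gc *v w = (transpose ?J ** ?Gd ** ?J) *v w" for w
    using vector_eq_ldot by blast
  then show ?thesis by (simp add: matrix_eq)
qed

definition rho :: "('m, 'n) chart \<Rightarrow> real^'n \<Rightarrow> real" where
  "rho c y = sqrt (det (gmat A g c y))"

lemma rho_pos: "c \<in> A \<Longrightarrow> y \<in> snd c ` fst c \<Longrightarrow> rho c y > 0"
  by (auto simp: rho_def gmat_det_pos)

text \<open>The Gram determinant picks up the square of the Jacobian determinant, hence the absolute
  value.\<close>

lemma rho_change:
  assumes "c \<in> A" "d \<in> A" "p \<in> fst c" "p \<in> fst d"
  shows "rho c (snd c p) = \<bar>det (Jac c d (snd c p))\<bar> * rho d (snd d p)"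
  by (simp add: rho_def gmat_change[OF assms] det_mul real_sqrt_mult)

lemma gmat_C1: "c \<in> A \<Longrightarrow> C1_on (\<lambda>y. gmat A g c y $ i $ j) (snd c ` fst c)"
  by (intro C1_on_nth chart_open smooth_on_C1 metric_facts)

lemma rho_C1: "c \<in> A \<Longrightarrow> C1_on (rho c) (snd c ` fst c)"
  unfolding rho_def
  by (intro C1_on_sqrt C1_on_det gmat_C1 chart_open) (auto simp: gmat_det_pos)

text \<open>The differential transforms by the transpose of J and the Gram matrix by J^T G J. After
  cancelling the transpose, the inverse Gram matrix applied to the differential transforms by J, as
  a vector does.\<close>

lemma grad_tangent:
  assumes f: "\<And>c. c \<in> A \<Longrightarrow> p \<in> fst c \<Longrightarrow> (f \<circ> chart_inv c) differentiable at (snd c p)"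
  shows "grad A g f p \<in> tangent_space A p"
  unfolding tangent_space_iff
proof (intro conjI allI impI ballI)
  show "grad A g f p c = 0" if "\<not> (c \<in> A \<and> p \<in> fst c)" for c
    using that by (auto simp: grad_def)
  fix c d assume cd: "c \<in> A" "d \<in> A" "p \<in> fst c" "p \<in> fst d"
  let ?J = "Jac c d (snd c p)" and ?Gc = "gmat A g c (snd c p)" and ?Gd = "gmat A g d (snd d p)"
  define dfc where "dfc = (\<chi> j. pd j (f \<circ> chart_inv c) (snd c p))"
  define dfd where "dfd = (\<chi> j. pd j (f \<circ> chart_inv d) (snd d p))"
  have "pd i (f \<circ> chart_inv c) (snd c p) = (\<Sum>k\<in>UNIV. ?J $ k $ i * pd k (f \<circ> chart_inv d) (snd d p))" for i
  proof -
    have "pd i (f \<circ> chart_inv c) (snd c p) = pd i (\<lambda>y. (f \<circ> chart_inv d) (trans_map c d y)) (snd c p)"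
      by (rule pd_cong_open[OF overlap_open[OF cd(1,2)]]) (use cd in \<open>auto simp: trans_map_def\<close>)
    also have "\<dots> = (\<Sum>k\<in>UNIV. (pd i (trans_map c d) (snd c p) $ k) *\<^sub>R pd k (f \<circ> chart_inv d) (trans_map c d (snd c p)))"
    proof (rule pd_chain[OF trans_differentiable[OF cd]])
      show "(f \<circ> chart_inv d) differentiable at (trans_map c d (snd c p))"
        using f[OF cd(2,4)] cd by simp
    qed
    finally show ?thesis using cd by (simp add: Jac_def)
  qed
  then have df: "dfc = transpose ?J *v dfd"
    by (simp add: dfc_def dfd_def vec_eq_iff matrix_vector_mult_def transpose_def)
  have nz: "det ?Gc \<noteq> 0" "det ?Gd \<noteq> 0" using gmat_det_pos cd less_imp_neq by metis+
  let ?v = "matrix_inv ?Gc *v dfc"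
  have "transpose ?J *v (?Gd *v (?J *v ?v)) = ?Gc *v ?v"
    by (simp add: gmat_change[OF cd] matrix_vector_mul_assoc matrix_mul_assoc)
  also have "\<dots> = dfc" by (simp add: matrix_vector_mul_assoc matrix_inv_right[OF nz(1)])
  finally have "transpose ?J *v (?Gd *v (?J *v ?v)) = transpose ?J *v dfd" using df by simp
  moreover have "?J ** Jac d c (snd d p) = mat 1" using Jac_inverse[of d c p] cd by simp
  then have "transpose (Jac d c (snd d p)) ** transpose ?J = mat 1"
    by (metis matrix_transpose_mul transpose_mat)
  ultimately have "?Gd *v (?J *v ?v) = dfd"
    by (metis matrix_vector_mul_assoc matrix_vector_mul_lid)
  then have "?J *v ?v = matrix_inv ?Gd *v dfd"
    by (metis matrix_inv_left[OF nz(2)] matrix_vector_mul_assoc matrix_vector_mul_lid)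
  then show "grad A g f p d = Dtrans c d p (grad A g f p c)"
    using cd by (simp add: grad_def Dtrans_Jac dfc_def dfd_def)
qed

lemma metric_grad:
  assumes f: "\<And>c. c \<in> A \<Longrightarrow> p \<in> fst c \<Longrightarrow> (f \<circ> chart_inv c) differentiable at (snd c p)"
    and c: "c \<in> A" "p \<in> fst c" and v: "v \<in> tangent_space A p"
  shows "g p v (grad A g f p) = (\<Sum>i\<in>UNIV. v c $ i * pd i (f \<circ> chart_inv c) (snd c p))"
proof -
  let ?G = "gmat A g c (snd c p)"
  define df where "df = (\<chi> j. pd j (f \<circ> chart_inv c) (snd c p))"
  have "det ?G \<noteq> 0" using gmat_det_pos[OF c] by simp
  then have "?G *v (matrix_inv ?G *v df) = df"
    by (simp add: matrix_vector_mul_assoc matrix_inv_right)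
  moreover have "g p v (grad A g f p) = inner (v c) (?G *v (matrix_inv ?G *v df))"
  proof -
    have gt: "grad A g f p \<in> tangent_space A p"
      by (rule grad_tangent) (rule f)
    have gc: "grad A g f p c = matrix_inv ?G *v df"
      by (simp add: grad_def df_def c)
    have "g p v (grad A g f p) = bform c p (v c) (grad A g f p c)"
      by (simp only: bform_def tvec_of_component[OF v c] tvec_of_component[OF gt c])
    then show ?thesis by (simp only: bform_inner[OF c] gc)
  qed
  ultimately show ?thesis by (simp add: inner_vec_def df_def)
qed

end

section \<open>Invariance of the divergence under coordinate changes\<close>

lemma matrix_mult_one_sum:
  fixes B J :: "real^'n^'n"
  assumes "B ** J = mat 1"
  shows "(\<Sum>k\<in>UNIV. B $ m $ k * J $ k $ i) = (if m = i then 1 else 0)"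
proof -
  have "(\<Sum>k\<in>UNIV. B $ m $ k * J $ k $ i) = (B ** J) $ m $ i"
    by (simp add: matrix_matrix_mult_def)
  then show ?thesis by (simp add: assms mat_def)
qed

text \<open>Here \<open>J\<close> is the Jacobian matrix of a coordinate change, \<open>D\<close> its determinant with sign \<open>e\<close>, and \<open>Vc\<close>, \<open>Vd\<close> are the
  components of a vector field multiplied by the volume density. After contraction of the differentiated transformation
  law with \<open>B = J\<^sup>-\<^sup>1\<close>, the second derivatives \<open>dJ\<close> of the coordinate change cancel by Jacobi's formula.\<close>

lemma piola_algebra:
  fixes B J :: "real^'n^'n" and Vc Vd dD :: "'n \<Rightarrow> real"
  assumes BJ: "B ** J = mat 1"
    and eq: "\<And>k m. (\<Sum>i\<in>UNIV. J $ k $ i * dVc m i + dJ m k i * Vc i)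
        = e * (D * (\<Sum>l\<in>UNIV. J $ l $ m * dVd l k) + dD m * Vd k)"
    and sym: "\<And>m k i. dJ m k i = dJ i k m"
    and dD: "\<And>m. dD m = D * (\<Sum>k\<in>UNIV. \<Sum>l\<in>UNIV. B $ l $ k * dJ m k l)"
    and V: "\<And>k. (\<Sum>i\<in>UNIV. J $ k $ i * Vc i) = e * D * Vd k"
  shows "(\<Sum>m\<in>UNIV. dVc m m) = e * D * (\<Sum>k\<in>UNIV. dVd k k)"
proof -
  have JB: "J ** B = mat 1" using BJ matrix_left_right_inverse by blast
  \<comment> \<open>By the hypothesis \<open>dD\<close>, this is the logarithmic derivative of
    \<open>D\<close>.\<close>
  define t where "t m = (\<Sum>k\<in>UNIV. \<Sum>l\<in>UNIV. B $ l $ k * dJ m k l)" for m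
  have 1: "(\<Sum>k\<in>UNIV. B $ m $ k * (\<Sum>i\<in>UNIV. J $ k $ i * x i)) = x m" for m and x :: "'n \<Rightarrow> real"
  proof -
    have "(\<Sum>k\<in>UNIV. B $ m $ k * (\<Sum>i\<in>UNIV. J $ k $ i * x i)) = (\<Sum>i\<in>UNIV. (\<Sum>k\<in>UNIV. B $ m $ k * J $ k $ i) * x i)"
      unfolding sum_distrib_left sum_distrib_right by (subst sum.swap) (simp add: mult.assoc)
    also have "\<dots> = (\<Sum>i\<in>UNIV. if i = m then x i else 0)"
      by (intro sum.cong) (auto simp: matrix_mult_one_sum[OF BJ])
    finally show ?thesis by simp
  qed
  \<comment> \<open>Symmetry exchanges the direction of differentiation with the component index,
    which turns the contraction with \<open>B\<close> into the trace \<open>t\<close>.\<close>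
  have 2: "(\<Sum>m\<in>UNIV. \<Sum>k\<in>UNIV. B $ m $ k * (\<Sum>i\<in>UNIV. dJ m k i * Vc i)) = (\<Sum>i\<in>UNIV. t i * Vc i)"
  proof -
    let ?T = "\<lambda>m k i. B $ m $ k * dJ i k m * Vc i"
    have "(\<Sum>m\<in>UNIV. \<Sum>k\<in>UNIV. B $ m $ k * (\<Sum>i\<in>UNIV. dJ m k i * Vc i))
       = (\<Sum>m\<in>UNIV. \<Sum>k\<in>UNIV. \<Sum>i\<in>UNIV. ?T m k i)"
      by (simp add: sum_distrib_left sym mult.assoc)
    also have "\<dots> = (\<Sum>m\<in>UNIV. \<Sum>i\<in>UNIV. \<Sum>k\<in>UNIV. ?T m k i)"
      by (intro sum.cong refl sum.swap)
    also have "\<dots> = (\<Sum>i\<in>UNIV. \<Sum>m\<in>UNIV. \<Sum>k\<in>UNIV. ?T m k i)"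
      by (rule sum.swap)
    also have "\<dots> = (\<Sum>i\<in>UNIV. \<Sum>k\<in>UNIV. \<Sum>m\<in>UNIV. ?T m k i)"
      by (intro sum.cong refl sum.swap)
    also have "\<dots> = (\<Sum>i\<in>UNIV. t i * Vc i)"
      by (simp add: t_def sum_distrib_right)
    finally show ?thesis .
  qed
  have 3: "(\<Sum>m\<in>UNIV. \<Sum>k\<in>UNIV. B $ m $ k * (\<Sum>l\<in>UNIV. J $ l $ m * dVd l k)) = (\<Sum>k\<in>UNIV. dVd k k)"
  proof -
    have "(\<Sum>m\<in>UNIV. \<Sum>k\<in>UNIV. B $ m $ k * (\<Sum>l\<in>UNIV. J $ l $ m * dVd l k))
       = (\<Sum>k\<in>UNIV. \<Sum>m\<in>UNIV. \<Sum>l\<in>UNIV. J $ l $ m * B $ m $ k * dVd l k)"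
      by (subst sum.swap) (simp add: sum_distrib_left mult_ac)
    also have "\<dots> = (\<Sum>k\<in>UNIV. \<Sum>l\<in>UNIV. (\<Sum>m\<in>UNIV. J $ l $ m * B $ m $ k) * dVd l k)"
      by (simp add: sum_distrib_right) (intro sum.cong refl sum.swap)
    also have "\<dots> = (\<Sum>k\<in>UNIV. \<Sum>l\<in>UNIV. if l = k then dVd l k else 0)"
      by (intro sum.cong refl) (auto simp: matrix_mult_one_sum[OF JB])
    finally show ?thesis by simp
  qed
  \<comment> \<open>The derivative of the determinant contributes the same sum as \<open>2\<close>,
    so the two cancel in the end.\<close>
  have 4: "(\<Sum>m\<in>UNIV. \<Sum>k\<in>UNIV. B $ m $ k * (e * (dD m * Vd k))) = (\<Sum>m\<in>UNIV. t m * Vc m)"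
  proof (intro sum.cong refl)
    fix m
    have "(\<Sum>k\<in>UNIV. B $ m $ k * (e * (dD m * Vd k))) = t m * (\<Sum>k\<in>UNIV. B $ m $ k * (e * D * Vd k))"
      unfolding dD[of m, folded t_def] by (simp add: sum_distrib_left mult_ac)
    also have "\<dots> = t m * Vc m" by (simp add: V[symmetric] 1)
    finally show "(\<Sum>k\<in>UNIV. B $ m $ k * (e * (dD m * Vd k))) = t m * Vc m" .
  qed
  have "(\<Sum>m\<in>UNIV. \<Sum>k\<in>UNIV. B $ m $ k * (\<Sum>i\<in>UNIV. J $ k $ i * dVc m i + dJ m k i * Vc i))
     = (\<Sum>m\<in>UNIV. dVc m m) + (\<Sum>i\<in>UNIV. t i * Vc i)"
    by (simp add: sum.distrib distrib_left 1 2)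
  moreover have "(\<Sum>m\<in>UNIV. \<Sum>k\<in>UNIV. B $ m $ k * (e * (D * (\<Sum>l\<in>UNIV. J $ l $ m * dVd l k) + dD m * Vd k)))
     = e * D * (\<Sum>k\<in>UNIV. dVd k k) + (\<Sum>m\<in>UNIV. t m * Vc m)"
  proof -
    have "(\<Sum>m\<in>UNIV. \<Sum>k\<in>UNIV. B $ m $ k * (e * (D * (\<Sum>l\<in>UNIV. J $ l $ m * dVd l k) + dD m * Vd k)))
       = e * D * (\<Sum>m\<in>UNIV. \<Sum>k\<in>UNIV. B $ m $ k * (\<Sum>l\<in>UNIV. J $ l $ m * dVd l k))
       + (\<Sum>m\<in>UNIV. \<Sum>k\<in>UNIV. B $ m $ k * (e * (dD m * Vd k)))"
      unfolding sum_distrib_left[of "e * D"] sum.distrib[symmetric]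
      by (intro sum.cong refl) (simp add: algebra_simps)
    then show ?thesis by (simp only: 3 4)
  qed
  ultimately show ?thesis by (simp add: eq)
qed

context riem_mfd
begin

text \<open>The coordinate expression in an arbitrary chart. In \<open>divergence\<close> the chart
  is selected separately at every point by \<open>chart_at\<close>, without any regularity in the
  point, so derivatives and integrals need a version with a fixed chart.\<close>

definition divc :: "('m, 'n) chart \<Rightarrow> ('m \<Rightarrow> ('m, 'n) tvec) \<Rightarrow> 'm \<Rightarrow> real" where
  "divc c X p = (\<Sum>i\<in>UNIV. pd i (\<lambda>y. rho c y * X (chart_inv c y) c $ i) (snd c p)) / rho c (snd c p)"

lemma divergence_eq_divc_chart_at: "divergence A g X p = divc (chart_at A p) X p"
  by (simp add: divergence_def divc_def rho_def Let_def)

text \<open>Multiplied by the density, the components obey J V_c = |det J| times V_d after the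
  coordinate change: the law for vectors supplies J, the law for densities the determinant. This
  holds near \<open>p\<close>, so it may be differentiated there, and \<open>piola_algebra\<close>
  evaluates the result.\<close>

lemma divc_change:
  assumes c: "c \<in> A" and d: "d \<in> A" and N: "open N" "p \<in> N" "N \<subseteq> fst c" "N \<subseteq> fst d"
    and X: "\<And>q. q \<in> N \<Longrightarrow> X q \<in> tangent_space A q"
    and Xc: "(\<lambda>y. X (chart_inv c y) c) differentiable at (snd c p)"
    and Xd: "(\<lambda>y. X (chart_inv d y) d) differentiable at (snd d p)"
  shows "divc c X p = divc d X p"
proof -
  note pc = subsetD[OF N(3) N(2)] and pdd = subsetD[OF N(4) N(2)]
  define T where "T = trans_map c d"
  define S where "S = snd c ` N"
  have S: "open S" "snd c p \<in> S" using chart_image_open[OF c N(1,3)] N by (auto simp: S_def)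
  define U where "U = snd c ` (fst c \<inter> fst d)"
  have U: "open U" "snd c p \<in> U" "S \<subseteq> U"
    using overlap_open[OF c d] N by (auto simp: U_def S_def)
  have T2: "Ck_on 2 T U" unfolding T_def U_def by (intro smooth_on_Ck2 trans_smooth c d)
  have Jdef: "Jac c d y $ k $ i = pd i (\<lambda>y. T y $ k) y" if "y \<in> U" for y k i
    using pd_nth[OF C1_on_differentiable[OF Ck_on_2_C1[OF T2] U(1) that]] by (simp add: Jac_def T_def)
  \<comment> \<open>Passage to single coordinates, because \<open>pd_symmetric\<close> concerns
    real-valued functions.\<close>
  have Tk2: "Ck_on 2 (\<lambda>y. T y $ k) U" for k
  proof -
    have "C1_on (pd i (\<lambda>y. T y $ k)) U" for i
    proof (rule Ck_Suc_cong_open[OF U(1)])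
      show "C1_on (\<lambda>y. pd i T y $ k) U"
        using T2 by (intro C1_on_nth U Ck_on_2_pd)
      show "pd i T z $ k = pd i (\<lambda>y. T y $ k) z" if "z \<in> U" for z
        using pd_nth[OF C1_on_differentiable[OF Ck_on_2_C1[OF T2] U(1) that]] by simp
    qed
    moreover have "C1_on (\<lambda>y. T y $ k) U"
      by (intro C1_on_nth U Ck_on_2_C1[OF T2])
    ultimately show ?thesis by (simp add: numeral_2_eq_2)
  qed
  have JC1: "C1_on (\<lambda>y. Jac c d y $ k $ i) U" for k i
    by (rule Ck_Suc_cong_open[OF U(1) _ Ck_on_2_pd[OF Tk2]]) (simp add: Jdef)
  have Jd: "(\<lambda>y. Jac c d y $ k $ i) differentiable at (snd c p)" for k i
    by (rule C1_on_differentiable[OF JC1 U(1,2)])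
  let ?J = "Jac c d (snd c p)" and ?B = "Jac d c (snd d p)"
  have BJ: "?B ** ?J = mat 1" by (rule Jac_inverse[OF c d pc pdd])
  then have "det ?B * det ?J = 1" by (metis det_mul det_I)
  then have detJ: "det ?J \<noteq> 0" by auto
  \<comment> \<open>The sign of the Jacobian determinant at \<open>p\<close>. On the open set
    \<open>S'\<close>, where it persists, the absolute value becomes the differentiable function
    \<open>e * det (Jac c d y)\<close>.\<close>
  define e where "e = sgn (det ?J)"
  define S' where "S' = {y \<in> S. e * det (Jac c d y) > 0}"
  have "continuous_on S (\<lambda>y. e * det (Jac c d y))"
    by (intro continuous_intros C1_on_continuous[OF Ck_on_subset[OF C1_on_det[OF U(1) JC1] U(3)]])
  then have S'o: "open S'"
    unfolding S'_def using continuous_on_open_vimage[OF S(1), of "\<lambda>y. e * det (Jac c d y)"]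
    by (auto simp: vimage_def Int_def conj_commute dest!: spec[of _ "{0<..}"])
  have S'p: "snd c p \<in> S'"
    using detJ S by (auto simp: S'_def e_def sgn_if)
  have absdet: "\<bar>det (Jac c d y)\<bar> = e * det (Jac c d y)" if "y \<in> S'" for y
    using that detJ by (auto simp: S'_def e_def sgn_if zero_less_mult_iff split: if_splits)
  define Vc where "Vc i y = rho c y * X (chart_inv c y) c $ i" for i y
  define Vd where "Vd i y = rho d y * X (chart_inv d y) d $ i" for i y
  have "rho c differentiable at (snd c p)" "rho d differentiable at (snd d p)"
    using C1_on_differentiable[OF rho_C1 chart_open(2)] c d pc pdd by blast+
  then have Vcd: "Vc i differentiable at (snd c p)" and Vdd: "Vd i differentiable at (snd d p)" for i
    unfolding Vc_def Vd_def using Xc Xd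
      differentiable_compose[OF bounded_linear_imp_differentiable[OF bounded_linear_vec_nth]]
    by (auto intro!: differentiable_mult)
  have Td: "T differentiable at (snd c p)" by (simp add: T_def trans_differentiable c d pc pdd)
  have Tp: "T (snd c p) = snd d p" by (simp add: T_def c pc)
  have VdT: "(\<lambda>y. Vd k (T y)) differentiable at (snd c p)" for k
    by (rule differentiable_compose) (simp_all add: Td Tp Vdd)
  have V: "(\<Sum>i\<in>UNIV. Jac c d y $ k $ i * Vc i y) = e * det (Jac c d y) * Vd k (T y)" if y: "y \<in> S'" for y k
  proof -
    obtain q where q: "q \<in> N" "y = snd c q" using y by (auto simp: S'_def S_def)
    then have qc: "q \<in> fst c" "q \<in> fst d" using N by auto
    have "X q d = Dtrans c d q (X q c)"
      using X[OF q(1)] c d qc unfolding tangent_space_iff by blast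
    then have "X q d $ k = (\<Sum>i\<in>UNIV. Jac c d y $ k $ i * X q c $ i)"
      by (simp add: Dtrans_Jac[OF c d qc] q matrix_vector_mult_def)
    then have "(\<Sum>i\<in>UNIV. Jac c d y $ k $ i * Vc i y) = rho c y * X q d $ k"
      using c qc by (simp add: Vc_def q sum_distrib_left mult_ac)
    also have "rho c y = e * det (Jac c d y) * rho d (T y)"
      using rho_change[OF c d qc] absdet[OF y] c qc by (simp add: q T_def)
    also have "\<dots> * X q d $ k = e * det (Jac c d y) * Vd k (T y)"
      using c d qc by (simp add: Vd_def T_def q)
    finally show ?thesis .
  qed
  have detd: "(\<lambda>y. det (Jac c d y)) differentiable at (snd c p)"
    by (rule C1_on_differentiable[OF C1_on_det[OF U(1) JC1] U(1,2)])
  let ?dJ = "\<lambda>m k i. pd m (\<lambda>y. Jac c d y $ k $ i) (snd c p)"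
  have "(\<Sum>m\<in>UNIV. pd m (Vc m) (snd c p)) = e * det ?J * (\<Sum>k\<in>UNIV. pd k (Vd k) (snd d p))"
  proof (rule piola_algebra[OF BJ, where dJ = "\<lambda>m k i. ?dJ m k i"
        and Vc = "\<lambda>i. Vc i (snd c p)" and dVc = "\<lambda>m i. pd m (Vc i) (snd c p)"
        and Vd = "\<lambda>k. Vd k (snd d p)" and dVd = "\<lambda>l k. pd l (Vd k) (snd d p)"
        and dD = "\<lambda>m. pd m (\<lambda>y. det (Jac c d y)) (snd c p)"])
    show "(\<Sum>i\<in>UNIV. ?J $ k $ i * Vc i (snd c p)) = e * det ?J * Vd k (snd d p)" for k
      using V[OF S'p, of k] by (simp add: Tp)
    show "pd m (\<lambda>y. det (Jac c d y)) (snd c p) = det ?J *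
         (\<Sum>k\<in>UNIV. \<Sum>l\<in>UNIV. ?B $ l $ k * ?dJ m k l)" for m
      by (rule pd_det[OF Jd BJ])
    show "?dJ m k i = ?dJ i k m" for m k i
    proof -
      have "?dJ m k i = pd m (pd i (\<lambda>y. T y $ k)) (snd c p)" for m i
        by (rule pd_cong_open[OF U(1,2)]) (simp add: Jdef)
      then show ?thesis using pd_symmetric[OF U(1) Tk2 U(2)] by simp
    qed
    show "(\<Sum>i\<in>UNIV. ?J $ k $ i * pd m (Vc i) (snd c p) + ?dJ m k i * Vc i (snd c p))
        = e * (det ?J * (\<Sum>l\<in>UNIV. ?J $ l $ m * pd l (Vd k) (snd d p))
          + pd m (\<lambda>y. det (Jac c d y)) (snd c p) * Vd k (snd d p))" for k m
    proof -
      have "(\<Sum>i\<in>UNIV. ?J $ k $ i * pd m (Vc i) (snd c p) + ?dJ m k i * Vc i (snd c p))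
         = (\<Sum>i\<in>UNIV. pd m (\<lambda>y. Jac c d y $ k $ i * Vc i y) (snd c p))"
        by (intro sum.cong refl) (simp add: pd_mult Jd Vcd)
      also have "\<dots> = pd m (\<lambda>y. \<Sum>i\<in>UNIV. Jac c d y $ k $ i * Vc i y) (snd c p)"
        by (rule pd_sum[symmetric]) (auto intro!: differentiable_mult Jd Vcd)
      also have "\<dots> = pd m (\<lambda>y. e * (det (Jac c d y) * Vd k (T y))) (snd c p)"
        by (rule pd_cong_open[OF S'o S'p]) (simp add: V mult.assoc)
      also have "\<dots> = e * pd m (\<lambda>y. det (Jac c d y) * Vd k (T y)) (snd c p)"
        by (subst pd_mult) (auto intro!: differentiable_mult detd VdT)
      also have "pd m (\<lambda>y. det (Jac c d y) * Vd k (T y)) (snd c p)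
         = det ?J * pd m (\<lambda>y. Vd k (T y)) (snd c p) + pd m (\<lambda>y. det (Jac c d y)) (snd c p) * Vd k (snd d p)"
        by (simp add: pd_mult detd VdT Tp)
      also have "pd m (\<lambda>y. Vd k (T y)) (snd c p) = (\<Sum>l\<in>UNIV. ?J $ l $ m * pd l (Vd k) (snd d p))"
        using pd_chain[of T "snd c p" "Vd k" m] Td Vdd Tp by (simp add: Jac_def T_def)
      finally show ?thesis .
    qed
  qed
  moreover have "rho c (snd c p) = e * det ?J * rho d (snd d p)"
    using rho_change[OF c d pc pdd] absdet[OF S'p] by simp
  moreover have "rho d (snd d p) > 0" using rho_pos[OF d] pdd by blast
  moreover have "e * det ?J > 0" using S'p by (simp add: S'_def)
  ultimately show ?thesis
    by (auto simp: divc_def Vc_def[symmetric] Vd_def[symmetric])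
qed

end

section \<open>Normal coordinates at the pole and the Gauss lemma\<close>

locale pole_mfd = riem_mfd A g for A :: "('m::topological_space, 'n::finite) chart set" and g +
  fixes x\<^sub>0 :: 'm
  assumes pole: "riem_pole A g x\<^sub>0"
begin

text \<open>The tangent space at the pole is parametrised as in \<open>riem_pole\<close>, through
  the chart selected by \<open>chart_at\<close>, so that the inverse of \<open>expc\<close> is
  literally the global chart provided there. By \<open>tvec_pole\<close> the components in
  \<open>c0\<close> parametrise the same vectors in the same way.\<close>

definition expc :: "real^'n \<Rightarrow> 'm" where
  "expc w = riem_exp A g x\<^sub>0 (tvec_of A (chart_at A x\<^sub>0) x\<^sub>0 w)"

definition c0 :: "('m, 'n) chart" where
  "c0 = (UNIV, inv expc)"

lemma fst_c0 [simp]: "fst c0 = UNIV" by (simp add: c0_def)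

lemma expc_bij: "bij expc" and c0_in [simp]: "c0 \<in> A"
  using pole by (simp_all add: riem_pole_def Let_def c0_def expc_def[abs_def])

lemma snd_c0: "snd c0 = inv expc" by (simp add: c0_def)

lemma chart_inv_c0 [simp]: "chart_inv c0 = expc"
  by (simp add: chart_inv_def snd_c0 inv_inv_eq[OF expc_bij])

lemma c0_expc [simp]: "snd c0 (expc w) = w"
  by (simp add: snd_c0 bij_is_inj[OF expc_bij])

lemma expc_c0 [simp]: "expc (snd c0 p) = p"
  using chart_inv_left[OF c0_in, of p] by simp

lemma range_c0 [simp]: "range (snd c0) = UNIV"
  by (metis c0_expc surjI)

lemma expmap: "is_exponential_map A g x\<^sub>0 (riem_exp A g x\<^sub>0)"
  using pole by (simp add: riem_pole_def)

abbreviation polar :: "real^'n \<Rightarrow> ('m, 'n) tvec" where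
  "polar w \<equiv> tvec_of A (chart_at A x\<^sub>0) x\<^sub>0 w"

lemma pole_vec: "tscale t (polar w) = polar (t *\<^sub>R w)"
  by (simp add: tscale_tvec_of chart_at_in)

lemma exp_tscale: "riem_exp A g x\<^sub>0 (tscale t (polar w)) = expc (t *\<^sub>R w)"
  by (simp add: pole_vec expc_def)

lemma expc_0 [simp]: "expc 0 = x\<^sub>0"
  using expmap by (simp add: expc_def tvec_of_zero chart_at_in is_exponential_map_def)

lemma c0_pole [simp]: "snd c0 x\<^sub>0 = 0"
  by (metis c0_expc expc_0)

lemma expc_continuous: "continuous_on S expc"
  using chart_homeo[OF c0_in] continuous_on_subset[of UNIV expc S] by (simp add: homeomorphism_def)

lemma c0_continuous: "continuous_on S (snd c0)"
  using chart_homeo[OF c0_in] continuous_on_subset[of UNIV "snd c0" S] by (simp add: homeomorphism_def)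

abbreviation G :: "real^'n \<Rightarrow> real^'n^'n" where "G \<equiv> gmat A g c0"

lemma G_C1: "C1_on (\<lambda>y. G y $ i $ j) UNIV"
  using gmat_C1[OF c0_in, of i j] by simp

lemma G_differentiable: "(\<lambda>y. G y $ i $ j) differentiable at y"
  by (rule C1_on_differentiable[OF G_C1]) auto

lemma G_sym: "G y $ i $ j = G y $ j $ i"
  using gmat_sym[OF c0_in, of "expc y" i j] by simp

lemma pd_G_sym: "pd m (\<lambda>y. G y $ i $ j) y = pd m (\<lambda>y. G y $ j $ i) y"
  by (rule pd_cong_open[of UNIV]) (auto simp: G_sym)

lemma G_det_pos: "det (G y) > 0"
  using gmat_det_pos[OF c0_in, of "expc y"] by simp

text \<open>In the chart \<open>c0\<close> the radial geodesics are the straight lines t w; their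
  coordinate velocity is constant, so the geodesic equation loses its second derivative.\<close>

lemma geodesic_eq:
  "(\<Sum>i\<in>UNIV. \<Sum>j\<in>UNIV. christoffel A g c0 k i j (t *\<^sub>R w) * w $ i * w $ j) = 0"
proof -
  have "geodesic A g (\<lambda>t. expc (t *\<^sub>R w))"
    using expmap tvec_of_tangent[OF chart_at_in, of x\<^sub>0 w]
    unfolding is_exponential_map_def by (metis (no_types, lifting) exp_tscale ext)
  then have geo: "geodesic A g (expc \<circ> (\<lambda>t. t *\<^sub>R w))" by (simp add: o_def)
  have y: "snd c0 \<circ> (expc \<circ> (\<lambda>t. t *\<^sub>R w)) = (\<lambda>t. t *\<^sub>R w)" by (simp add: o_def)
  have "((\<lambda>t. t *\<^sub>R w) has_vector_derivative w) (at s)" for s :: real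
    by (auto intro!: derivative_eq_intros simp: has_vector_derivative_def)
  then have y': "vector_derivative (\<lambda>t. t *\<^sub>R w) (at s) = w" for s :: real
    by (rule vector_derivative_at)
  have "((\<lambda>s::real. w) has_vector_derivative
    (\<chi> k. - (\<Sum>i\<in>UNIV. \<Sum>j\<in>UNIV. christoffel A g c0 k i j (t *\<^sub>R w) * w $ i * w $ j))) (at t)"
    using bspec[OF conjunct2[OF geo[unfolded geodesic_def]] c0_in, THEN spec, of t]
    by (simp only: Let_def y y' fst_c0 UNIV_I simp_thms)
  moreover have "((\<lambda>s::real. w) has_vector_derivative 0) (at t)" by simp
  ultimately have "(\<chi> k. - (\<Sum>i\<in>UNIV. \<Sum>j\<in>UNIV. christoffel A g c0 k i j (t *\<^sub>R w) * w $ i * w $ j)) = 0"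
    by (rule vector_derivative_unique_at)
  then show ?thesis by (simp add: vec_eq_iff)
qed

text \<open>Applying the Gram matrix to \<open>geodesic_eq\<close> removes its inverse. Of the three
  derivative terms of the Christoffel symbols, two agree after exchanging \<open>i\<close> and
  \<open>j\<close>.\<close>

lemma geodesic_eq_lowered:
  "2 * (\<Sum>i\<in>UNIV. \<Sum>j\<in>UNIV. pd i (\<lambda>z. G z $ l $ j) (t *\<^sub>R w) * w $ i * w $ j)
    = (\<Sum>i\<in>UNIV. \<Sum>j\<in>UNIV. pd l (\<lambda>z. G z $ i $ j) (t *\<^sub>R w) * w $ i * w $ j)"
proof -
  let ?y = "t *\<^sub>R w"
  define D where "D i j l = pd i (\<lambda>z. G z $ j $ l) ?y" for i j l
  \<comment> \<open>Twice the contraction of the Christoffel symbols of the first kind with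
    \<open>w\<close>.\<close>
  define a where "a l = (\<Sum>i\<in>UNIV. \<Sum>j\<in>UNIV. (D i j l + D j i l - D l i j) * w $ i * w $ j)" for l
  have "matrix_inv (G ?y) *v (\<chi> l. a l) = 0"
  proof -
    have "(\<Sum>l\<in>UNIV. matrix_inv (G ?y) $ k $ l * a l)
       = 2 * (\<Sum>i\<in>UNIV. \<Sum>j\<in>UNIV. christoffel A g c0 k i j ?y * w $ i * w $ j)" for k
    proof -
      let ?M = "\<lambda>i j l. matrix_inv (G ?y) $ k $ l * (D i j l + D j i l - D l i j) * w $ i * w $ j"
      have "(\<Sum>l\<in>UNIV. matrix_inv (G ?y) $ k $ l * a l)
         = (\<Sum>l\<in>UNIV. \<Sum>i\<in>UNIV. \<Sum>j\<in>UNIV. ?M i j l)"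
        by (simp add: a_def sum_distrib_left mult.assoc)
      also have "\<dots> = (\<Sum>i\<in>UNIV. \<Sum>l\<in>UNIV. \<Sum>j\<in>UNIV. ?M i j l)"
        by (rule sum.swap)
      also have "\<dots> = (\<Sum>i\<in>UNIV. \<Sum>j\<in>UNIV. \<Sum>l\<in>UNIV. ?M i j l)"
        by (intro sum.cong refl sum.swap)
      also have "\<dots> = (\<Sum>i\<in>UNIV. \<Sum>j\<in>UNIV. (2 * christoffel A g c0 k i j ?y) * w $ i * w $ j)"
        by (simp add: christoffel_def D_def[symmetric] sum_distrib_right)
      finally show ?thesis
        by (simp only: sum_distrib_left mult.assoc)
    qed
    then show ?thesis by (simp add: geodesic_eq vec_eq_iff matrix_vector_mult_def)
  qed
  then have "G ?y *v (matrix_inv (G ?y) *v (\<chi> l. a l)) = 0" by simp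
  then have "(\<chi> l. a l) = 0"
    using G_det_pos[of ?y] by (simp add: matrix_vector_mul_assoc matrix_inv_right)
  then have "a l = 0" by (simp add: vec_eq_iff)
  moreover have "(\<Sum>i\<in>UNIV. \<Sum>j\<in>UNIV. D j i l * w $ i * w $ j) = (\<Sum>i\<in>UNIV. \<Sum>j\<in>UNIV. D i j l * w $ i * w $ j)"
    by (subst sum.swap) (simp add: mult_ac)
  ultimately have "2 * (\<Sum>i\<in>UNIV. \<Sum>j\<in>UNIV. D i j l * w $ i * w $ j) = (\<Sum>i\<in>UNIV. \<Sum>j\<in>UNIV. D l i j * w $ i * w $ j)"
    by (simp add: a_def algebra_simps sum.distrib sum_subtractf)
  then show ?thesis by (simp add: D_def pd_G_sym[of _ _ l])
qed

lemma DERIV_G_ray: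
  "((\<lambda>t. G (t *\<^sub>R w) $ i $ j) has_real_derivative (\<Sum>m\<in>UNIV. pd m (\<lambda>z. G z $ i $ j) (t *\<^sub>R w) * w $ m)) (at t)"
proof -
  have "((\<lambda>t. t *\<^sub>R w) has_derivative (\<lambda>h. h *\<^sub>R w)) (at t)"
    by (auto intro!: derivative_eq_intros)
  from has_derivative_compose[OF this has_derivative_pd[OF G_differentiable]]
  have "((\<lambda>t. G (t *\<^sub>R w) $ i $ j) has_derivative
      (\<lambda>h. \<Sum>m\<in>UNIV. (h *\<^sub>R w) $ m *\<^sub>R pd m (\<lambda>z. G z $ i $ j) (t *\<^sub>R w))) (at t)" .
  moreover have "(\<lambda>h. \<Sum>m\<in>UNIV. (h *\<^sub>R w) $ m *\<^sub>R pd m (\<lambda>z. G z $ i $ j) (t *\<^sub>R w))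
     = (*) (\<Sum>m\<in>UNIV. pd m (\<lambda>z. G z $ i $ j) (t *\<^sub>R w) * w $ m)"
    by (simp add: fun_eq_iff sum_distrib_left sum_distrib_right mult_ac)
  ultimately show ?thesis by (simp add: has_field_derivative_def)
qed

text \<open>The squared length at the pole of the tangent vector with components \<open>w\<close>.
  By \<open>riem_dist_pole\<close> it is the squared distance of \<open>expc w\<close> from the
  pole.\<close>

definition sq :: "real^'n \<Rightarrow> real" where
  "sq w = (\<Sum>i\<in>UNIV. \<Sum>j\<in>UNIV. G 0 $ i $ j * w $ i * w $ j)"

text \<open>Radial geodesics have constant speed. The derivative along the ray is the contraction of
  the derivatives of \<open>G\<close> with three copies of \<open>w\<close>; contracting
  \<open>geodesic_eq_lowered\<close> once more with \<open>w\<close> shows that twice this number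
  equals the number itself.\<close>

lemma G_ray: "(\<Sum>i\<in>UNIV. \<Sum>j\<in>UNIV. G (t *\<^sub>R w) $ i $ j * w $ i * w $ j) = sq w"
proof -
  define f where "f t = (\<Sum>i\<in>UNIV. \<Sum>j\<in>UNIV. G (t *\<^sub>R w) $ i $ j * w $ i * w $ j)" for t
  have "(f has_real_derivative 0) (at t)" for t
  proof -
    let ?D = "\<lambda>m i j. pd m (\<lambda>z. G z $ i $ j) (t *\<^sub>R w)"
    define R where "R = (\<Sum>i\<in>UNIV. \<Sum>j\<in>UNIV. \<Sum>m\<in>UNIV. ?D m i j * w $ m * w $ i * w $ j)"
    have "(f has_real_derivative R) (at t)"
      unfolding f_def R_def
      by (auto intro!: derivative_eq_intros DERIV_G_ray simp: sum_distrib_right sum_distrib_left algebra_simps)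
    moreover have "R = 0"
    proof -
      have "R = (\<Sum>l\<in>UNIV. w $ l * (\<Sum>i\<in>UNIV. \<Sum>j\<in>UNIV. ?D i l j * w $ i * w $ j))"
        unfolding R_def
        by (simp add: sum_distrib_left) (rule sum.cong[OF refl], subst sum.swap, simp add: mult_ac)
      moreover have "R = (\<Sum>l\<in>UNIV. w $ l * (\<Sum>i\<in>UNIV. \<Sum>j\<in>UNIV. ?D l i j * w $ i * w $ j))"
      proof -
        have "R = (\<Sum>i\<in>UNIV. \<Sum>m\<in>UNIV. \<Sum>j\<in>UNIV. ?D m i j * w $ m * w $ i * w $ j)"
          unfolding R_def by (intro sum.cong refl sum.swap)
        also have "\<dots> = (\<Sum>m\<in>UNIV. \<Sum>i\<in>UNIV. \<Sum>j\<in>UNIV. ?D m i j * w $ m * w $ i * w $ j)"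
          by (rule sum.swap)
        finally show ?thesis by (simp add: sum_distrib_left mult_ac)
      qed
      ultimately show ?thesis
        by (simp add: geodesic_eq_lowered[symmetric] sum_distrib_left[symmetric] mult.left_commute[of _ 2])
    qed
    ultimately show ?thesis by simp
  qed
  then have "f t = f 0" by (metis DERIV_isconst_all)
  then show ?thesis by (simp add: f_def sq_def)
qed

lemma sq_G: "(\<Sum>i\<in>UNIV. \<Sum>j\<in>UNIV. G w $ i $ j * w $ i * w $ j) = sq w"
  using G_ray[of 1 w] by simp

lemma quad_form_pd:
  fixes H :: "real^'n \<Rightarrow> real^'n^'n"
  assumes H: "\<And>i j. (\<lambda>y. H y $ i $ j) differentiable at y" and sym: "\<And>i j. H y $ i $ j = H y $ j $ i"
  shows "pd l (\<lambda>y. \<Sum>i\<in>UNIV. \<Sum>j\<in>UNIV. H y $ i $ j * y $ i * y $ j) y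
    = (\<Sum>i\<in>UNIV. \<Sum>j\<in>UNIV. pd l (\<lambda>y. H y $ i $ j) y * y $ i * y $ j) + 2 * (\<Sum>j\<in>UNIV. H y $ l $ j * y $ j)"
proof -
  note dd = coord_differentiable H differentiable_mult differentiable_sum
  have "pd l (\<lambda>y. \<Sum>i\<in>UNIV. \<Sum>j\<in>UNIV. H y $ i $ j * y $ i * y $ j) y
     = (\<Sum>i\<in>UNIV. \<Sum>j\<in>UNIV. pd l (\<lambda>y. H y $ i $ j * y $ i * y $ j) y)"
    by (simp add: pd_sum dd)
  also have "\<dots> = (\<Sum>i\<in>UNIV. \<Sum>j\<in>UNIV. pd l (\<lambda>y. H y $ i $ j) y * y $ i * y $ j
      + H y $ i $ j * (if l = i then 1 else 0) * y $ j + H y $ i $ j * y $ i * (if l = j then 1 else 0))"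
    by (intro sum.cong refl) (simp add: pd_mult dd algebra_simps)
  also have "\<dots> = (\<Sum>i\<in>UNIV. \<Sum>j\<in>UNIV. pd l (\<lambda>y. H y $ i $ j) y * y $ i * y $ j)
      + (\<Sum>i\<in>UNIV. \<Sum>j\<in>UNIV. H y $ i $ j * (if l = i then 1 else 0) * y $ j)
      + (\<Sum>i\<in>UNIV. \<Sum>j\<in>UNIV. H y $ i $ j * y $ i * (if l = j then 1 else 0))"
    by (simp add: sum.distrib)
  also have "(\<Sum>i\<in>UNIV. \<Sum>j\<in>UNIV. H y $ i $ j * (if l = i then 1 else 0) * y $ j)
      = (\<Sum>i\<in>UNIV. if i = l then (\<Sum>j\<in>UNIV. H y $ i $ j * y $ j) else 0)"
    by (intro sum.cong refl) auto
  also have "(\<Sum>i\<in>UNIV. \<Sum>j\<in>UNIV. H y $ i $ j * y $ i * (if l = j then 1 else 0))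
      = (\<Sum>i\<in>UNIV. \<Sum>j\<in>UNIV. if j = l then H y $ l $ i * y $ i else 0)"
    by (intro sum.cong refl) (auto simp: sym[of _ l])
  finally show ?thesis by simp
qed

lemma pd_sq: "pd l sq y = 2 * (\<Sum>j\<in>UNIV. G 0 $ l $ j * y $ j)"
  unfolding sq_def[abs_def] by (subst quad_form_pd) (auto simp: G_sym)

text \<open>By \<open>G_ray\<close>, \<open>sq\<close> may be written with \<open>G 0\<close> or
  with \<open>G y\<close>. Comparing the two gradients and using \<open>geodesic_eq_lowered\<close>
  gives a first-order equation along rays for the vector (G(t w) - G(0)) w, by which t times this
  vector is constant.\<close>

lemma gauss_lemma: "(\<Sum>j\<in>UNIV. G w $ l $ j * w $ j) = (\<Sum>j\<in>UNIV. G 0 $ l $ j * w $ j)"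
proof -
  have *: "(\<Sum>i\<in>UNIV. \<Sum>j\<in>UNIV. pd i (\<lambda>z. G z $ l $ j) y * y $ i * y $ j)
      = (\<Sum>j\<in>UNIV. (G 0 $ l $ j - G y $ l $ j) * y $ j)" for y
  proof -
    have "pd l sq y = pd l (\<lambda>y. \<Sum>i\<in>UNIV. \<Sum>j\<in>UNIV. G y $ i $ j * y $ i * y $ j) y"
      by (simp add: sq_G[abs_def])
    also have "\<dots> = (\<Sum>i\<in>UNIV. \<Sum>j\<in>UNIV. pd l (\<lambda>y. G y $ i $ j) y * y $ i * y $ j) + 2 * (\<Sum>j\<in>UNIV. G y $ l $ j * y $ j)"
      by (intro quad_form_pd G_differentiable G_sym)
    also have "(\<Sum>i\<in>UNIV. \<Sum>j\<in>UNIV. pd l (\<lambda>y. G y $ i $ j) y * y $ i * y $ j)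
       = 2 * (\<Sum>i\<in>UNIV. \<Sum>j\<in>UNIV. pd i (\<lambda>z. G z $ l $ j) y * y $ i * y $ j)"
      using geodesic_eq_lowered[of l 1 y] by simp
    finally show ?thesis
      by (simp add: pd_sq algebra_simps sum_subtractf)
  qed
  let ?D = "\<lambda>t i j. pd i (\<lambda>z. G z $ l $ j) (t *\<^sub>R w)"
  \<comment> \<open>The factor \<open>t\<close> is the integrating factor of the radial equation and
    makes \<open>h 0\<close> vanish.\<close>
  define h where "h t = (\<Sum>j\<in>UNIV. t * (G (t *\<^sub>R w) $ l $ j - G 0 $ l $ j) * w $ j)" for t
  have "(h has_real_derivative 0) (at t)" for t
  proof -
    define R where "R = (\<Sum>j\<in>UNIV. (G (t *\<^sub>R w) $ l $ j - G 0 $ l $ j) * w $ j)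
       + t * (\<Sum>i\<in>UNIV. \<Sum>j\<in>UNIV. ?D t i j * w $ i * w $ j)"
    have "(h has_real_derivative (\<Sum>j\<in>UNIV. (G (t *\<^sub>R w) $ l $ j - G 0 $ l $ j
       + t * (\<Sum>i\<in>UNIV. ?D t i j * w $ i)) * w $ j)) (at t)"
      unfolding h_def
      by (auto intro!: derivative_eq_intros DERIV_G_ray sum.cong)
    moreover have "(\<Sum>j\<in>UNIV. (G (t *\<^sub>R w) $ l $ j - G 0 $ l $ j
       + t * (\<Sum>i\<in>UNIV. ?D t i j * w $ i)) * w $ j) = R"
    proof -
      have "(\<Sum>i\<in>UNIV. \<Sum>j\<in>UNIV. ?D t i j * w $ i * w $ j)
         = (\<Sum>j\<in>UNIV. \<Sum>i\<in>UNIV. ?D t i j * w $ i * w $ j)"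
        by (rule sum.swap)
      then show ?thesis
        by (simp only: R_def) (simp add: algebra_simps sum.distrib sum_subtractf sum_distrib_left sum_distrib_right)
    qed
    moreover have "R = 0"
    proof (cases "t = 0")
      case False
      have "t * (t * (\<Sum>i\<in>UNIV. \<Sum>j\<in>UNIV. ?D t i j * w $ i * w $ j))
         = t * (\<Sum>j\<in>UNIV. (G 0 $ l $ j - G (t *\<^sub>R w) $ l $ j) * w $ j)"
        using *[of "t *\<^sub>R w"] by (simp add: sum_distrib_left mult_ac)
      then have "t * (\<Sum>i\<in>UNIV. \<Sum>j\<in>UNIV. ?D t i j * w $ i * w $ j)
         = (\<Sum>j\<in>UNIV. (G 0 $ l $ j - G (t *\<^sub>R w) $ l $ j) * w $ j)"
        using False by simp
      then show ?thesis by (simp add: R_def algebra_simps sum_subtractf)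
    qed (simp add: R_def)
    ultimately show ?thesis by simp
  qed
  then have "h 1 = h 0" by (metis DERIV_isconst_all)
  then show ?thesis by (simp add: h_def algebra_simps sum_subtractf)
qed

end

section \<open>Distance from the pole\<close>

text \<open>Near \<open>S\<close> the derivative may be unbounded. If its absolute value has
  infinite integral, the right-hand side is infinite. Otherwise the derivative, extended by 0, is
  Lebesgue integrable, and its integral coincides with the gauge integral that the fundamental
  theorem supplies for continuous functions differentiable off a finite set.\<close>

lemma increment_le_nn_integral:
  fixes f f' L :: "real \<Rightarrow> real"
  assumes S: "finite S" and f: "continuous_on {0..1} f"
    and D: "\<And>t. t \<in> {0..1} - S \<Longrightarrow> (f has_real_derivative f' t) (at t)"
    and f': "continuous_on ({0..1} - S) f'"
    and L: "\<And>t. t \<in> {0..1} - S \<Longrightarrow> \<bar>f' t\<bar> \<le> L t"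
  shows "ennreal (f 0 - f 1) \<le> (\<integral>\<^sup>+ t\<in>{0..1}. ennreal (L t) \<partial>lborel)"
proof -
  define h where "h t = indicator ({0..1} - S) t *\<^sub>R f' t" for t
  have Sb: "{0..1} - S \<in> sets borel" using S by (simp add: sets.Diff finite_imp_closed borel_closed)
  have hm: "h \<in> borel_measurable borel"
    unfolding h_def by (rule borel_measurable_continuous_on_indicator[OF Sb f'])
  have le: "(\<integral>\<^sup>+ t. ennreal \<bar>h t\<bar> \<partial>lborel) \<le> (\<integral>\<^sup>+ t\<in>{0..1}. ennreal (L t) \<partial>lborel)"
    by (rule nn_integral_mono) (auto simp: h_def indicator_def L intro!: ennreal_leI)
  show ?thesis
  proof (cases "(\<integral>\<^sup>+ t. ennreal \<bar>h t\<bar> \<partial>lborel) < \<infinity>")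
    case False
    then have "(\<integral>\<^sup>+ t\<in>{0..1}. ennreal (L t) \<partial>lborel) = \<infinity>"
      using le by (auto simp: not_less top_unique)
    then show ?thesis by simp
  next
    case True
    then have hi: "integrable lborel h"
      using hm by (intro integrableI_bounded) auto
    have "(f' has_integral f 1 - f 0) {0..1}"
      using D by (intro fundamental_theorem_of_calculus_strong[OF S])
        (auto simp: f has_real_derivative_iff_has_vector_derivative)
    then have "(h has_integral f 1 - f 0) {0..1}"
      by (rule has_integral_spike_finite[OF S, rotated]) (auto simp: h_def)
    moreover have "(h has_integral (LINT t|lborel. h t)) {0..1}"
    proof -
      have "(h has_integral (LINT t|lborel. h t)) UNIV"
        by (rule has_integral_integral_lborel[OF hi])
      moreover have "(\<lambda>t. if t \<in> {0..1} then h t else 0) = h"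
        by (auto simp: h_def fun_eq_iff indicator_def)
      ultimately show ?thesis
        using has_integral_restrict_UNIV[of "{0..1}" h] by simp
    qed
    ultimately have eq: "f 1 - f 0 = (LINT t|lborel. h t)"
      using has_integral_unique by blast
    have "ennreal (f 0 - f 1) \<le> ennreal (LINT t|lborel. \<bar>h t\<bar>)"
      using integral_abs_bound[of lborel h] eq by (intro ennreal_leI) linarith
    also have "\<dots> = (\<integral>\<^sup>+ t. ennreal \<bar>h t\<bar> \<partial>lborel)"
      using hi by (intro nn_integral_eq_integral[symmetric]) auto
    also note le
    finally show ?thesis .
  qed
qed

context riem_mfd
begin

lemma bform_cauchy_schwarz:
  assumes "c \<in> A" "p \<in> fst c"
  shows "\<bar>bform c p v w\<bar> \<le> sqrt (bform c p v v) * sqrt (bform c p w w)"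
proof -
  interpret linear "\<lambda>v. bform c p v z" for z by (rule bform_linear[OF assms])
  have nn: "bform c p v v \<ge> 0" for v
    using bform_pos[OF assms, of v] zero by (cases "v = 0") auto
  have "(bform c p v w)\<^sup>2 \<le> bform c p v v * bform c p w w"
  proof (cases "w = 0")
    case True
    then show ?thesis using zero bform_sym[OF assms, of v w] by simp
  next
    case False
    let ?a = "bform c p w w" and ?b = "bform c p v w"
    \<comment> \<open>A multiple of the part of \<open>v\<close> orthogonal to \<open>w\<close>,
      scaled to avoid a division.\<close>
    let ?z = "?a *\<^sub>R v - ?b *\<^sub>R w"
    have a: "?a > 0" using bform_pos[OF assms False] .
    have "bform c p ?z ?z = ?a * bform c p v ?z - ?b * bform c p w ?z"
      by (simp add: diff scale)
    also have "bform c p v ?z = ?a * bform c p v v - ?b * ?b"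
      by (subst bform_sym[OF assms]) (simp add: diff scale bform_sym[OF assms, of w v])
    also have "bform c p w ?z = ?a * ?b - ?b * ?a"
      by (subst bform_sym[OF assms]) (simp add: diff scale)
    finally have "?a * (?a * bform c p v v - ?b\<^sup>2) \<ge> 0"
      using nn[of ?z] by (simp add: algebra_simps power2_eq_square)
    then show ?thesis using a by (simp add: zero_le_mult_iff mult.commute)
  qed
  then have "sqrt ((bform c p v w)\<^sup>2) \<le> sqrt (bform c p v v * bform c p w w)"
    by (rule real_sqrt_le_mono)
  then show ?thesis by (simp add: real_sqrt_mult)
qed

end

context pole_mfd
begin

lemma sq_bform0: "sq w = bform c0 x\<^sub>0 w w"
  by (simp add: sq_def bform_gmat)

lemma sq_bform: "sq w = bform c0 (expc w) w w"
  by (simp add: sq_G[symmetric] bform_gmat)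

lemma sq_pos: "w \<noteq> 0 \<Longrightarrow> sq w > 0"
  unfolding sq_bform0 by (rule bform_pos) auto

lemma sq_zero [simp]: "sq 0 = 0" by (simp add: sq_def)

lemma sq_nonneg: "sq w \<ge> 0"
  using sq_pos[of w] by (cases "w = 0") auto

lemma sq_scale: "sq (t *\<^sub>R w) = t\<^sup>2 * sq w"
  by (simp add: sq_def sum_distrib_left power2_eq_square mult_ac)

lemma pd_sq_gauss: "pd l sq y = 2 * (\<Sum>j\<in>UNIV. G y $ l $ j * y $ j)"
  by (simp add: pd_sq gauss_lemma)

lemma sq_C1: "C1_on sq UNIV"
  unfolding sq_def[abs_def] by (intro C1_on_sum C1_on_mult C1_on_const coord_C1 open_UNIV)

lemma sq_differentiable: "sq differentiable at y"
  by (rule C1_on_differentiable[OF sq_C1]) auto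

text \<open>The velocity is defined by a derivative in each chart separately; since
  \<open>c0\<close> is global, the chain rule reduces all of them to the one in
  \<open>c0\<close>.\<close>

lemma velocity_eq:
  assumes D: "((\<lambda>s. snd c0 (\<gamma> s)) has_vector_derivative y') (at t)"
  shows "velocity A \<gamma> t = tvec_of A c0 (\<gamma> t) y'"
proof
  fix c
  show "velocity A \<gamma> t c = tvec_of A c0 (\<gamma> t) y' c"
  proof (cases "c \<in> A \<and> \<gamma> t \<in> fst c")
    case True
    then have "(trans_map c0 c has_derivative Dtrans c0 c (\<gamma> t)) (at (snd c0 (\<gamma> t)))"
      by (intro Dtrans_has_derivative) auto
    from has_derivative_compose[OF D[unfolded has_vector_derivative_def] this]
    have "((\<lambda>s. trans_map c0 c (snd c0 (\<gamma> s))) has_derivative (\<lambda>h. Dtrans c0 c (\<gamma> t) (h *\<^sub>R y'))) (at t)" .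
    moreover have "(\<lambda>s. trans_map c0 c (snd c0 (\<gamma> s))) = snd c \<circ> \<gamma>" by (simp add: fun_eq_iff)
    moreover have "(\<lambda>h. Dtrans c0 c (\<gamma> t) (h *\<^sub>R y')) = (\<lambda>h. h *\<^sub>R Dtrans c0 c (\<gamma> t) y')"
      using True by (simp add: linear_scale[OF Dtrans_linear])
    ultimately have "(snd c \<circ> \<gamma> has_vector_derivative Dtrans c0 c (\<gamma> t) y') (at t)"
      by (simp add: has_vector_derivative_def)
    then show ?thesis using True by (simp add: velocity_def tvec_of_eq vector_derivative_at)
  qed (auto simp: velocity_def tvec_of_eq)
qed

text \<open>The differential of the exponential map at the origin is the identity: the ray with
  components \<open>w\<close> has initial velocity \<open>polar w\<close> by definition of the
  exponential map, while its coordinates in \<open>c0\<close> are t w.\<close>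

lemma tvec_pole: "polar w = tvec_of A c0 x\<^sub>0 w"
proof -
  let ?v = "polar w"
  have "?v = velocity A (\<lambda>t. riem_exp A g x\<^sub>0 (tscale t ?v)) 0"
    using expmap tvec_of_tangent[OF chart_at_in, of x\<^sub>0 w] unfolding is_exponential_map_def by metis
  also have "\<dots> = velocity A (\<lambda>t. expc (t *\<^sub>R w)) 0"
    by (simp only: exp_tscale)
  also have "\<dots> = tvec_of A c0 (expc (0 *\<^sub>R w)) w"
    by (rule velocity_eq) (auto intro!: derivative_eq_intros simp: has_vector_derivative_def)
  finally show ?thesis by simp
qed

lemma radial_field_eq:
  assumes "w \<noteq> 0"
  shows "radial_field A g x\<^sub>0 (expc w) = tvec_of A c0 (expc w) (w /\<^sub>R sqrt (sq w))"
proof -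
  let ?v = "tvec_of A c0 x\<^sub>0 w"
  have ex: "riem_exp A g x\<^sub>0 (tvec_of A c0 x\<^sub>0 w) = expc w" for w
    by (simp add: expc_def tvec_pole)
  have vt: "?v \<in> tangent_space A x\<^sub>0" by (rule tvec_of_tangent) auto
  \<comment> \<open>\<open>radial_field\<close> inverts \<open>riem_exp\<close> on the tangent space
    only, so injectivity is shown there, through the components in \<open>c0\<close>.\<close>
  have "inj_on (riem_exp A g x\<^sub>0) (tangent_space A x\<^sub>0)"
  proof (rule inj_onI)
    fix v v' assume v: "v \<in> tangent_space A x\<^sub>0" "v' \<in> tangent_space A x\<^sub>0"
      and eq: "riem_exp A g x\<^sub>0 v = riem_exp A g x\<^sub>0 v'"
    have "tvec_of A c0 x\<^sub>0 (v c0) = v" "tvec_of A c0 x\<^sub>0 (v' c0) = v'"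
      using v by (auto intro: tvec_of_component)
    moreover from this have "expc (v c0) = expc (v' c0)" using eq ex by metis
    then have "v c0 = v' c0" by (metis c0_expc)
    ultimately show "v = v'" by metis
  qed
  then have v: "inv_into (tangent_space A x\<^sub>0) (riem_exp A g x\<^sub>0) (expc w) = ?v"
    using vt ex[of w] by (metis inv_into_f_f)
  have \<rho>: "tnorm g x\<^sub>0 ?v = sqrt (sq w)"
    by (simp add: tnorm_def sq_bform0 bform_def)
  have pos: "sqrt (sq w) > 0" using sq_pos[OF assms] by simp
  have "radial_field A g x\<^sub>0 (expc w) = velocity A (\<lambda>t. expc ((t / sqrt (sq w)) *\<^sub>R w)) (sqrt (sq w))"
    by (simp add: radial_field_def Let_def v \<rho> tscale_tvec_of ex)
  also have "\<dots> = tvec_of A c0 (expc ((sqrt (sq w) / sqrt (sq w)) *\<^sub>R w)) (w /\<^sub>R sqrt (sq w))"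
    by (rule velocity_eq)
      (auto intro!: derivative_eq_intros simp: has_vector_derivative_def divide_inverse)
  also have "(sqrt (sq w) / sqrt (sq w)) *\<^sub>R w = w" using pos by simp
  finally show ?thesis .
qed

text \<open>By the Gauss lemma the differential of \<open>sq\<close> at y is the pairing with 2 y in
  the metric at that same point. The Cauchy-Schwarz inequality then bounds the rate of change of the
  square root of \<open>sq\<close> by the speed.\<close>

lemma curve_length_ge:
  assumes \<gamma>: "piecewise_C1_path A \<gamma>" and start: "pathstart \<gamma> = expc w" and fin: "pathfinish \<gamma> = x\<^sub>0"
  shows "ennreal (sqrt (sq w)) \<le> curve_length A g \<gamma>"
proof -
  obtain S where S: "finite S" and C1: "(snd c0 \<circ> \<gamma>) C1_differentiable_on {t \<in> {0..1} - S. \<gamma> t \<in> fst c0}"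
    using \<gamma> c0_in unfolding piecewise_C1_path_def by blast
  have path: "continuous_on {0..1} \<gamma>" using \<gamma> by (simp add: piecewise_C1_path_def path_def)
  define y where "y t = snd c0 (\<gamma> t)" for t
  obtain D where D: "\<And>t. t \<in> {0..1} - S \<Longrightarrow> (y has_vector_derivative D t) (at t)"
    and Dc: "continuous_on ({0..1} - S) D"
  proof -
    have "{t \<in> {0..1} - S. \<gamma> t \<in> fst c0} = {0..1} - S" by auto
    moreover have "snd c0 \<circ> \<gamma> = y" by (simp add: y_def fun_eq_iff)
    ultimately show ?thesis using C1 that unfolding C1_differentiable_on_def by metis
  qed
  have yc: "continuous_on {0..1} y"
    unfolding y_def using continuous_on_compose[OF path c0_continuous] by (simp add: o_def)
  define L where "L t = tnorm g (\<gamma> t) (velocity A \<gamma> t)" for t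
  have L: "L t = sqrt (bform c0 (\<gamma> t) (D t) (D t))" if "t \<in> {0..1} - S" for t
    using velocity_eq[of \<gamma> "D t" t] D[OF that] by (simp add: L_def tnorm_def bform_def y_def[abs_def])
  have "ennreal (sqrt (sq w) - \<delta>) \<le> curve_length A g \<gamma>" if \<delta>: "\<delta> > 0" for \<delta>
  proof -
    \<comment> \<open>The square root of \<open>sq\<close> is not differentiable at the pole, where
      the curve ends and which it may also meet earlier; adding \<delta>^2 under the root costs at
      most \<delta>.\<close>
    define N where "N t = sqrt (sq (y t) + \<delta>\<^sup>2)" for t
    define N' where "N' t = (\<Sum>i\<in>UNIV. \<Sum>j\<in>UNIV. G (y t) $ i $ j * y t $ j * D t $ i) / N t" for t
    have pos: "sq z + \<delta>\<^sup>2 > 0" for z using sq_nonneg[of z] \<delta> by (simp add: add_nonneg_pos)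
    have Npos: "N t > 0" for t using pos by (simp add: N_def)
    have Gc: "continuous_on T (\<lambda>t. G (y t) $ i $ j)" if "continuous_on T y" for T :: "real set" and i j
      using continuous_on_compose2[OF C1_on_continuous[OF G_C1] that] by simp
    have sqc: "continuous_on T (\<lambda>t. sq (y t))" if "continuous_on T y" for T :: "real set"
      using continuous_on_compose2[OF C1_on_continuous[OF sq_C1] that] by simp
    have yS: "continuous_on ({0..1} - S) y" using yc continuous_on_subset by blast
    have "ennreal (N 0 - N 1) \<le> (\<integral>\<^sup>+ t\<in>{0..1}. ennreal (L t) \<partial>lborel)"
    proof (rule increment_le_nn_integral[OF S])
      show "continuous_on {0..1} N"
        unfolding N_def by (intro continuous_intros sqc yc)
      have Nc: "continuous_on ({0..1} - S) N"
        unfolding N_def by (intro continuous_intros sqc yS)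
      then show "continuous_on ({0..1} - S) N'"
        unfolding N'_def using Npos
        by (intro continuous_intros Gc yS Dc) (auto simp: less_imp_neq[symmetric])
      fix t assume t: "t \<in> {0..1} - S"
      show "(N has_real_derivative N' t) (at t)"
      proof -
        have NN: "N' t * N t = (\<Sum>i\<in>UNIV. \<Sum>j\<in>UNIV. G (y t) $ i $ j * y t $ j * D t $ i)"
          using Npos[of t] by (simp add: N'_def)
        have "((\<lambda>t. sq (y t)) has_derivative (\<lambda>h. \<Sum>i\<in>UNIV. (h *\<^sub>R D t) $ i *\<^sub>R pd i sq (y t))) (at t)"
          by (rule has_derivative_compose[OF D[OF t, unfolded has_vector_derivative_def] has_derivative_pd[OF sq_differentiable]])
        moreover have "(\<lambda>h. \<Sum>i\<in>UNIV. (h *\<^sub>R D t) $ i *\<^sub>R pd i sq (y t)) = (*) (2 * N' t * N t)"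
          unfolding mult.assoc[of 2] NN by (simp add: fun_eq_iff pd_sq_gauss sum_distrib_left sum_distrib_right mult_ac)
        ultimately have "((\<lambda>t. sq (y t)) has_real_derivative 2 * N' t * N t) (at t)"
          by (simp add: has_field_derivative_def)
        then have "((\<lambda>t. sqrt (sq (y t) + \<delta>\<^sup>2)) has_real_derivative
            (inverse (sqrt (sq (y t) + \<delta>\<^sup>2)) / 2) * (2 * N' t * N t + 0)) (at t)"
          by (intro DERIV_chain2[where f = sqrt] DERIV_real_sqrt pos DERIV_add DERIV_const)
        then have "(N has_real_derivative inverse (N t) / 2 * (2 * N' t * N t + 0)) (at t)"
          unfolding N_def[abs_def] .
        moreover have "inverse (N t) / 2 * (2 * N' t * N t + 0) = N' t"
          using Npos[of t] by (simp add: field_simps)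
        ultimately show ?thesis by (simp only:)
      qed
      have p: "\<gamma> t = expc (y t)" by (simp add: y_def)
      have "N' t = bform c0 (\<gamma> t) (D t) (y t) / N t"
        by (simp add: N'_def bform_gmat p mult_ac)
      then have "\<bar>N' t\<bar> = \<bar>bform c0 (\<gamma> t) (D t) (y t)\<bar> / N t"
        using Npos[of t] by simp
      also have "\<dots> \<le> (L t * sqrt (sq (y t))) / N t"
        using bform_cauchy_schwarz[of c0 "\<gamma> t" "D t" "y t"] Npos[of t] L[OF t]
        by (intro divide_right_mono) (auto simp: sq_bform p)
      also have "\<dots> \<le> (L t * N t) / N t"
      proof (intro divide_right_mono mult_left_mono)
        show "sqrt (sq (y t)) \<le> N t" by (simp add: N_def)
        show "0 \<le> L t"
          using bform_pos[of c0 "\<gamma> t" "D t"] linear_0[OF bform_linear[of c0 "\<gamma> t" "D t"]]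
          by (cases "D t = 0") (auto simp: L[OF t])
      qed (use Npos[of t] in simp)
      finally show "\<bar>N' t\<bar> \<le> L t" using Npos[of t] by simp
    qed
    moreover have "N 1 = \<delta>" using fin \<delta> by (simp add: N_def y_def pathfinish_def)
    moreover have "sqrt (sq w) \<le> N 0" using start by (simp add: N_def y_def pathstart_def)
    ultimately show ?thesis
      unfolding curve_length_def L_def by (meson diff_right_mono ennreal_leI order_trans)
  qed
  then have "ennreal (sqrt (sq w)) \<le> curve_length A g \<gamma> + ennreal \<delta>" if "\<delta> > 0" for \<delta>
  proof -
    have "ennreal (sqrt (sq w)) \<le> ennreal (sqrt (sq w) - \<delta>) + ennreal \<delta>"
      using that by (cases "sqrt (sq w) \<ge> \<delta>") (auto simp: ennreal_plus[symmetric] ennreal_neg simp del: ennreal_plus intro!: ennreal_leI)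
    also have "\<dots> \<le> curve_length A g \<gamma> + ennreal \<delta>"
      using \<open>\<And>\<delta>. \<delta> > 0 \<Longrightarrow> ennreal (sqrt (sq w) - \<delta>) \<le> curve_length A g \<gamma>\<close>[OF that] by (rule add_right_mono)
    finally show ?thesis .
  qed
  then show ?thesis
    by (rule ennreal_le_epsilon)
qed

text \<open>The coordinates in \<open>c0\<close> are affine and the speed is constant by
  \<open>G_ray\<close>. Since \<open>piecewise_C1_path\<close> asks for regularity in every chart,
  the transition maps enter.\<close>

lemma curve_length_ray:
  fixes w :: "real^'n"
  defines "\<gamma> \<equiv> (\<lambda>t. expc ((1 - t) *\<^sub>R w))"
  shows "piecewise_C1_path A \<gamma>" "pathstart \<gamma> = expc w" "pathfinish \<gamma> = x\<^sub>0"
    "curve_length A g \<gamma> = ennreal (sqrt (sq w))"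
proof -
  show "pathstart \<gamma> = expc w" "pathfinish \<gamma> = x\<^sub>0"
    by (simp_all add: \<gamma>_def pathstart_def pathfinish_def)
  have cont: "continuous_on T \<gamma>" for T
    unfolding \<gamma>_def by (rule continuous_on_compose2[OF expc_continuous[of UNIV]]) (auto intro!: continuous_intros)
  have yd: "((\<lambda>s. snd c0 (\<gamma> s)) has_vector_derivative - w) (at t)" for t
    by (auto simp: \<gamma>_def has_vector_derivative_def intro!: derivative_eq_intros)
  have "(snd c \<circ> \<gamma>) C1_differentiable_on {t \<in> {0..1} - {}. \<gamma> t \<in> fst c}" (is "_ C1_differentiable_on ?T") if c: "c \<in> A" for c
    unfolding C1_differentiable_on_def
  proof (intro exI conjI ballI)
    let ?D = "\<lambda>t. \<Sum>i\<in>UNIV. (- w) $ i *\<^sub>R pd i (trans_map c0 c) ((1 - t) *\<^sub>R w)"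
    have C1: "C1_on (trans_map c0 c) (snd c0 ` (fst c0 \<inter> fst c))"
      by (rule smooth_on_C1[OF trans_smooth[OF c0_in c]])
    have in1: "(1 - t) *\<^sub>R w \<in> snd c0 ` (fst c0 \<inter> fst c)" if "t \<in> ?T" for t
      using that by (auto simp: \<gamma>_def intro!: image_eqI[where x = "expc ((1 - t) *\<^sub>R w)"])
    show "continuous_on ?T ?D"
      by (intro continuous_intros continuous_on_compose2[OF C1_on_pd[OF C1]])
        (use in1 in auto)
    fix t assume t: "t \<in> ?T"
    have "((\<lambda>s. (1 - s) *\<^sub>R w) has_derivative (\<lambda>h. h *\<^sub>R - w)) (at t)"
      by (auto intro!: derivative_eq_intros)
    from has_derivative_compose[OF this C1_on_has_derivative[OF C1 overlap_open[OF c0_in c] in1[OF t]]]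
    show "(snd c \<circ> \<gamma> has_vector_derivative ?D t) (at t)"
      by (simp add: has_vector_derivative_def trans_map_def \<gamma>_def o_def scaleR_sum_right sum_negf)
  qed
  then show "piecewise_C1_path A \<gamma>"
    unfolding piecewise_C1_path_def path_def using cont by blast
  have "tnorm g (\<gamma> t) (velocity A \<gamma> t) = sqrt (sq w)" for t
  proof -
    have "g (\<gamma> t) (velocity A \<gamma> t) (velocity A \<gamma> t) = bform c0 (\<gamma> t) (- w) (- w)"
      by (simp add: velocity_eq[OF yd] bform_def)
    also have "\<dots> = sq w"
      by (simp add: bform_gmat \<gamma>_def G_ray)
    finally show ?thesis by (simp add: tnorm_def)
  qed
  then show "curve_length A g \<gamma> = ennreal (sqrt (sq w))"
    unfolding curve_length_def by (simp add: nn_integral_cmult)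
qed

lemma riem_dist_pole: "riem_dist A g x x\<^sub>0 = sqrt (sq (snd c0 x))"
proof -
  define w where "w = snd c0 x"
  have x: "x = expc w" by (simp add: w_def)
  let ?I = "INF \<gamma>\<in>{\<gamma>. piecewise_C1_path A \<gamma> \<and> pathstart \<gamma> = x \<and> pathfinish \<gamma> = x\<^sub>0}. curve_length A g \<gamma>"
  have "?I
      = ennreal (sqrt (sq w))"
  proof (rule antisym)
    show "?I
      \<le> ennreal (sqrt (sq w))"
      unfolding x using curve_length_ray[of w]
      by (intro INF_lower2[of "\<lambda>t. expc ((1 - t) *\<^sub>R w)"]) auto
    show "ennreal (sqrt (sq w)) \<le> ?I"
      unfolding x by (rule INF_greatest) (use curve_length_ge in blast)
  qed
  then show ?thesis using sq_nonneg by (simp add: riem_dist_def w_def)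
qed

end

section \<open>Laplacian and divergence in normal coordinates\<close>

context pole_mfd
begin

lemma differentiable_in_chart:
  assumes f: "(f \<circ> expc) differentiable at (snd c0 p)" and c: "c \<in> A" "p \<in> fst c"
  shows "(f \<circ> chart_inv c) differentiable at (snd c p)"
proof -
  have T: "trans_map c c0 differentiable at (snd c p)"
    using c by (intro trans_differentiable) auto
  have "(f \<circ> expc) differentiable at (trans_map c c0 (snd c p))"
    using f c by (simp only: trans_map_eq)
  from differentiable_compose[OF this T]
  have "(\<lambda>y. (f \<circ> expc) (trans_map c c0 y)) differentiable at (snd c p)" .
  moreover have "(\<lambda>y. (f \<circ> expc) (trans_map c c0 y)) = f \<circ> chart_inv c"
    by (simp add: fun_eq_iff trans_map_def)
  ultimately show ?thesis by simp
qed

text \<open>The components in \<open>c\<close> are those in \<open>c0\<close> multiplied by the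
  Jacobian matrix of a smooth transition map.\<close>

lemma vector_field_C1_in_chart:
  assumes c: "c \<in> A" and N: "open N" "N \<subseteq> fst c"
    and X: "\<And>q. q \<in> N \<Longrightarrow> X q \<in> tangent_space A q"
    and X0: "C1_on (\<lambda>y. X (expc y) c0) (snd c0 ` N)"
  shows "C1_on (\<lambda>y. X (chart_inv c y) c) (snd c ` N)"
proof -
  let ?T = "trans_map c c0" and ?S = "trans_map c0 c"
  have o: "open (snd c ` N)" "open (snd c0 ` N)"
    using chart_image_open[OF c N] chart_image_open[OF c0_in N(1)] by auto
  have T: "C1_on ?T (snd c ` N)"
    by (rule Ck_on_subset[OF smooth_on_C1[OF trans_smooth[OF c c0_in]]]) (use N in auto)
  have S: "C1_on (pd i ?S) (snd c0 ` N)" for i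
    by (rule Ck_on_subset[OF Ck_on_2_pd[OF smooth_on_Ck2[OF trans_smooth[OF c0_in c]]]]) (use N in auto)
  have TN: "?T ` snd c ` N \<subseteq> snd c0 ` N"
  proof -
    have "?T (snd c q) \<in> snd c0 ` N" if "q \<in> N" for q
      using trans_map_eq[OF c subsetD[OF N(2) that]] that by (simp only: imageI)
    then show ?thesis by blast
  qed
  have comp: "C1_on (\<lambda>y. \<Sum>i\<in>UNIV. X (expc (?T y)) c0 $ i * pd i ?S (?T y) $ k) (snd c ` N)" for k
    by (intro C1_on_sum C1_on_mult o C1_on_nth C1_on_compose[OF o T X0 TN] C1_on_compose[OF o T S TN])
  have "C1_on (\<lambda>y. X (chart_inv c y) c $ k) (snd c ` N)" for k
  proof (rule Ck_Suc_cong_open[OF o(1) _ comp[of k]])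
    fix y assume "y \<in> snd c ` N"
    then obtain q where q: "q \<in> N" "y = snd c q" by auto
    then have qc: "q \<in> fst c" using N by auto
    have "X q c = Dtrans c0 c q (X q c0)"
      using X[OF q(1)] c c0_in qc fst_c0 unfolding tangent_space_iff by blast
    also have "\<dots> = Jac c0 c (snd c0 q) *v X q c0"
      by (rule Dtrans_Jac) (use c qc in auto)
    finally show "(\<Sum>i\<in>UNIV. X (expc (?T y)) c0 $ i * pd i ?S (?T y) $ k) = X (chart_inv c y) c $ k"
      using c qc by (simp add: q Jac_def matrix_vector_mult_def mult.commute)
  qed
  then show ?thesis by (rule C1_on_vec[OF o(1)])
qed

text \<open>Moves the divergence from the chart selected at \<open>p\<close> to the global one. The
  open set \<open>N\<close> admits fields that are regular only off the pole, such as the gradient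
  of the distance.\<close>

lemma divergence_c0:
  assumes N: "open N" "p \<in> N"
    and X: "\<And>q. q \<in> N \<Longrightarrow> X q \<in> tangent_space A q"
    and X0: "C1_on (\<lambda>y. X (expc y) c0) (snd c0 ` N)"
  shows "rho c0 (snd c0 p) * divergence A g X p
    = (\<Sum>i\<in>UNIV. pd i (\<lambda>y. rho c0 y * X (expc y) c0 $ i) (snd c0 p))"
proof -
  let ?c = "chart_at A p"
  let ?N = "N \<inter> fst ?c"
  note ci = chart_at_in[of p]
  have N': "open ?N" "p \<in> ?N" "?N \<subseteq> fst ?c" "?N \<subseteq> fst c0"
    using N ci by (auto intro!: open_Int chart_open)
  have X0': "C1_on (\<lambda>y. X (expc y) c0) (snd c0 ` ?N)"
    by (rule Ck_on_subset[OF X0]) auto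
  have "divc ?c X p = divc c0 X p"
  proof (rule divc_change[OF ci(1) c0_in N'])
    show "(\<lambda>y. X (chart_inv ?c y) ?c) differentiable at (snd ?c p)"
    proof (rule C1_on_differentiable[OF _ chart_image_open[OF ci(1) N'(1,3)]])
      show "C1_on (\<lambda>y. X (chart_inv ?c y) ?c) (snd ?c ` ?N)"
        by (rule vector_field_C1_in_chart[of _ _ X, OF ci(1) N'(1,3) _ X0']) (use X in blast)
    qed (use N' in blast)
    show "(\<lambda>y. X (chart_inv c0 y) c0) differentiable at (snd c0 p)"
      using N' C1_on_differentiable[OF X0' chart_image_open[OF c0_in N'(1)]] by auto
  qed (use X in auto)
  moreover have "rho c0 (snd c0 p) > 0" by (rule rho_pos) auto
  ultimately show ?thesis
    by (simp add: divergence_eq_divc_chart_at divc_def)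
qed

lemma grad_c0: "grad A g f (expc y) c0 = matrix_inv (G y) *v (\<chi> j. pd j (f \<circ> expc) y)"
  by (simp add: grad_def)

lemma rho_c0_C1: "C1_on (rho c0) UNIV"
  using rho_C1[OF c0_in] by simp

lemma rho_c0_pos: "rho c0 y > 0"
  using rho_pos[OF c0_in, of y] by simp

definition gradc :: "(real^'n \<Rightarrow> real) \<Rightarrow> real^'n \<Rightarrow> real^'n" where
  "gradc V y = matrix_inv (G y) *v (\<chi> j. pd j V y)"

lemma gradc_C1:
  assumes "open S" "Ck_on 2 V S"
  shows "C1_on (gradc V) S"
proof (rule C1_on_vec[OF assms(1)])
  have M: "C1_on (\<lambda>y. matrix_inv (G y) $ k $ l) S" for k l
    using G_det_pos by (intro C1_on_matrix_inv assms Ck_on_subset[OF G_C1]) (auto simp: less_imp_neq[symmetric])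
  show "C1_on (\<lambda>y. gradc V y $ k) S" for k
    unfolding gradc_def matrix_vector_mult_def vec_lambda_beta
    by (intro C1_on_sum C1_on_mult assms M Ck_on_2_pd)
qed

text \<open>The coordinate form of the fact that the pairing of a vector with the gradient is the
  derivative in its direction.\<close>

lemma gradc_inner: "(\<Sum>i\<in>UNIV. (\<Sum>j\<in>UNIV. G y $ i $ j * z $ j) * gradc V y $ i) = (\<Sum>j\<in>UNIV. z $ j * pd j V y)"
proof -
  have "G y *v gradc V y = (\<chi> j. pd j V y)"
    using G_det_pos[of y] by (simp add: gradc_def matrix_vector_mul_assoc matrix_inv_right)
  then have "pd j V y = (\<Sum>i\<in>UNIV. G y $ j $ i * gradc V y $ i)" for j
    by (simp add: vec_eq_iff matrix_vector_mult_def)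
  then have "(\<Sum>j\<in>UNIV. z $ j * pd j V y) = (\<Sum>j\<in>UNIV. \<Sum>i\<in>UNIV. z $ j * G y $ j $ i * gradc V y $ i)"
    by (simp add: sum_distrib_left mult.assoc)
  also have "\<dots> = (\<Sum>i\<in>UNIV. \<Sum>j\<in>UNIV. z $ j * G y $ j $ i * gradc V y $ i)"
    by (rule sum.swap)
  finally show ?thesis by (simp add: sum_distrib_left sum_distrib_right mult_ac G_sym[of y])
qed

lemma laplacian_c0:
  assumes f: "Ck_on 2 (f \<circ> expc) UNIV"
  shows "rho c0 y * laplacian A g f (expc y) = (\<Sum>i\<in>UNIV. pd i (\<lambda>z. rho c0 z * gradc (f \<circ> expc) z $ i) y)"
proof -
  have "(f \<circ> expc) differentiable at y" for y
    by (rule C1_on_differentiable[OF Ck_on_2_C1[OF f]]) auto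
  then have T: "grad A g f q \<in> tangent_space A q" for q
    by (intro grad_tangent differentiable_in_chart) auto
  have "rho c0 (snd c0 (expc y)) * divergence A g (grad A g f) (expc y)
    = (\<Sum>i\<in>UNIV. pd i (\<lambda>y. rho c0 y * grad A g f (expc y) c0 $ i) (snd c0 (expc y)))"
    by (rule divergence_c0[of UNIV]) (use T gradc_C1[OF _ f] in \<open>auto simp: grad_c0 gradc_def[symmetric] simp del: Ck_on.simps\<close>)
  then show ?thesis by (simp add: laplacian_def grad_c0 gradc_def)
qed

lemma pd_sqrt_sq:
  assumes "y \<noteq> 0"
  shows "pd j (\<lambda>y. sqrt (sq y)) y = (\<Sum>i\<in>UNIV. G y $ j $ i * y $ i) / sqrt (sq y)"
proof -
  have "pd j (\<lambda>y. sqrt (sq y)) y = inverse (sqrt (sq y)) / 2 * pd j sq y"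
    by (rule pd_compose_real[OF sq_differentiable DERIV_real_sqrt[OF sq_pos[OF assms]]])
  then have "pd j (\<lambda>y. sqrt (sq y)) y = inverse (sqrt (sq y)) * (\<Sum>i\<in>UNIV. G y $ j $ i * y $ i)"
    by (simp add: pd_sq_gauss)
  then show ?thesis by (simp only: divide_inverse mult.commute)
qed

lemma sum_pd_sq: "(\<Sum>i\<in>UNIV. pd i sq y * y $ i) = 2 * sq y"
proof -
  have "(\<Sum>i\<in>UNIV. pd i sq y * y $ i) = 2 * (\<Sum>i\<in>UNIV. \<Sum>j\<in>UNIV. G y $ i $ j * y $ i * y $ j)"
    by (simp add: pd_sq_gauss sum_distrib_left sum_distrib_right mult_ac)
  then show ?thesis by (simp add: sq_G)
qed

lemma rho_differentiable: "rho c0 differentiable at y"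
  by (rule C1_on_differentiable[OF rho_c0_C1]) auto

lemma c0_eq_0_iff: "snd c0 p = 0 \<longleftrightarrow> p = x\<^sub>0"
  by (metis c0_pole expc_0 expc_c0)

lemma expc_eq_pole_iff: "expc y = x\<^sub>0 \<longleftrightarrow> y = 0"
  by (metis c0_expc c0_pole expc_0)

text \<open>By the Gauss lemma the gradient of r has the components y / r. The product rule for the
  divergence of this quotient leaves the divergence of the coordinate field y, which unlike the
  Laplacian of r is regular at the pole, and a term -1/r from differentiating 1/r.\<close>

lemma laplacian_dist:
  assumes r: "r = (\<lambda>x. riem_dist A g x x\<^sub>0)" and y: "y \<noteq> 0"
  shows "(\<Sum>i\<in>UNIV. pd i (\<lambda>z. rho c0 z * z $ i) y) = rho c0 y * (r (expc y) * laplacian A g r (expc y) + 1)"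
proof -
  have rc: "r \<circ> expc = (\<lambda>y. sqrt (sq y))" by (simp add: r fun_eq_iff riem_dist_pole)
  define N where "N = - {x\<^sub>0}"
  have N: "open N"
  proof -
    have "N = snd c0 -` (- {0})"
      by (simp add: N_def c0_eq_0_iff set_eq_iff)
    then show ?thesis
      using open_vimage[OF open_Compl[OF closed_singleton] c0_continuous[of UNIV]] by simp
  qed
  have N0: "snd c0 ` N = - {0}"
  proof -
    have "z \<in> snd c0 ` N" if "z \<noteq> 0" for z
      using that by (intro image_eqI[of _ _ "expc z"]) (simp_all add: N_def expc_eq_pole_iff)
    then show ?thesis by (auto simp: N_def c0_eq_0_iff)
  qed
  have pN: "expc y \<in> N" using y by (simp add: N_def expc_eq_pole_iff)
  have sd: "(\<lambda>y. sqrt (sq y)) differentiable at z" if "z \<noteq> 0" for z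
    using differentiableI[OF has_derivative_compose[OF has_derivative_pd[OF sq_differentiable]
      DERIV_real_sqrt[OF sq_pos[OF that], unfolded has_field_derivative_def]]] .
  have T: "grad A g r q \<in> tangent_space A q" if "q \<in> N" for q
  proof (intro grad_tangent differentiable_in_chart)
    have "snd c0 q \<noteq> 0" using that N0 by auto
    then show "(r \<circ> expc) differentiable at (snd c0 q)" by (simp add: rc sd)
  qed
  have gr: "grad A g r (expc z) c0 = (1 / sqrt (sq z)) *\<^sub>R z" if "z \<noteq> 0" for z
  proof -
    have "(\<chi> j. pd j (r \<circ> expc) z) = G z *v ((1 / sqrt (sq z)) *\<^sub>R z)"
      by (simp add: rc pd_sqrt_sq[OF that] vec_eq_iff matrix_vector_mult_def sum_divide_distrib)
    then show ?thesis
      using G_det_pos[of z] by (simp only: grad_c0) (simp add: matrix_vector_mul_assoc matrix_inv_left)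
  qed
  have o: "open (- {0 :: real^'n})" by auto
  have S1: "C1_on (\<lambda>z. 1 / sqrt (sq z)) (- {0})"
    using sq_pos by (intro C1_on_divide C1_on_sqrt C1_on_const o Ck_on_subset[OF sq_C1])
      (auto simp: less_imp_neq[symmetric])
  have "C1_on (\<lambda>z. (1 / sqrt (sq z)) *\<^sub>R z) (- {0})"
    by (rule C1_on_vec[OF o]) (use C1_on_mult[OF o S1 coord_C1[OF o]] in \<open>simp del: Ck_on.simps\<close>)
  then have X0: "C1_on (\<lambda>z. grad A g r (expc z) c0) (snd c0 ` N)"
    unfolding N0 by (rule Ck_Suc_cong_open[OF o, rotated]) (simp add: gr)
  have "rho c0 y * laplacian A g r (expc y) = (\<Sum>i\<in>UNIV. pd i (\<lambda>z. rho c0 z * grad A g r (expc z) c0 $ i) y)"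
    using divergence_c0[OF N pN T X0] by (simp add: laplacian_def)
  also have "\<dots> = (\<Sum>i\<in>UNIV. pd i (\<lambda>z. (1 / sqrt (sq z)) * (rho c0 z * z $ i)) y)"
    by (intro sum.cong refl pd_cong_open[OF o]) (use y in \<open>auto simp: gr\<close>)
  also have "\<dots> = (\<Sum>i\<in>UNIV. (1 / sqrt (sq y)) * pd i (\<lambda>z. rho c0 z * z $ i) y
      + pd i (\<lambda>z. 1 / sqrt (sq z)) y * (rho c0 y * y $ i))"
    by (intro sum.cong refl pd_mult differentiable_mult rho_differentiable coord_differentiable
        C1_on_differentiable[OF S1 o]) (use y in auto)
  also have "\<dots> = (\<Sum>i\<in>UNIV. pd i (\<lambda>z. rho c0 z * z $ i) y) / sqrt (sq y) - rho c0 y / sqrt (sq y)"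
  proof -
    have pos: "sqrt (sq y) > 0" using sq_pos[OF y] by simp
    have "pd i (\<lambda>z. 1 / sqrt (sq z)) y = - (1 / (2 * sqrt (sq y) * sq y)) * pd i sq y" for i
    proof (rule pd_compose_real[OF sq_differentiable])
      show "((\<lambda>x. 1 / sqrt x) has_real_derivative - (1 / (2 * sqrt (sq y) * sq y))) (at (sq y))"
        using sq_pos[OF y] by (auto intro!: derivative_eq_intros simp: field_simps)
    qed
    then have "(\<Sum>i\<in>UNIV. pd i (\<lambda>z. 1 / sqrt (sq z)) y * (rho c0 y * y $ i))
      = - (1 / (2 * sqrt (sq y) * sq y)) * rho c0 y * (\<Sum>i\<in>UNIV. pd i sq y * y $ i)"
      by (subst sum_distrib_left, intro sum.cong refl, simp only: mult_ac)
    \<comment> \<open>Euler's identity for the quadratic form \<open>sq\<close>.\<close>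
    also have "\<dots> = - rho c0 y / sqrt (sq y)"
      unfolding sum_pd_sq using sq_pos[OF y] by (simp add: field_simps)
    finally show ?thesis by (simp add: sum.distrib sum_divide_distrib)
  qed
  finally have "rho c0 y * laplacian A g r (expc y) = ((\<Sum>i\<in>UNIV. pd i (\<lambda>z. rho c0 z * z $ i) y) - rho c0 y) / sqrt (sq y)"
    by (simp add: diff_divide_distrib)
  then have "sqrt (sq y) * (rho c0 y * laplacian A g r (expc y)) = (\<Sum>i\<in>UNIV. pd i (\<lambda>z. rho c0 z * z $ i) y) - rho c0 y"
    using sq_pos[OF y] by simp
  moreover have "r (expc y) = sqrt (sq y)" using rc by (metis comp_apply)
  ultimately show ?thesis by (simp add: algebra_simps)
qed

lemma radial_component:
  assumes v: "v \<in> tangent_space A (expc y)" and y: "y \<noteq> 0"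
  shows "sqrt (sq y) * g (expc y) v (radial_field A g x\<^sub>0 (expc y)) = (\<Sum>i\<in>UNIV. \<Sum>j\<in>UNIV. G y $ i $ j * v c0 $ i * y $ j)"
proof -
  have "g (expc y) v (radial_field A g x\<^sub>0 (expc y)) = bform c0 (expc y) (v c0) (y /\<^sub>R sqrt (sq y))"
    using tvec_of_component[OF v c0_in] by (simp add: radial_field_eq[OF y] bform_def)
  also have "\<dots> = bform c0 (expc y) (y /\<^sub>R sqrt (sq y)) (v c0)"
    by (rule bform_sym) auto
  also have "\<dots> = inverse (sqrt (sq y)) * bform c0 (expc y) y (v c0)"
    using linear_scale[OF bform_linear[of c0 "expc y"]] by simp
  also have "bform c0 (expc y) y (v c0) = bform c0 (expc y) (v c0) y"
    by (rule bform_sym) auto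
  finally show ?thesis
    using sq_pos[OF y] by (simp add: bform_gmat)
qed

end

section \<open>Integration by parts\<close>

lemma integrable_compact_support:
  fixes f :: "'a::euclidean_space \<Rightarrow> real"
  assumes f: "continuous_on UNIV f" and R: "\<And>y. R < norm y \<Longrightarrow> f y = 0"
  shows "integrable lborel f"
proof -
  have "integrable lborel (\<lambda>y. indicator (cball 0 R) y *\<^sub>R f y)"
    by (rule borel_integrable_compact) (auto intro: continuous_on_subset[OF f])
  moreover have "(\<lambda>y. indicator (cball 0 R) y *\<^sub>R f y) = f"
    using R by (auto simp: fun_eq_iff indicator_def)
  ultimately show ?thesis by simp
qed

text \<open>By translation invariance of Lebesgue measure all difference quotients have integral 0;
  dominated convergence passes this on to the derivative.\<close>

lemma integral_pd_zero:
  fixes V :: "real^'n \<Rightarrow> real"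
  assumes V: "C1_on V UNIV" and R: "\<And>y. R < norm y \<Longrightarrow> V y = 0"
  shows "integrable lborel (pd i V)" "(LINT y|lborel. pd i V y) = 0"
proof -
  have Vc: "continuous_on UNIV V" by (rule C1_on_continuous[OF V])
  have Vd: "V differentiable at y" for y by (rule C1_on_differentiable[OF V]) auto
  have p0: "pd i V y = 0" if "R < norm y" for y
  proof -
    have "open {y::real^'n. R < norm y}" by (intro open_Collect_less continuous_intros)
    then have "pd i V y = pd i (\<lambda>y. 0) y"
      by (rule pd_cong_open) (use that R in auto)
    then show ?thesis by simp
  qed
  have pc: "continuous_on UNIV (pd i V)" by (rule C1_on_pd[OF V])
  show "integrable lborel (pd i V)"
    by (rule integrable_compact_support[OF pc p0])
  have "compact (pd i V ` cball 0 R)"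
    by (intro compact_continuous_image continuous_on_subset[OF pc]) auto
  then have "bounded (pd i V ` cball 0 R)" by (rule compact_imp_bounded)
  then obtain B where B: "\<And>y. y \<in> cball 0 R \<Longrightarrow> \<bar>pd i V y\<bar> \<le> B"
    unfolding bounded_iff by (metis imageI real_norm_def)
  define C where "C = max B 0"
  have C: "\<bar>pd i V y\<bar> \<le> C" "0 \<le> C" for y
    using B[of y] p0[of y] by (cases "R < norm y"; simp add: C_def le_max_iff_disj)+
  \<comment> \<open>Steps of length at most 1 keep the difference quotients supported in the ball of
    radius \<open>R + 1\<close>, so that a single dominating function suffices.\<close>
  define h where "h n = 1 / real (Suc n)" for n
  have h: "0 < h n" "h n \<le> 1" for n by (auto simp: h_def)
  define q where "q n y = (V (y + h n *\<^sub>R axis i 1) - V y) / h n" for n y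
  have int: "integrable lborel V" by (rule integrable_compact_support[OF Vc R])
  have shift: "(LINT y|lborel. V (y + c)) = (LINT y|lborel. V y)" "integrable lborel (\<lambda>y. V (y + c))" for c
  proof -
    have m: "V \<in> borel_measurable borel" using int by (simp add: borel_measurable_integrable)
    have "(LINT y|lborel. V y) = (LINT y|distr lborel borel ((+) c). V y)"
      by (simp add: lborel_distr_plus)
    also have "\<dots> = (LINT y|lborel. V (c + y))"
      by (rule integral_distr) (use m in auto)
    finally show "(LINT y|lborel. V (y + c)) = (LINT y|lborel. V y)" by (simp add: add.commute)
    have "integrable (distr lborel borel ((+) c)) V" using int by (simp add: lborel_distr_plus)
    then show "integrable lborel (\<lambda>y. V (y + c))"
      by (subst (asm) integrable_distr_eq) (use m in \<open>auto simp: add.commute\<close>)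
  qed
  have q0: "(LINT y|lborel. q n y) = 0" for n
    unfolding q_def using shift int by (simp add: Bochner_Integration.integral_diff)
  have "(\<lambda>n. LINT y|lborel. q n y) \<longlonglongrightarrow> (LINT y|lborel. pd i V y)"
  proof (rule integral_dominated_convergence[where w = "\<lambda>y. indicator (cball 0 (R + 1)) y *\<^sub>R C"])
    show "pd i V \<in> borel_measurable lborel" using pc by (simp add: borel_measurable_continuous_onI)
    show "q n \<in> borel_measurable lborel" for n
      unfolding q_def using shift(2) int by (auto intro!: borel_measurable_integrable)
    show "integrable lborel (\<lambda>y. indicator (cball 0 (R + 1)) y *\<^sub>R C)"
      by (rule borel_integrable_compact) auto
    show "AE y in lborel. (\<lambda>n. q n y) \<longlonglongrightarrow> pd i V y"
    proof (rule AE_I2)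
      fix y
      have "((\<lambda>s. V (y + s *\<^sub>R axis i 1)) has_real_derivative pd i V y) (at 0)"
        using DERIV_pd_line[of V y 0 i] Vd by simp
      then have "((\<lambda>k. (V (y + k *\<^sub>R axis i 1) - V y) / k) \<longlongrightarrow> pd i V y) (at 0)"
        by (simp add: DERIV_def)
      moreover have "filterlim h (at 0) sequentially"
      proof (rule filterlim_atI)
        show "h \<longlonglongrightarrow> 0" unfolding h_def using LIMSEQ_inverse_real_of_nat by (simp add: inverse_eq_divide)
        show "\<forall>\<^sub>F n in sequentially. h n \<noteq> 0" using h(1) by (auto simp: less_imp_neq[symmetric])
      qed
      ultimately show "(\<lambda>n. q n y) \<longlonglongrightarrow> pd i V y"
        unfolding q_def by (rule filterlim_compose)
    qed
    show "AE y in lborel. norm (q n y) \<le> indicator (cball 0 (R + 1)) y *\<^sub>R C" for n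
    proof (rule AE_I2)
      fix y :: "real^'n"
      show "norm (q n y) \<le> indicator (cball 0 (R + 1)) y *\<^sub>R C"
      proof (cases "norm y \<le> R + 1")
        case False
        have "norm (h n *\<^sub>R axis i 1 :: real^'n) \<le> 1" using h[of n] by simp
        then have "R < norm (y + h n *\<^sub>R axis i 1)"
          using False norm_diff_ineq[of y "h n *\<^sub>R axis i 1"] by linarith
        then show ?thesis using R False by (simp add: q_def)
      next
        case True
        have "\<exists>z. 0 < z \<and> z < h n \<and> V (y + h n *\<^sub>R axis i 1) - V (y + 0 *\<^sub>R axis i 1) = (h n - 0) * pd i V (y + z *\<^sub>R axis i 1)"
          by (rule MVT2[OF h(1)]) (rule DERIV_pd_line[OF Vd])
        then obtain z where "V (y + h n *\<^sub>R axis i 1) - V y = h n * pd i V (y + z *\<^sub>R axis i 1)" by auto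
        then have "q n y = pd i V (y + z *\<^sub>R axis i 1)" using h(1)[of n] by (simp add: q_def)
        then show ?thesis using C True by simp
      qed
    qed
  qed
  then have "(\<lambda>n::nat. 0) \<longlonglongrightarrow> (LINT y|lborel. pd i V y)" by (simp add: q0)
  then show "(LINT y|lborel. pd i V y) = 0" using LIMSEQ_unique tendsto_const by blast
qed

context pole_mfd
begin

text \<open>The minimum on the unit sphere bounds \<open>sq\<close> from below by a positive
  multiple of the squared norm. Hence a profile vanishing for large arguments gives a compactly
  supported function of \<open>y\<close>.\<close>

lemma sq_coercive: "\<exists>R. \<forall>y. sq y \<le> R0 \<longrightarrow> norm y \<le> R"
proof -
  have "\<exists>u\<in>sphere (0::real^'n) 1. \<forall>v\<in>sphere 0 1. sq u \<le> sq v"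
  proof (rule continuous_attains_inf)
    show "continuous_on (sphere 0 1) sq"
      using C1_on_continuous[OF sq_C1] continuous_on_subset by blast
    show "sphere (0::real^'n) 1 \<noteq> {}"
      using norm_axis_1[of undefined] by (metis dist_0_norm mem_sphere empty_iff)
  qed auto
  then obtain u :: "real^'n" where u: "norm u = 1" "\<And>v. norm v = 1 \<Longrightarrow> sq u \<le> sq v" by auto
  have pos: "sq u > 0" using u(1) by (intro sq_pos) auto
  have lower: "(norm y)\<^sup>2 * sq u \<le> sq y" for y
  proof (cases "y = 0")
    case False
    have "sq y = sq (norm y *\<^sub>R (y /\<^sub>R norm y))" using False by simp
    also have "\<dots> = (norm y)\<^sup>2 * sq (y /\<^sub>R norm y)" by (rule sq_scale)
    finally show ?thesis using u(2)[of "y /\<^sub>R norm y"] False by (simp add: mult_left_mono)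
  qed simp
  show ?thesis
  proof (intro exI allI impI)
    fix y assume "sq y \<le> R0"
    then have "(norm y)\<^sup>2 \<le> R0 / sq u" using lower[of y] pos by (simp add: pos_le_divide_eq)
    then show "norm y \<le> sqrt (R0 / sq u)" by (rule real_le_rsqrt)
  qed
qed

end

section \<open>The assumptions on the distance and the drift, read in normal coordinates\<close>

locale drift_mfd = pole_mfd A g x\<^sub>0
  for A :: "('m::topological_space, 'n::finite) chart set" and g and x\<^sub>0 +
  fixes b :: "'m \<Rightarrow> ('m, 'n) tvec" and r :: "'m \<Rightarrow> real" and C\<^sub>1 C\<^sub>d \<sigma> :: real
  assumes r: "r = (\<lambda>x. riem_dist A g x x\<^sub>0)"
    and laplacian_r: "\<And>x. x \<noteq> x\<^sub>0 \<Longrightarrow> laplacian A g r x \<le> C\<^sub>1 * (real CARD('n) - 1) / r x"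
    and b_C1: "C1_vector_field A b"
    and div_b: "\<And>x. divergence A g b x \<le> C\<^sub>d"
    and radial_b: "\<And>x. x \<noteq> x\<^sub>0 \<Longrightarrow> g x (b x) (radial_field A g x\<^sub>0 x) \<ge> - \<sigma> / r x"
begin

abbreviation bc :: "real^'n \<Rightarrow> real^'n" where "bc y \<equiv> b (expc y) c0"

text \<open>The bracket in the lower bound for \<open>lam\<close>: the first two summands bound the
  divergence of the coordinate field y, the last one accounts for the radial drift.\<close>

definition kap :: real where "kap = 1 + C\<^sub>1 * (real CARD('n) - 1) + \<sigma>"

lemma bc_C1: "C1_on bc UNIV" and b_tangent: "b x \<in> tangent_space A x"
  using b_C1 bspec[OF conjunct2[OF b_C1[unfolded C1_vector_field_def]] c0_in]
  by (simp_all add: C1_vector_field_def)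

lemma r_expc: "r (expc y) = sqrt (sq y)"
  by (simp add: r riem_dist_pole)

text \<open>The factor r in \<open>laplacian_dist\<close> cancels the 1/r of the Laplacian
  comparison.\<close>

lemma sum_pd_rho_coord: "y \<noteq> 0 \<Longrightarrow>
  (\<Sum>i\<in>UNIV. pd i (\<lambda>z. rho c0 z * z $ i) y) \<le> rho c0 y * (C\<^sub>1 * (real CARD('n) - 1) + 1)"
  using laplacian_r[of "expc y"] laplacian_dist[OF r, of y] rho_c0_pos[of y] sq_pos[of y]
  by (simp add: expc_eq_pole_iff r_expc pos_le_divide_eq mult.commute)

lemma sum_pd_rho_b: "(\<Sum>i\<in>UNIV. pd i (\<lambda>z. rho c0 z * bc z $ i) y) \<le> rho c0 y * C\<^sub>d"
proof -
  have "(\<Sum>i\<in>UNIV. pd i (\<lambda>z. rho c0 z * bc z $ i) y) = rho c0 y * divergence A g b (expc y)"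
    using divergence_c0[of UNIV "expc y" b] b_tangent bc_C1 by (simp del: Ck_on.simps)
  then show ?thesis using div_b rho_c0_pos[of y] by simp
qed

text \<open>The gradient of r^2 is 2 r times the radial field, and this r cancels the 1/r in the
  bound for the drift.\<close>

lemma sum_pd_sq_b: "y \<noteq> 0 \<Longrightarrow> (\<Sum>i\<in>UNIV. pd i sq y * bc y $ i) \<ge> - 2 * \<sigma>"
proof -
  assume y: "y \<noteq> 0"
  have "(\<Sum>i\<in>UNIV. pd i sq y * bc y $ i) = 2 * (\<Sum>i\<in>UNIV. \<Sum>j\<in>UNIV. G y $ i $ j * bc y $ i * y $ j)"
    by (simp add: pd_sq_gauss sum_distrib_left sum_distrib_right mult_ac)
  also have "\<dots> = 2 * (sqrt (sq y) * g (expc y) (b (expc y)) (radial_field A g x\<^sub>0 (expc y)))"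
    by (simp add: radial_component[OF b_tangent y])
  finally have "(\<Sum>i\<in>UNIV. pd i sq y * bc y $ i)
    = 2 * (sqrt (sq y) * g (expc y) (b (expc y)) (radial_field A g x\<^sub>0 (expc y)))" .
  moreover have "sqrt (sq y) * g (expc y) (b (expc y)) (radial_field A g x\<^sub>0 (expc y)) \<ge> - \<sigma>"
  proof -
    have pos: "sqrt (sq y) > 0" using sq_pos[OF y] by simp
    have "sqrt (sq y) * (- \<sigma> / sqrt (sq y)) \<le> sqrt (sq y) * g (expc y) (b (expc y)) (radial_field A g x\<^sub>0 (expc y))"
      using radial_b[of "expc y"] y pos
      by (intro mult_left_mono) (auto simp: expc_eq_pole_iff r_expc)
    moreover have "sqrt (sq y) * (- \<sigma> / sqrt (sq y)) = - \<sigma>" using pos by simp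
    ultimately show ?thesis by simp
  qed
  ultimately show ?thesis by simp
qed

end

lemma pd_flux_shape:
  fixes p q a x c u :: "real^'n \<Rightarrow> real"
  assumes d: "p differentiable at y" "q differentiable at y" "a differentiable at y"
    "x differentiable at y" "c differentiable at y" "u differentiable at y"
  shows "pd i (\<lambda>z. p z * a z + u z * (- 2 * q z * x z + p z * c z)) y
    = p y * pd i a y + pd i p y * a y
      + u y * (- 2 * q y * pd i x y - 2 * pd i q y * x y + p y * pd i c y + pd i p y * c y)
      + pd i u y * (- 2 * q y * x y + p y * c y)"
proof -
  note dd = d differentiable_mult differentiable_add differentiable_const
  have 1: "pd i (\<lambda>z. - 2 * q z) y = - 2 * pd i q y"
    by (subst pd_mult, (intro dd)+) simp
  have 2: "pd i (\<lambda>z. - 2 * q z * x z) y = - 2 * q y * pd i x y - 2 * pd i q y * x y"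
    by (subst pd_mult, (intro dd)+, subst 1) simp
  have 3: "pd i (\<lambda>z. - 2 * q z * x z + p z * c z) y
    = - 2 * q y * pd i x y - 2 * pd i q y * x y + (p y * pd i c y + pd i p y * c y)"
    by (subst pd_add, (intro dd)+, subst 2, subst pd_mult, (intro dd)+, rule refl)
  show ?thesis
    by (subst pd_add, (intro dd)+, subst pd_mult, (intro dd)+, subst pd_mult, (intro dd)+, subst 3) simp
qed

definition (in drift_mfd) generator :: "('m \<Rightarrow> real) \<Rightarrow> 'm \<Rightarrow> real" where
  "generator v x = laplacian A g v x + g x (b x) (grad A g v x)"

text \<open>The argument stands for r^2. The signs fit the one-sided assumptions: \<open>P\<close>
  is paired with the upper bound for the divergence of the drift, \<open>P'\<close> with the upper
  bound for the Laplacian of r and the lower bound for the radial drift, and \<open>P''\<close>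
  belongs to the term to be discarded.\<close>

locale radial_profile =
  fixes P P' P'' :: "real \<Rightarrow> real" and R\<^sub>0 :: real
  assumes P: "\<And>s. (P has_real_derivative P' s) (at s)"
    and P': "\<And>s. (P' has_real_derivative P'' s) (at s)"
    and P'': "continuous_on UNIV P''"
    and P_nonneg: "\<And>s. 0 \<le> P s" and P'_nonpos: "\<And>s. P' s \<le> 0" and P''_nonneg: "\<And>s. 0 \<le> P'' s"
    and P_supp: "\<And>s. R\<^sub>0 < s \<Longrightarrow> P s = 0" and P'_supp: "\<And>s. R\<^sub>0 < s \<Longrightarrow> P' s = 0"
begin

lemma P'_continuous: "continuous_on S P'"
  using P' DERIV_isCont continuous_at_imp_continuous_on by blast

lemma P_continuous: "continuous_on S P"
  using P DERIV_isCont continuous_at_imp_continuous_on by blast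

end

locale drift_profile = drift_mfd A g x\<^sub>0 b r C\<^sub>1 C\<^sub>d \<sigma> + radial_profile P P' P'' R\<^sub>0
  for A :: "('m::topological_space, 'n::finite) chart set" and g and x\<^sub>0 and b and r and C\<^sub>1 C\<^sub>d \<sigma>
    and P P' P'' R\<^sub>0
begin

lemma Psq_C1: "C1_on (\<lambda>y. P (sq y)) UNIV" "C1_on (\<lambda>y. P' (sq y)) UNIV"
  by (rule C1_on_real_compose[OF open_UNIV sq_C1 P P'_continuous],
      rule C1_on_real_compose[OF open_UNIV sq_C1 P' continuous_on_subset[OF P'']]) auto

lemma pd_Psq: "pd i (\<lambda>y. P (sq y)) y = P' (sq y) * pd i sq y"
  "pd i (\<lambda>y. P' (sq y)) y = P'' (sq y) * pd i sq y"
  using pd_compose_real[OF sq_differentiable] P P' by blast+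

context
  fixes v :: "'m \<Rightarrow> real"
  assumes v: "Ck_on 2 (v \<circ> expc) UNIV" and v_nonneg: "\<And>x. 0 \<le> v x"
begin

abbreviation V :: "real^'n \<Rightarrow> real" where "V \<equiv> v \<circ> expc"

text \<open>The density times the components of P grad v - v grad(P(r^2)) + P v b: the field of
  Green's second identity with a drift term. By the Gauss lemma the components of grad(P(r^2)) are 2
  P' y.\<close>

definition flux :: "'n \<Rightarrow> real^'n \<Rightarrow> real" where
  "flux i z = P (sq z) * (rho c0 z * gradc V z $ i)
    + V z * (- 2 * P' (sq z) * (rho c0 z * z $ i) + P (sq z) * (rho c0 z * bc z $ i))"

lemma V_C1: "C1_on V UNIV" and V_diff: "V differentiable at y"
  using Ck_on_2_C1[OF v] C1_on_differentiable[OF Ck_on_2_C1[OF v] open_UNIV] by auto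

lemma flux_parts_C1:
  "C1_on (\<lambda>z. rho c0 z * gradc V z $ i) UNIV" "C1_on (\<lambda>z. rho c0 z * z $ i) UNIV" "C1_on (\<lambda>z. rho c0 z * bc z $ i) UNIV"
  by (intro C1_on_mult rho_c0_C1 C1_on_nth gradc_C1 v bc_C1 coord_C1 open_UNIV)+

lemma flux_C1: "C1_on (flux i) UNIV"
  unfolding flux_def[abs_def]
  by (intro C1_on_mult C1_on_add flux_parts_C1 Psq_C1 V_C1 C1_on_const open_UNIV)

lemma rho_generator:
  "rho c0 y * generator v (expc y) = (\<Sum>i\<in>UNIV. pd i (\<lambda>z. rho c0 z * gradc V z $ i) y)
     + rho c0 y * (\<Sum>i\<in>UNIV. bc y $ i * pd i V y)"
proof -
  have "g (expc y) (b (expc y)) (grad A g v (expc y)) = (\<Sum>i\<in>UNIV. bc y $ i * pd i V y)"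
    using metric_grad[of "expc y" v c0 "b (expc y)"] differentiable_in_chart[of v "expc y"] V_diff b_tangent
    by simp
  then show ?thesis
    by (simp add: generator_def distrib_left laplacian_c0[OF v])
qed

lemma rho_generator_continuous: "continuous_on UNIV (\<lambda>y. rho c0 y * generator v (expc y))"
  unfolding rho_generator
  by (intro continuous_intros C1_on_pd flux_parts_C1 V_C1 C1_on_continuous[OF rho_c0_C1]
      C1_on_continuous[OF C1_on_nth[OF open_UNIV bc_C1]])

text \<open>The terms pairing \<open>P'\<close> with the gradient of \<open>V\<close> cancel: by
  \<open>gradc_inner\<close>, the derivative of \<open>sq\<close> along that gradient is 2 times the
  derivative of \<open>V\<close> along y. Euler's identity produces the coefficient 4 of
  \<open>P''\<close>.\<close>

lemma sum_pd_flux: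
  "(\<Sum>i\<in>UNIV. pd i (flux i) y) = P (sq y) * (rho c0 y * generator v (expc y))
    + V y * (- 2 * P' (sq y) * (\<Sum>i\<in>UNIV. pd i (\<lambda>z. rho c0 z * z $ i) y) - 4 * P'' (sq y) * rho c0 y * sq y
      + P (sq y) * (\<Sum>i\<in>UNIV. pd i (\<lambda>z. rho c0 z * bc z $ i) y) + P' (sq y) * rho c0 y * (\<Sum>i\<in>UNIV. pd i sq y * bc y $ i))"
proof -
  let ?g = "\<lambda>i. pd i (\<lambda>z. rho c0 z * gradc V z $ i) y" and ?x = "\<lambda>i. pd i (\<lambda>z. rho c0 z * z $ i) y"
    and ?b = "\<lambda>i. pd i (\<lambda>z. rho c0 z * bc z $ i) y"
  note d = flux_parts_C1[THEN C1_on_differentiable, OF open_UNIV UNIV_I] Psq_C1[THEN C1_on_differentiable, OF open_UNIV UNIV_I]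
    V_diff
  have "pd i (flux i) y = P (sq y) * ?g i
      + P' (sq y) * rho c0 y * (pd i sq y * gradc V y $ i)
      + V y * (- 2 * P' (sq y) * ?x i - 2 * P'' (sq y) * rho c0 y * (pd i sq y * y $ i)
        + P (sq y) * ?b i + P' (sq y) * rho c0 y * (pd i sq y * bc y $ i))
      + (- 2 * P' (sq y) * rho c0 y * (y $ i * pd i V y) + P (sq y) * rho c0 y * (bc y $ i * pd i V y))" for i
    unfolding flux_def[abs_def] pd_flux_shape[OF d(4,5,1,2,3,6)] pd_Psq
    by (simp add: algebra_simps del: comp_apply)
  then have "(\<Sum>i\<in>UNIV. pd i (flux i) y) = P (sq y) * (\<Sum>i\<in>UNIV. ?g i)
      + P' (sq y) * rho c0 y * (\<Sum>i\<in>UNIV. pd i sq y * gradc V y $ i)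
      + V y * (- 2 * P' (sq y) * (\<Sum>i\<in>UNIV. ?x i) - 2 * P'' (sq y) * rho c0 y * (\<Sum>i\<in>UNIV. pd i sq y * y $ i)
        + P (sq y) * (\<Sum>i\<in>UNIV. ?b i) + P' (sq y) * rho c0 y * (\<Sum>i\<in>UNIV. pd i sq y * bc y $ i))
      + (- 2 * P' (sq y) * rho c0 y * (\<Sum>i\<in>UNIV. y $ i * pd i V y) + P (sq y) * rho c0 y * (\<Sum>i\<in>UNIV. bc y $ i * pd i V y))"
    by (simp only: sum.distrib sum_subtractf sum_distrib_left[symmetric])
  moreover have "(\<Sum>i\<in>UNIV. pd i sq y * gradc V y $ i) = 2 * (\<Sum>j\<in>UNIV. y $ j * pd j V y)"
    using gradc_inner[of y y V] by (simp add: pd_sq_gauss mult.assoc flip: sum_distrib_left)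
  ultimately show ?thesis
    unfolding rho_generator sum_pd_sq by (simp only:) (simp add: algebra_simps)
qed

text \<open>In \<open>sum_pd_flux\<close> the term with \<open>P''\<close> enters negatively and is
  discarded; the three geometric bounds are multiplied by factors of matching sign and add up to
  \<open>kap\<close> and \<open>C\<^sub>d\<close>.\<close>

lemma flux_bound:
  assumes y: "y \<noteq> 0"
  shows "(\<Sum>i\<in>UNIV. pd i (flux i) y) + rho c0 y * (V y * (2 * P' (sq y) * kap - C\<^sub>d * P (sq y)))
    \<le> P (sq y) * (rho c0 y * generator v (expc y))"
proof -
  let ?X = "\<Sum>i\<in>UNIV. pd i (\<lambda>z. rho c0 z * z $ i) y" and ?B = "\<Sum>i\<in>UNIV. pd i (\<lambda>z. rho c0 z * bc z $ i) y"
    and ?S = "\<Sum>i\<in>UNIV. pd i sq y * bc y $ i"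
  have "- 2 * P' (sq y) * ?X \<le> - 2 * P' (sq y) * (rho c0 y * (C\<^sub>1 * (real CARD('n) - 1) + 1))"
    using sum_pd_rho_coord[OF y] P'_nonpos by (intro mult_left_mono) auto
  moreover have "4 * P'' (sq y) * rho c0 y * sq y \<ge> 0"
    using P''_nonneg[of "sq y"] rho_c0_pos[of y] sq_nonneg[of y] by simp
  moreover have "P (sq y) * ?B \<le> P (sq y) * (rho c0 y * C\<^sub>d)"
    using sum_pd_rho_b P_nonneg by (intro mult_left_mono) auto
  moreover have "P' (sq y) * rho c0 y * ?S \<le> P' (sq y) * rho c0 y * (- 2 * \<sigma>)"
    using sum_pd_sq_b[OF y] P'_nonpos[of "sq y"] rho_c0_pos[of y]
    by (intro mult_left_mono_neg) (auto simp: mult_nonpos_nonneg less_imp_le)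
  ultimately have "- 2 * P' (sq y) * ?X - 4 * P'' (sq y) * rho c0 y * sq y + P (sq y) * ?B + P' (sq y) * rho c0 y * ?S
    \<le> - 2 * P' (sq y) * (rho c0 y * (C\<^sub>1 * (real CARD('n) - 1) + 1)) + P (sq y) * (rho c0 y * C\<^sub>d) + P' (sq y) * rho c0 y * (- 2 * \<sigma>)"
    by linarith
  also have "\<dots> = - (rho c0 y * (2 * P' (sq y) * kap - C\<^sub>d * P (sq y)))"
    by (simp add: kap_def algebra_simps)
  finally have "V y * (- 2 * P' (sq y) * ?X - 4 * P'' (sq y) * rho c0 y * sq y + P (sq y) * ?B + P' (sq y) * rho c0 y * ?S)
    \<le> V y * (- (rho c0 y * (2 * P' (sq y) * kap - C\<^sub>d * P (sq y))))"
    by (intro mult_left_mono) (simp_all add: v_nonneg)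
  then show ?thesis
    unfolding sum_pd_flux by (simp add: algebra_simps del: comp_apply)
qed

text \<open>The flux has compact support, so its divergence integrates to 0; the origin, excluded in
  \<open>flux_bound\<close>, is a null set.\<close>

lemma weak_inequality:
  shows "integrable lborel (\<lambda>y. P (sq y) * (rho c0 y * generator v (expc y)))" (is "integrable lborel ?K")
    and "integrable lborel (\<lambda>y. rho c0 y * (V y * (2 * P' (sq y) * kap - C\<^sub>d * P (sq y))))" (is "integrable lborel ?L")
    and "(LINT y|lborel. rho c0 y * (V y * (2 * P' (sq y) * kap - C\<^sub>d * P (sq y))))
      \<le> (LINT y|lborel. P (sq y) * (rho c0 y * generator v (expc y)))"
proof -
  obtain R where R: "\<And>y. sq y \<le> R\<^sub>0 \<Longrightarrow> norm y \<le> R" using sq_coercive by blast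
  then have R': "R\<^sub>0 < sq y" if "R < norm y" for y using that by (meson not_le)
  have Pc: "continuous_on UNIV (\<lambda>y. P (sq y))" "continuous_on UNIV (\<lambda>y. P' (sq y))"
    using Psq_C1 C1_on_continuous by blast+
  show 1: "integrable lborel (\<lambda>y. ?K y)"
    by (rule integrable_compact_support[where R = R])
      (auto intro!: continuous_on_mult rho_generator_continuous Pc simp: P_supp[OF R'])
  show 2: "integrable lborel (\<lambda>y. ?L y)"
    by (rule integrable_compact_support[where R = R])
      (auto intro!: continuous_intros C1_on_continuous[OF rho_c0_C1] C1_on_continuous[OF V_C1, unfolded o_def] Pc
        simp: P_supp[OF R'] P'_supp[OF R'])
  have f0: "flux i y = 0" if "R < norm y" for i y
    by (simp add: flux_def P_supp[OF R'[OF that]] P'_supp[OF R'[OF that]])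
  note fl = integral_pd_zero[OF flux_C1 f0]
  have "(LINT y|lborel. ?L y)
     = (LINT y|lborel. (\<Sum>i\<in>UNIV. pd i (flux i) y) + ?L y)"
    using fl 2 by (simp add: Bochner_Integration.integral_add Bochner_Integration.integral_sum)
  also have "\<dots> \<le> (LINT y|lborel. ?K y)"
  proof (rule integral_mono_AE)
    show "AE y in lborel. (\<Sum>i\<in>UNIV. pd i (flux i) y) + ?L y
      \<le> ?K y"
      using AE_lborel_singleton[of "0::real^'n"] by eventually_elim (rule flux_bound)
  qed (use fl 1 2 in auto)
  finally show "(LINT y|lborel. ?L y)
      \<le> (LINT y|lborel. ?K y)" .
qed

end

end

section \<open>The comparison profile\<close>

text \<open>The building block for powers of the positive part, since (max 0 z)^2 = (z^2 + z |z|) /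
  2. At 0 the difference quotient is |h|.\<close>

lemma DERIV_mult_abs: "((\<lambda>z. z * \<bar>z\<bar>) has_real_derivative 2 * \<bar>z\<bar>) (at z)"
proof (cases "z = 0")
  case True
  have "((\<lambda>h. ((0 + h) * \<bar>0 + h\<bar> - 0 * \<bar>0\<bar>) / h) \<longlongrightarrow> 0) (at (0::real))"
  proof (rule tendsto_cong[THEN iffD1])
    show "((\<lambda>h::real. \<bar>h\<bar>) \<longlongrightarrow> 0) (at 0)"
      by (intro tendsto_rabs_zero tendsto_ident_at)
    show "\<forall>\<^sub>F h in at (0::real). \<bar>h\<bar> = ((0 + h) * \<bar>0 + h\<bar> - 0 * \<bar>0\<bar>) / h"
      by (auto simp: eventually_at_filter)
  qed
  then show ?thesis using True by (simp add: DERIV_def)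
next
  case False
  show ?thesis
  proof (cases "z > 0")
    case True
    have "((\<lambda>z. z * z) has_real_derivative 2 * \<bar>z\<bar>) (at z)"
      using True by (auto intro!: derivative_eq_intros)
    then show ?thesis
      by (rule has_field_derivative_transform_within_open[where S = "{0<..}"]) (use True in auto)
  next
    case neg: False
    have "((\<lambda>z. - (z * z)) has_real_derivative 2 * \<bar>z\<bar>) (at z)"
      using neg by (auto intro!: derivative_eq_intros)
    then show ?thesis
      by (rule has_field_derivative_transform_within_open[where S = "{..<0}"]) (use neg False in auto)
  qed
qed

lemma DERIV_pos_part_2: "((\<lambda>z::real. (max 0 z)^2) has_real_derivative 2 * max 0 z) (at z)"
proof -
  have "(\<lambda>z::real. (max 0 z)^2) = (\<lambda>z. (z * z + z * \<bar>z\<bar>) / 2)"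
    by (auto simp: fun_eq_iff power2_eq_square max_def)
  moreover have "((\<lambda>z. (z * z + z * \<bar>z\<bar>) / 2) has_real_derivative (z + z + 2 * \<bar>z\<bar>) / 2) (at z)"
    by (intro DERIV_cdivide DERIV_add DERIV_mult_abs) (auto intro!: derivative_eq_intros)
  ultimately show ?thesis by (simp only:) (erule DERIV_cong, auto simp: max_def)
qed

lemma DERIV_pos_part_3: "((\<lambda>z::real. (max 0 z)^3) has_real_derivative 3 * (max 0 z)^2) (at z)"
proof -
  have "(\<lambda>z::real. (max 0 z)^3) = (\<lambda>z. (z^3 + z * (z * \<bar>z\<bar>)) / 2)"
    by (auto simp: fun_eq_iff power3_eq_cube max_def)
  moreover have "((\<lambda>z. (z^3 + z * (z * \<bar>z\<bar>)) / 2) has_real_derivative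
      (3 * z^2 + (z * (2 * \<bar>z\<bar>) + 1 * (z * \<bar>z\<bar>))) / 2) (at z)"
    by (intro DERIV_cdivide DERIV_add DERIV_mult' DERIV_mult_abs DERIV_ident) (auto intro!: derivative_eq_intros)
  ultimately show ?thesis by (simp only:) (erule DERIV_cong, auto simp: max_def power2_eq_square)
qed

text \<open>With \<open>x = \<epsilon> * exp (a * s)\<close> the profile is \<open>exp (- a * s) * (1 - x)\<^sup>3\<close> for \<open>x \<le> 1\<close>: a convex, decreasing
  \<open>C\<^sup>2\<close> function of compact support below \<open>exp (- a * s)\<close> whose derivative is dominated by that of the latter.\<close>

definition prof :: "real \<Rightarrow> real \<Rightarrow> real \<Rightarrow> real" where
  "prof a \<epsilon> s = exp (- a * s) * (max 0 (1 - \<epsilon> * exp (a * s)))^3"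

definition prof' :: "real \<Rightarrow> real \<Rightarrow> real \<Rightarrow> real" where
  "prof' a \<epsilon> s = - a * exp (- a * s) * ((max 0 (1 - \<epsilon> * exp (a * s)))^2 * (1 + 2 * (\<epsilon> * exp (a * s))))"

definition prof'' :: "real \<Rightarrow> real \<Rightarrow> real \<Rightarrow> real" where
  "prof'' a \<epsilon> s = a^2 * exp (- a * s) *
     (max 0 (1 - \<epsilon> * exp (a * s)) * (1 + \<epsilon> * exp (a * s) + 4 * (\<epsilon> * exp (a * s))^2))"

lemma DERIV_prof: "(prof a \<epsilon> has_real_derivative prof' a \<epsilon> s) (at s)"
proof -
  define x where "x = \<epsilon> * exp (a * s)"
  define m where "m = max 0 (1 - x)"
  have "((\<lambda>s. 1 - \<epsilon> * exp (a * s)) has_real_derivative - a * x) (at s)"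
    by (auto intro!: derivative_eq_intros simp: x_def)
  from DERIV_chain2[OF DERIV_pos_part_3 this]
  have "((\<lambda>s. (max 0 (1 - \<epsilon> * exp (a * s)))^3) has_real_derivative 3 * m^2 * (- a * x)) (at s)"
    by (simp add: m_def x_def)
  moreover have "((\<lambda>s. exp (- a * s)) has_real_derivative - a * exp (- a * s)) (at s)"
    by (auto intro!: derivative_eq_intros)
  ultimately have "((\<lambda>s. exp (- a * s) * (max 0 (1 - \<epsilon> * exp (a * s)))^3) has_real_derivative
    exp (- a * s) * (3 * m^2 * (- a * x)) + (- a * exp (- a * s)) * m^3) (at s)"
    unfolding m_def x_def by (rule DERIV_mult'[rotated])
  \<comment> \<open>Valid also for x > 1, where both sides vanish; it gives the two terms of the
    product rule the common factor m^2.\<close>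
  moreover have "m^3 = m^2 * (1 - x)"
    by (auto simp: m_def max_def power3_eq_cube power2_eq_square)
  ultimately show ?thesis
    unfolding prof_def[abs_def] by (auto elim!: DERIV_cong simp: prof'_def x_def[symmetric] m_def[symmetric] algebra_simps)
qed

text \<open>Of the cube in \<open>prof\<close> one factor of the positive part remains here, so the
  second derivative is continuous. The other factor 1 + x + 4 x^2 is positive for x > 0, whence
  convexity.\<close>

lemma DERIV_prof': "(prof' a \<epsilon> has_real_derivative prof'' a \<epsilon> s) (at s)"
proof -
  define x where "x = \<epsilon> * exp (a * s)"
  define m where "m = max 0 (1 - x)"
  have "((\<lambda>s. 1 - \<epsilon> * exp (a * s)) has_real_derivative - a * x) (at s)"
    by (auto intro!: derivative_eq_intros simp: x_def)
  from DERIV_chain2[OF DERIV_pos_part_2 this]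
  have 1: "((\<lambda>s. (max 0 (1 - \<epsilon> * exp (a * s)))^2) has_real_derivative 2 * m * (- a * x)) (at s)"
    by (simp add: m_def x_def)
  have 2: "((\<lambda>s. - a * exp (- a * s)) has_real_derivative a^2 * exp (- a * s)) (at s)"
    by (auto intro!: derivative_eq_intros simp: power2_eq_square)
  have 3: "((\<lambda>s. 1 + 2 * (\<epsilon> * exp (a * s))) has_real_derivative 2 * (a * x)) (at s)"
    by (auto intro!: derivative_eq_intros simp: x_def)
  have 4: "(prof' a \<epsilon> has_real_derivative
     - a * exp (- a * s) * (m^2 * (2 * (a * x)) + 2 * m * (- a * x) * (1 + 2 * x))
     + a^2 * exp (- a * s) * (m^2 * (1 + 2 * x))) (at s)"
    using DERIV_mult'[OF 2 DERIV_mult'[OF 1 3]]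
    unfolding prof'_def[abs_def] m_def x_def .
  have "m^2 = m * (1 - x)"
    by (auto simp: m_def max_def power2_eq_square)
  then have "- a * exp (- a * s) * (m^2 * (2 * (a * x)) + 2 * m * (- a * x) * (1 + 2 * x))
     + a^2 * exp (- a * s) * (m^2 * (1 + 2 * x)) = prof'' a \<epsilon> s"
    unfolding prof''_def x_def[symmetric] m_def[symmetric]
    by (simp only:) (simp add: algebra_simps power2_eq_square)
  with 4 show ?thesis by simp
qed

text \<open>The third bound says that truncation does not steepen the profile: 1 - (1 - x)^2 (1 + 2
  x) = x^2 (3 - 2 x) is nonnegative for 0 \<le> x \<le> 1. It preserves the coefficient of
  \<open>kap\<close> in \<open>lam\<close>.\<close>

lemma prof_bounds:
  assumes "a > 0" "\<epsilon> > 0"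
  shows "0 \<le> prof a \<epsilon> s" "prof a \<epsilon> s \<le> exp (- a * s)" "- prof' a \<epsilon> s \<le> a * exp (- a * s)"
proof -
  define x where "x = \<epsilon> * exp (a * s)"
  define m where "m = max 0 (1 - x)"
  have x: "x > 0" using assms by (simp add: x_def)
  have m: "0 \<le> m" "m \<le> 1" using x by (auto simp: m_def)
  show "0 \<le> prof a \<epsilon> s" by (simp add: prof_def)
  have "m^3 \<le> 1" using m by (rule power_le_one)
  then show "prof a \<epsilon> s \<le> exp (- a * s)" by (simp add: prof_def m_def x_def)
  have "m^2 * (1 + 2 * x) \<le> 1"
  proof (cases "x \<le> 1")
    case True
    then have m1: "m = 1 - x" by (simp add: m_def)
    have "1 - m^2 * (1 + 2 * x) = x^2 * (3 - 2 * x)"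
      unfolding m1 by (simp add: power2_eq_square algebra_simps)
    also have "\<dots> \<ge> 0" using True by simp
    finally show ?thesis by simp
  next
    case False
    then have "m = 0" by (simp add: m_def)
    then show ?thesis by simp
  qed
  then have "a * exp (- a * s) * (m^2 * (1 + 2 * x)) \<le> a * exp (- a * s) * 1"
    using assms by (intro mult_left_mono) auto
  then show "- prof' a \<epsilon> s \<le> a * exp (- a * s)" by (simp add: prof'_def m_def x_def)
qed

text \<open>The support ends at the solution s of \<epsilon> exp(a s) = 1.\<close>

lemma radial_profile_prof:
  assumes a: "a > 0" and e: "\<epsilon> > 0"
  shows "radial_profile (prof a \<epsilon>) (prof' a \<epsilon>) (prof'' a \<epsilon>) (ln (1 / \<epsilon>) / a)"
proof
  have supp: "max 0 (1 - \<epsilon> * exp (a * s)) = 0" if "ln (1 / \<epsilon>) / a < s" for s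
  proof -
    have "ln (1 / \<epsilon>) < a * s" using that a by (simp add: pos_divide_less_eq mult.commute)
    then have "exp (ln (1 / \<epsilon>)) < exp (a * s)" by simp
    then show ?thesis using e by (simp add: pos_divide_less_eq mult.commute)
  qed
  show "prof a \<epsilon> s = 0" "prof' a \<epsilon> s = 0" if "ln (1 / \<epsilon>) / a < s" for s
    using supp[OF that] by (simp_all add: prof_def prof'_def)
  show "continuous_on UNIV (prof'' a \<epsilon>)"
    unfolding prof''_def[abs_def] by (intro continuous_intros)
  show "prof' a \<epsilon> s \<le> 0" for s
    using a e by (simp add: prof'_def)
  show "0 \<le> prof'' a \<epsilon> s" for s
    using e by (simp add: prof''_def add_nonneg_nonneg)
  show "0 \<le> prof a \<epsilon> s" for s by (rule prof_bounds[OF a e])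
qed (rule DERIV_prof DERIV_prof')+

lemma prof_tendsto: "(\<lambda>n. prof a (1 / real (Suc n)) s) \<longlonglongrightarrow> exp (- a * s)"
proof -
  have "(\<lambda>n. exp (- a * s) * (max 0 (1 - (1 / real (Suc n)) * exp (a * s)))^3)
    \<longlonglongrightarrow> exp (- a * s) * (max 0 (1 - 0 * exp (a * s)))^3"
    using LIMSEQ_inverse_real_of_nat by (intro tendsto_intros) (simp add: inverse_eq_divide)
  then show ?thesis by (simp add: prof_def)
qed

section \<open>Blow-up for a differential inequality\<close>

text \<open>Above the threshold \<open>y\<^sub>1\<close> the linear term is at most the fraction 1 -
  c of y^q, and \<kappa> is at most half of the remaining c y^q; hence y' \<ge> (c/2) y^q. Then
  y^(1-q) decreases at least at the rate (q - 1) c / 2 while it stays positive. The resulting bound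
  contains neither \<kappa> nor \<open>y 0\<close>, so \<tau> can be chosen before the
  truncation.\<close>

lemma blowup_time_bound:
  fixes y y' :: "real \<Rightarrow> real"
  assumes q: "q > 1" and lam: "lam \<ge> 0" and y1: "y\<^sub>1 > 0" "lam < y\<^sub>1 powr (q - 1)" and \<tau>: "\<tau> > 0"
    and cont: "continuous_on {0..\<tau>} y"
    and D: "\<And>t. 0 < t \<Longrightarrow> t < \<tau> \<Longrightarrow> (y has_real_derivative y' t) (at t)"
    and ineq: "\<And>t. 0 < t \<Longrightarrow> t < \<tau> \<Longrightarrow> y' t \<ge> y t powr q - lam * y t - \<kappa>"
    and y0: "y 0 > y\<^sub>1"
    and c: "c = 1 - lam / y\<^sub>1 powr (q - 1)" and \<kappa>: "\<kappa> \<le> c / 2 * y\<^sub>1 powr q"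
  shows "\<tau> < 2 * y\<^sub>1 powr (1 - q) / ((q - 1) * c)"
proof -
  have c0: "c > 0" using y1 by (simp add: c)
  have grow: "y' t \<ge> c / 2 * y t powr q" if t: "0 < t" "t < \<tau>" and ge: "y t \<ge> y\<^sub>1" for t
  proof -
    have yt: "y t > 0" using ge y1 by simp
    have "lam / y\<^sub>1 powr (q - 1) * y t powr (q - 1) \<ge> lam / y\<^sub>1 powr (q - 1) * y\<^sub>1 powr (q - 1)"
      using ge q lam y1 by (intro mult_left_mono powr_mono2) auto
    then have "lam \<le> lam / y\<^sub>1 powr (q - 1) * y t powr (q - 1)" using y1 by simp
    then have "lam * y t \<le> lam / y\<^sub>1 powr (q - 1) * y t powr (q - 1) * y t"
      using yt by (intro mult_right_mono) auto
    also have "\<dots> = lam / y\<^sub>1 powr (q - 1) * y t powr q"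
      using yt by (simp add: powr_diff)
    finally have "y t powr q - lam * y t \<ge> c * y t powr q"
      by (simp add: c left_diff_distrib)
    moreover have "\<kappa> \<le> c / 2 * y t powr q"
      using \<kappa> ge y1 q c0 by (meson less_imp_le order_trans mult_left_mono powr_mono2 half_gt_zero less_trans zero_less_one)
    ultimately show ?thesis using ineq[OF t] by simp
  qed
  have above: "y t > y\<^sub>1" if "t \<in> {0..\<tau>}" for t
  proof (rule ccontr)
    assume "\<not> y t > y\<^sub>1"
    define S where "S = {s \<in> {0..\<tau>}. y s \<le> y\<^sub>1}"
    have "closed S" unfolding S_def
      by (intro continuous_on_closed_Collect_le cont continuous_on_const) auto
    moreover have "S \<subseteq> {0..\<tau>}" by (auto simp: S_def)
    ultimately have "compact S" using compact_Icc compact_Int_closed by (metis inf.absorb2)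
    moreover have "t \<in> S" using that \<open>\<not> y t > y\<^sub>1\<close> by (simp add: S_def)
    \<comment> \<open>The first time at which the threshold is reached: before it the derivative is
      positive, so \<open>y\<close> could not have come down from \<open>y 0\<close>.\<close>
    ultimately obtain t0 where t0: "t0 \<in> S" "\<And>s. s \<in> S \<Longrightarrow> t0 \<le> s"
      using compact_attains_inf[of S] by auto
    have t0': "0 \<le> t0" "t0 \<le> \<tau>" "y t0 \<le> y\<^sub>1" using t0 by (auto simp: S_def)
    then have pos: "0 < t0" using y0 by (cases "t0 = 0") auto
    have "\<exists>l z. 0 < z \<and> z < t0 \<and> (y has_real_derivative l) (at z) \<and> y t0 - y 0 = (t0 - 0) * l"
    proof (rule MVT[OF pos])
      show "continuous_on {0..t0} y" by (rule continuous_on_subset[OF cont]) (use t0' in auto)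
      show "y differentiable at s" if "0 < s" "s < t0" for s
        using D[of s] that t0' unfolding real_differentiable_def by auto
    qed
    then obtain l z where z: "0 < z" "z < t0" "(y has_real_derivative l) (at z)" "y t0 - y 0 = t0 * l" by auto
    then have l: "l = y' z" using D[of z] t0' DERIV_unique by fastforce
    have "y z > y\<^sub>1" using t0(2)[of z] z t0' by (force simp: S_def)
    then have "y' z \<ge> c / 2 * y z powr q" using z t0' by (intro grow) auto
    moreover have "c / 2 * y z powr q > 0" using c0 \<open>y z > y\<^sub>1\<close> y1 by simp
    ultimately have "t0 * l > 0" using pos l by simp
    then show False using z(4) t0'(3) y0 by simp
  qed
  \<comment> \<open>Separation of variables: this power turns y' \<ge> (c/2) y^q into a constant
    bound for the derivative.\<close>
  define w where "w t = y t powr (1 - q)" for t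
  have wc: "continuous_on {0..\<tau>} w"
    unfolding w_def using above y1 by (intro continuous_on_powr cont continuous_on_const) force
  have Dw: "(w has_real_derivative (1 - q) * y t powr (- q) * y' t) (at t)" if "0 < t" "t < \<tau>" for t
  proof -
    have "y t > 0" using above[of t] that y1 by simp
    then have "(w has_real_derivative (1 - q) * y t powr (1 - q - 1) * y' t) (at t)"
      unfolding w_def using DERIV_fun_powr[OF D[OF that], of "1 - q"] by simp
    then show ?thesis by simp
  qed
  have "\<exists>l z. 0 < z \<and> z < \<tau> \<and> (w has_real_derivative l) (at z) \<and> w \<tau> - w 0 = (\<tau> - 0) * l"
    by (rule MVT[OF \<tau> wc]) (use Dw in \<open>auto simp: real_differentiable_def\<close>)
  then obtain l z where z: "0 < z" "z < \<tau>" "(w has_real_derivative l) (at z)" "w \<tau> - w 0 = \<tau> * l" by auto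
  then have l: "l = (1 - q) * y z powr (- q) * y' z" using Dw[of z] DERIV_unique by fastforce
  have yz: "y z > y\<^sub>1" using above z by simp
  have "(1 - q) * y z powr (- q) * y' z \<le> (1 - q) * y z powr (- q) * (c / 2 * y z powr q)"
    using grow[of z] z yz q by (intro mult_left_mono_neg) (auto simp: mult_nonpos_nonneg)
  also have "\<dots> = (1 - q) * c / 2"
    using yz y1 by (simp add: powr_minus field_simps)
  finally have "\<tau> * l \<le> \<tau> * ((1 - q) * c / 2)" using l \<tau> by simp
  moreover have "w \<tau> > 0" using above[of \<tau>] \<tau> y1 by (simp add: w_def)
  ultimately have "\<tau> * ((q - 1) * c / 2) < w 0" using z(4) by (simp add: algebra_simps)
  also have "w 0 \<le> y\<^sub>1 powr (1 - q)"
    unfolding w_def using y0 y1 q by (intro powr_mono2') auto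
  finally have "\<tau> * ((q - 1) * c) < 2 * y\<^sub>1 powr (1 - q)" by simp
  then show ?thesis using q c0 by (simp add: pos_less_divide_eq)
qed

text \<open>For x > 0 this is convexity. At x = 0 the tangent has the value (1 - q) m^q, which is at
  most 0.\<close>

lemma powr_tangent:
  fixes x m q :: real
  assumes "x \<ge> 0" "m > 0" "q > 1"
  shows "x powr q \<ge> m powr q + q * m powr (q - 1) * (x - m)"
proof (cases "x = 0")
  case True
  have "m powr q + q * m powr (q - 1) * (0 - m) = (1 - q) * m powr q"
    using assms by (simp add: powr_diff algebra_simps)
  also have "\<dots> \<le> 0" using assms by (intro mult_nonpos_nonneg) auto
  finally show ?thesis using True by simp
next
  case False
  have "q * m powr (q - 1) * (x - m) \<le> x powr q - m powr q"
  proof (rule convex_on_imp_above_tangent[OF powr_convex])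
    show "((\<lambda>x. x powr q) has_real_derivative q * m powr (q - 1)) (at m within {0<..})"
      using has_real_derivative_powr[OF assms(2)] by (rule DERIV_subset) simp
  qed (use assms False in \<open>auto simp: interior_open\<close>)
  then show ?thesis by simp
qed

text \<open>The tangent of x^q at the mean m is integrated against \<open>w\<close>. Its constant
  term (1 - q) m^q is nonpositive, so total mass at most 1 suffices; this is what the truncated
  weights have.\<close>

lemma jensen_powr:
  fixes w f :: "'a \<Rightarrow> real"
  assumes q: "q > 1" and k: "k > 0"
    and int: "integrable M w" "integrable M (\<lambda>x. w x * f x)" "integrable M (\<lambda>x. w x * f x powr q)"
    and w: "\<And>x. 0 \<le> w x" and f: "\<And>x. 0 \<le> f x" and le: "k * (LINT x|M. w x) \<le> 1"
  shows "(k * (LINT x|M. w x * f x)) powr q \<le> k * (LINT x|M. w x * f x powr q)"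
proof -
  define m where "m = k * (LINT x|M. w x * f x)"
  have m0: "m \<ge> 0" using k w f by (auto simp: m_def intro!: integral_nonneg_AE)
  show ?thesis
  proof (cases "m = 0")
    case True
    have "0 \<le> k * (LINT x|M. w x * f x powr q)"
      using k w by (auto intro!: mult_nonneg_nonneg integral_nonneg_AE)
    then show ?thesis unfolding m_def[symmetric] True by simp
  next
    case False
    then have m: "m > 0" using m0 by simp
    define A where "A = m powr q - q * m powr (q - 1) * m"
    have A: "A = - (q - 1) * m powr q" using m by (simp add: A_def powr_diff algebra_simps)
    have "(LINT x|M. A * w x + (q * m powr (q - 1)) * (w x * f x)) \<le> (LINT x|M. w x * f x powr q)"
    proof (rule integral_mono)
      fix x
      have "w x * (m powr q + q * m powr (q - 1) * (f x - m)) \<le> w x * f x powr q"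
        using powr_tangent[OF f m q] w by (intro mult_left_mono) auto
      then show "A * w x + (q * m powr (q - 1)) * (w x * f x) \<le> w x * f x powr q"
        by (simp add: A_def algebra_simps)
    qed (use int in auto)
    also have "(LINT x|M. A * w x + (q * m powr (q - 1)) * (w x * f x)) = A * (LINT x|M. w x) + (q * m powr (q - 1)) * (LINT x|M. w x * f x)"
      using int by simp
    finally have "k * (A * (LINT x|M. w x) + (q * m powr (q - 1)) * (LINT x|M. w x * f x)) \<le> k * (LINT x|M. w x * f x powr q)"
      using k by simp
    moreover have "k * (A * (LINT x|M. w x) + (q * m powr (q - 1)) * (LINT x|M. w x * f x))
      = A * (k * (LINT x|M. w x)) + q * m powr (q - 1) * m"
      by (simp add: m_def algebra_simps)
    moreover have "A * (k * (LINT x|M. w x)) \<ge> A * 1"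
      using le A m q by (intro mult_left_mono_neg) (auto intro!: mult_nonpos_nonneg)
    ultimately show ?thesis by (simp add: A_def m_def)
  qed
qed

section \<open>The volume measure in normal coordinates\<close>

locale pole_volume = pole_mfd A g x\<^sub>0
  for A :: "('m::topological_space, 'n::finite) chart set" and g and x\<^sub>0 +
  fixes \<mu> :: "'m measure"
  assumes vol: "riemannian_volume A g \<mu>"
begin

lemma expc_measurable [measurable]: "expc \<in> borel \<rightarrow>\<^sub>M borel"
  by (rule borel_measurable_continuous_onI[OF expc_continuous])

lemma c0_measurable [measurable]: "snd c0 \<in> borel \<rightarrow>\<^sub>M borel"
  by (rule borel_measurable_continuous_onI[OF c0_continuous])

lemma rho_measurable [measurable]: "rho c0 \<in> borel_measurable borel"
  by (rule borel_measurable_continuous_onI[OF C1_on_continuous[OF rho_c0_C1]])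

text \<open>The domain of \<open>c0\<close> is the whole manifold, so the defining property of the
  volume in this one chart determines it on every Borel set.\<close>

lemma volume_eq: "\<mu> = distr (density lborel (\<lambda>y. ennreal (rho c0 y))) borel expc"
proof (rule measure_eqI)
  show "sets \<mu> = sets (distr (density lborel (\<lambda>y. ennreal (rho c0 y))) borel expc)"
    using vol by (simp add: riemannian_volume_def)
  fix B assume "B \<in> sets \<mu>"
  then have B: "B \<in> sets borel" using vol by (simp add: riemannian_volume_def)
  have im: "snd c0 ` B = expc -` B"
  proof -
    have "y \<in> snd c0 ` B" if "expc y \<in> B" for y using that by (metis c0_expc imageI)
    then show ?thesis by auto
  qed
  have "emeasure \<mu> B = (\<integral>\<^sup>+ y\<in>snd c0 ` B. ennreal (rho c0 y) \<partial>lborel)"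
    using vol c0_in B unfolding riemannian_volume_def rho_def by auto
  also have "\<dots> = emeasure (density lborel (\<lambda>y. ennreal (rho c0 y))) (expc -` B)"
    using measurable_sets[OF expc_measurable B] by (subst emeasure_density) (auto simp: im)
  also have "\<dots> = emeasure (distr (density lborel (\<lambda>y. ennreal (rho c0 y))) borel expc) B"
    using B by (subst emeasure_distr) auto
  finally show "emeasure \<mu> B = emeasure (distr (density lborel (\<lambda>y. ennreal (rho c0 y))) borel expc) B" .
qed

lemma volume_integral:
  fixes f :: "'m \<Rightarrow> real"
  assumes f: "f \<in> borel_measurable borel"
  shows "(LINT x|\<mu>. f x) = (LINT y|lborel. rho c0 y * f (expc y))"
    and "integrable \<mu> f \<longleftrightarrow> integrable lborel (\<lambda>y. rho c0 y * f (expc y))"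
proof -
  have m: "expc \<in> density lborel (\<lambda>y. ennreal (rho c0 y)) \<rightarrow>\<^sub>M borel" by simp
  have fm: "(\<lambda>y. f (expc y)) \<in> borel_measurable lborel"
    using measurable_compose[OF expc_measurable f] by simp
  have nn: "AE y in lborel. 0 \<le> rho c0 y" using rho_c0_pos by (auto intro!: AE_I2 less_imp_le)
  show "(LINT x|\<mu>. f x) = (LINT y|lborel. rho c0 y * f (expc y))"
    unfolding volume_eq by (subst integral_distr[OF m f], subst integral_density) (use fm nn in auto)
  show "integrable \<mu> f \<longleftrightarrow> integrable lborel (\<lambda>y. rho c0 y * f (expc y))"
    unfolding volume_eq by (subst integrable_distr_eq[OF m f], subst integrable_density) (use fm nn in auto)
qed

lemma AE_volume:
  assumes "{x. P x} \<in> sets borel" "AE x in \<mu>. P x"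
  shows "AE y in lborel. P (expc y)"
proof -
  have "AE y in density lborel (\<lambda>y. ennreal (rho c0 y)). P (expc y)"
    using assms unfolding volume_eq by (subst (asm) AE_distr_iff) auto
  then show ?thesis
    using rho_c0_pos by (subst (asm) AE_density) auto
qed

text \<open>Required for the product with the time interval. The density is finite, so the image
  under \<open>snd c0\<close> is sigma-finite, and the property passes back along the map.\<close>

lemma sigma_finite_volume: "sigma_finite_measure \<mu>"
proof (rule sigma_finite_measure_distr)
  have s: "sets \<mu> = sets borel" using vol by (simp add: riemannian_volume_def)
  show "snd c0 \<in> \<mu> \<rightarrow>\<^sub>M borel" using c0_measurable by (simp add: measurable_cong_sets[OF s refl])
  have "distr \<mu> borel (snd c0) = distr (density lborel (\<lambda>y. ennreal (rho c0 y))) borel (snd c0 \<circ> expc)"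
    unfolding volume_eq by (rule distr_distr) auto
  also have "\<dots> = distr (density lborel (\<lambda>y. ennreal (rho c0 y))) (density lborel (\<lambda>y. ennreal (rho c0 y))) (\<lambda>y. y)"
    by (rule distr_cong) auto
  also have "\<dots> = density lborel (\<lambda>y. ennreal (rho c0 y))" by (rule distr_id)
  finally have "distr \<mu> borel (snd c0) = density lborel (\<lambda>y. ennreal (rho c0 y))" .
  moreover have "sigma_finite_measure (density lborel (\<lambda>y. ennreal (rho c0 y)))"
    by (subst sigma_finite_measure.sigma_finite_iff_density_finite[OF lborel.sigma_finite_measure_axioms]) auto
  ultimately show "sigma_finite_measure (distr \<mu> borel (snd c0))" by simp
qed

text \<open>Almost every point has the bound at almost every time. Continuity in time extends it to
  every time, including 0, with one null set of points for all times.\<close>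

lemma bounded_of_ess_bounded:
  fixes u :: "'m \<Rightarrow> real \<Rightarrow> real"
  assumes cont: "continuous_on (UNIV \<times> {0..}) (\<lambda>(x, t). u x t)" and \<tau>: "\<tau> > 0"
    and ess: "ess_bounded (\<mu> \<Otimes>\<^sub>M restrict_space lborel {0<..<\<tau>}) (\<lambda>(x, t). u x t)"
  shows "\<exists>K\<ge>0. AE y in lborel. \<forall>t\<in>{0..<\<tau>}. u (expc y) t \<le> K"
proof -
  interpret M: sigma_finite_measure \<mu> by (rule sigma_finite_volume)
  interpret R: sigma_finite_measure "restrict_space lborel {0<..<\<tau>}"
    by (rule sigma_finite_measure_restrict_space) (auto intro: lborel.sigma_finite_measure_axioms)
  interpret pair_sigma_finite \<mu> "restrict_space lborel {0<..<\<tau>}" ..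
  obtain K where K: "AE z in \<mu> \<Otimes>\<^sub>M restrict_space lborel {0<..<\<tau>}. \<bar>(\<lambda>(x, t). u x t) z\<bar> \<le> K"
    using ess unfolding ess_bounded_def by blast
  have ct: "continuous_on {0..} (u x)" for x
  proof -
    have "continuous_on {0..} (\<lambda>t. (\<lambda>(x, t). u x t) (x, t))"
      by (rule continuous_on_compose2[OF cont]) (auto intro!: continuous_intros)
    then show ?thesis by simp
  qed
  have cx: "continuous_on UNIV (\<lambda>x. u x t)" if "t \<ge> 0" for t
  proof -
    have "continuous_on UNIV (\<lambda>x. (\<lambda>(x, t). u x t) (x, t))"
      by (rule continuous_on_compose2[OF cont]) (use that in \<open>auto intro!: continuous_intros\<close>)
    then show ?thesis by simp
  qed
  have "AE x in \<mu>. AE t in restrict_space lborel {0<..<\<tau>}. \<bar>u x t\<bar> \<le> K"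
    using AE_pair[OF K] by simp
  then have ae: "AE x in \<mu>. \<forall>t\<in>{0..<\<tau>}. u x t \<le> K"
  proof eventually_elim
    fix x assume "AE t in restrict_space lborel {0<..<\<tau>}. \<bar>u x t\<bar> \<le> K"
    then have x: "AE t in lborel. t \<in> {0<..<\<tau>} \<longrightarrow> \<bar>u x t\<bar> \<le> K"
      by (subst (asm) AE_restrict_space_iff) auto
    show "\<forall>t\<in>{0..<\<tau>}. u x t \<le> K"
    proof (rule ballI, rule ccontr)
      fix t0 assume t0: "t0 \<in> {0..<\<tau>}" and gt: "\<not> u x t0 \<le> K"
      have "(u x \<longlongrightarrow> u x t0) (at t0 within {0..})"
        using ct[of x] t0 by (auto simp: continuous_on_def)
      then have "\<forall>\<^sub>F t in at t0 within {0..}. K < u x t"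
        using gt by (intro order_tendstoD(1)) auto
      then obtain d where d: "d > 0" "\<And>t. t \<in> {0..} \<Longrightarrow> t \<noteq> t0 \<Longrightarrow> dist t t0 < d \<Longrightarrow> K < u x t"
        unfolding eventually_at by blast
      \<comment> \<open>The interval lies to the right of \<open>t0\<close>, which may be 0; on it
        the bound fails, although it has positive length.\<close>
      define t1 where "t1 = min (t0 + d) \<tau>"
      have t1: "t0 < t1" using d(1) t0 by (auto simp: t1_def)
      have "AE t in lborel. t \<notin> {t0<..<t1}"
        using x
      proof eventually_elim
        fix t assume t: "t \<in> {0<..<\<tau>} \<longrightarrow> \<bar>u x t\<bar> \<le> K"
        show "t \<notin> {t0<..<t1}"
        proof
          assume "t \<in> {t0<..<t1}"
          then have "t \<in> {0<..<\<tau>}" "K < u x t"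
            using t0 by (auto simp: t1_def dist_real_def intro!: d(2))
          then show False using t by auto
        qed
      qed
      then have "emeasure lborel {t0<..<t1} = 0"
        by (subst (asm) AE_iff_measurable[OF _ refl]) (auto simp: greaterThanLessThan_def Int_def)
      then show False using t1 by simp
    qed
  qed
  \<comment> \<open>Measurability, from an intersection of closed sets, allows the null set to be
    pulled back along \<open>expc\<close>.\<close>
  have "{x. \<forall>t\<in>{0..<\<tau>}. u x t \<le> K} \<in> sets borel"
  proof -
    have "closed (\<Inter>t\<in>{0..<\<tau>}. {x. u x t \<le> K})"
      by (intro closed_INT ballI closed_Collect_le cx continuous_on_const) auto
    moreover have "(\<Inter>t\<in>{0..<\<tau>}. {x. u x t \<le> K}) = {x. \<forall>t\<in>{0..<\<tau>}. u x t \<le> K}" by auto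
    ultimately show ?thesis by (metis borel_closed)
  qed
  from AE_volume[OF this ae] have "AE y in lborel. \<forall>t\<in>{0..<\<tau>}. u (expc y) t \<le> max K 0"
    by eventually_elim (auto simp: le_max_iff_disj)
  then show ?thesis by (intro exI[of _ "max K 0"]) auto
qed

end

text \<open>Continuity and differentiation under the integral sign are used for gauge integrals over
  a fixed box.\<close>

lemma LINT_eq_integral_cbox:
  fixes f :: "'a::euclidean_space \<Rightarrow> real"
  assumes f: "continuous_on UNIV f" and R: "\<And>y. R < norm y \<Longrightarrow> f y = 0" and ab: "cball 0 R \<subseteq> cbox l h"
  shows "(LINT y|lborel. f y) = integral (cbox l h) f"
proof -
  have "(f has_integral (LINT y|lborel. f y)) UNIV"
    by (rule has_integral_integral_lborel[OF integrable_compact_support[OF f R]])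
  moreover have "(\<lambda>y. if y \<in> cbox l h then f y else 0) = f"
  proof
    fix y
    show "(if y \<in> cbox l h then f y else 0) = f y"
      using R[of y] subsetD[OF ab, of y] by (cases "R < norm y") auto
  qed
  ultimately have "(f has_integral (LINT y|lborel. f y)) (cbox l h)"
    using has_integral_restrict_UNIV[of "cbox l h" f] by simp
  then show ?thesis by (simp add: integral_unique)
qed

section \<open>Blow-up\<close>

locale drift_volume = drift_mfd A g x\<^sub>0 b r C\<^sub>1 C\<^sub>d \<sigma> + pole_volume A g x\<^sub>0 \<mu>
  for A :: "('m::topological_space, 'n::finite) chart set" and g x\<^sub>0 b r C\<^sub>1 C\<^sub>d \<sigma> \<mu>
begin

text \<open>The constants meet here: by \<open>prof_bounds\<close> the weight in
  \<open>weak_inequality\<close> is at least -(2 a kap + C_d) exp(- a r^2), uniformly in \<epsilon>.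
  The full weight, not the truncated one, therefore appears on the left.\<close>

lemma prof_inequality:
  assumes a: "a > 0" and e: "\<epsilon> > 0" and kap: "kap \<ge> 0" and Cd: "C\<^sub>d \<ge> 0" and lam: "lam \<ge> 2 * a * kap + C\<^sub>d"
    and v: "Ck_on 2 (v \<circ> expc) UNIV" "\<And>x. 0 \<le> v x"
    and int: "integrable lborel (\<lambda>y. rho c0 y * (v (expc y) * exp (- a * sq y)))"
  shows "integrable lborel (\<lambda>y. prof a \<epsilon> (sq y) * (rho c0 y * generator v (expc y)))"
    and "- lam * (LINT y|lborel. rho c0 y * (v (expc y) * exp (- a * sq y))) \<le> (LINT y|lborel. prof a \<epsilon> (sq y) * (rho c0 y * generator v (expc y)))"
proof -
  interpret radial_profile "prof a \<epsilon>" "prof' a \<epsilon>" "prof'' a \<epsilon>" "ln (1 / \<epsilon>) / a"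
    by (rule radial_profile_prof[OF a e])
  interpret drift_profile A g x\<^sub>0 b r C\<^sub>1 C\<^sub>d \<sigma> "prof a \<epsilon>" "prof' a \<epsilon>" "prof'' a \<epsilon>" "ln (1 / \<epsilon>) / a" ..
  note W = weak_inequality[OF v]
  show "integrable lborel (\<lambda>y. prof a \<epsilon> (sq y) * (rho c0 y * generator v (expc y)))" by (rule W(1))
  have "- lam * (LINT y|lborel. rho c0 y * (v (expc y) * exp (- a * sq y)))
     = (LINT y|lborel. - lam * (rho c0 y * (v (expc y) * exp (- a * sq y))))"
    by simp
  also have "\<dots> \<le> (LINT y|lborel. rho c0 y * ((v \<circ> expc) y * (2 * prof' a \<epsilon> (sq y) * kap - C\<^sub>d * prof a \<epsilon> (sq y))))"
  proof (rule integral_mono)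
    show "integrable lborel (\<lambda>y. - lam * (rho c0 y * (v (expc y) * exp (- a * sq y))))"
      using int by (rule integrable_mult_right)
    fix y
    have "- prof' a \<epsilon> (sq y) * (2 * kap) \<le> a * exp (- a * sq y) * (2 * kap)"
      using prof_bounds(3)[OF a e] kap by (intro mult_right_mono) auto
    moreover have "C\<^sub>d * prof a \<epsilon> (sq y) \<le> C\<^sub>d * exp (- a * sq y)"
      using prof_bounds(2)[OF a e] Cd by (intro mult_left_mono) auto
    moreover have "(2 * a * kap + C\<^sub>d) * exp (- a * sq y) \<le> lam * exp (- a * sq y)"
      using lam by (intro mult_right_mono) auto
    ultimately have "- lam * exp (- a * sq y) \<le> 2 * prof' a \<epsilon> (sq y) * kap - C\<^sub>d * prof a \<epsilon> (sq y)"
      by (simp add: algebra_simps)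
    then have "rho c0 y * (v (expc y) * (- lam * exp (- a * sq y)))
      \<le> rho c0 y * (v (expc y) * (2 * prof' a \<epsilon> (sq y) * kap - C\<^sub>d * prof a \<epsilon> (sq y)))"
      using v(2) rho_c0_pos[of y] by (intro mult_left_mono) (auto intro: less_imp_le)
    then show "- lam * (rho c0 y * (v (expc y) * exp (- a * sq y)))
      \<le> rho c0 y * ((v \<circ> expc) y * (2 * prof' a \<epsilon> (sq y) * kap - C\<^sub>d * prof a \<epsilon> (sq y)))"
      by (simp add: algebra_simps)
  qed (rule W(2))
  also note W(3)
  finally show "- lam * (LINT y|lborel. rho c0 y * (v (expc y) * exp (- a * sq y))) \<le> (LINT y|lborel. prof a \<epsilon> (sq y) * (rho c0 y * generator v (expc y)))" .
qed

end

context drift_volume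
begin

lemma no_global_solution:
  assumes kap: "kap \<ge> 0" and Cd: "C\<^sub>d \<ge> 0" and a: "a > 0" and q: "q > 1"
    and lam: "lam \<ge> 2 * a * kap + C\<^sub>d"
    and \<eta>: "\<eta> = (\<lambda>x. exp (- a * (r x)\<^sup>2))" and k: "k = 1 / (LINT x|\<mu>. \<eta> x)"
    and large: "k * (LINT x|\<mu>. u\<^sub>0 x * \<eta> x) > lam powr (1 / (q - 1))"
    and adm: "admissible_solution A g \<mu> b q \<eta> u\<^sub>0 \<infinity> u"
  shows False
proof -
  have lam0: "lam \<ge> 0" using lam kap Cd a by (smt (verit) mult_nonneg_nonneg)
  have sol: "classical_solution A g b q u\<^sub>0 \<infinity> u" using adm by (simp add: admissible_solution_def)
  have u0: "u x 0 = u\<^sub>0 x" for x using sol by (simp add: classical_solution_def)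
  have nonneg: "0 \<le> u x t" if "0 \<le> t" for x t using adm that by (simp add: admissible_solution_def)
  have times: "{t. 0 \<le> t \<and> ereal t < \<infinity>} = {0..}" "{t. 0 < t \<and> ereal t < \<infinity>} = {0<..}" by auto
  have ucont: "continuous_on (UNIV \<times> {0..}) (\<lambda>(x, t). u x t)"
    using sol unfolding classical_solution_def times by blast
  have C21: "C21_on A {0<..} u" using sol unfolding classical_solution_def times by blast
  have pde: "deriv (u x) t = generator (\<lambda>z. u z t) x + u x t powr q" if "0 < t" for x t
    using sol that by (simp add: classical_solution_def generator_def)
  have udiff: "u x differentiable (at t)" if "0 < t" for x t
    using C21 that by (simp add: C21_on_def)
  note C21_c0 = bspec[OF conjunct2[OF C21[unfolded C21_on_def]] c0_in, unfolded Let_def chart_inv_c0 fst_c0 range_c0]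
  have uC2: "Ck_on 2 ((\<lambda>z. u z t) \<circ> expc) UNIV" if "0 < t" for t
    using C21_c0 that by (simp add: o_def del: Ck_on.simps)
  have dcont: "continuous_on (UNIV \<times> {0<..}) (\<lambda>(y, t). deriv (u (expc y)) t)"
    using C21_c0 by blast
  have Ucont: "continuous_on UNIV (\<lambda>y. u (expc y) t)" if "0 \<le> t" for t
  proof -
    have "continuous_on UNIV (\<lambda>y. (\<lambda>(x, t). u x t) (expc y, t))"
      by (rule continuous_on_compose2[OF ucont])
        (use that in \<open>auto intro!: continuous_intros expc_continuous\<close>)
    then show ?thesis by simp
  qed

  define E where "E y = exp (- a * sq y)" for y
  have \<eta>E: "\<eta> (expc y) = E y" for y
    using sq_nonneg[of y] by (simp add: \<eta> E_def r_expc)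
  have sqc: "continuous_on UNIV sq" by (rule C1_on_continuous[OF sq_C1])
  have Ec: "continuous_on UNIV E" unfolding E_def by (intro continuous_intros sqc)
  have \<eta>b: "\<eta> \<in> borel_measurable borel"
  proof -
    have "\<eta> = E \<circ> snd c0" using \<eta>E by (metis comp_apply expc_c0 ext)
    then have "continuous_on UNIV \<eta>"
      using continuous_on_compose[OF c0_continuous continuous_on_subset[OF Ec]] by simp
    then show ?thesis by (rule borel_measurable_continuous_onI)
  qed
  have rc: "continuous_on UNIV (rho c0)" by (rule C1_on_continuous[OF rho_c0_C1])
  note rn = rho_c0_pos[THEN less_imp_le]

  \<comment> \<open>A function that is not integrable has Bochner integral 0, and 1 / 0 = 0; so the
    largeness of the weighted mean of \<open>u\<^sub>0\<close> itself forces \<eta> to be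
    integrable.\<close>
  have knz: "(LINT x|\<mu>. \<eta> x) \<noteq> 0"
  proof
    assume "(LINT x|\<mu>. \<eta> x) = 0"
    then have "k = 0" by (simp add: k)
    then have "lam powr (1 / (q - 1)) < 0" using large by simp
    then show False by (simp add: not_less[symmetric])
  qed
  then have "integrable \<mu> \<eta>" using not_integrable_integral_eq by blast
  then have intE: "integrable lborel (\<lambda>y. rho c0 y * E y)"
    using volume_integral(2)[OF \<eta>b] by (simp add: \<eta>E)
  define Z where "Z = (LINT y|lborel. rho c0 y * E y)"
  have kZ: "k = 1 / Z" using volume_integral(1)[OF \<eta>b] by (simp add: k \<eta>E Z_def)
  have "Z \<ge> 0" unfolding Z_def using rn by (intro integral_nonneg_AE AE_I2) (simp add: E_def)
  moreover have "Z \<noteq> 0" using knz volume_integral(1)[OF \<eta>b] by (simp add: \<eta>E Z_def)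
  ultimately have Z: "Z > 0" by simp
  then have k0: "k > 0" by (simp add: kZ)

  define \<Phi> where "\<Phi> t = k * (LINT y|lborel. rho c0 y * (u (expc y) t * E y))" for t
  have \<Phi>0: "\<Phi> 0 > lam powr (1 / (q - 1))"
  proof -
    have "u\<^sub>0 = (\<lambda>x. u x 0)" by (simp add: u0)
    moreover have "continuous_on UNIV (\<lambda>x. u x 0)"
    proof -
      have "continuous_on UNIV (\<lambda>x. (\<lambda>(x, t). u x t) (x, 0))"
        by (rule continuous_on_compose2[OF ucont]) (auto intro!: continuous_intros)
      then show ?thesis by simp
    qed
    ultimately have "u\<^sub>0 \<in> borel_measurable borel" by (simp add: borel_measurable_continuous_onI)
    then have "(\<lambda>x. u\<^sub>0 x * \<eta> x) \<in> borel_measurable borel" using \<eta>b by measurable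
    from volume_integral(1)[OF this] show ?thesis using large by (simp add: \<Phi>_def \<eta>E u0)
  qed

  \<comment> \<open>The parameter \<open>1 / real (Suc n)\<close> is positive and tends to 0, so
    \<phi> n tends to \<open>E\<close> pointwise, from below.\<close>
  define \<phi> where "\<phi> n y = prof a (1 / real (Suc n)) (sq y)" for n y
  note pb = prof_bounds[OF a, of "1 / real (Suc _)"]
  have \<phi>n: "0 \<le> \<phi> n y" and \<phi>E: "\<phi> n y \<le> E y" for n y
    using pb by (simp_all add: \<phi>_def E_def)
  interpret prof: radial_profile "prof a (1 / real (Suc n))" "prof' a (1 / real (Suc n))"
      "prof'' a (1 / real (Suc n))" "ln (1 / (1 / real (Suc n))) / a" for n
    by (rule radial_profile_prof[OF a]) simp
  have \<phi>c: "continuous_on UNIV (\<phi> n)" for n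
    unfolding \<phi>_def by (rule continuous_on_compose2[OF prof.P_continuous sqc]) auto
  have "\<exists>R. \<forall>y. R < norm y \<longrightarrow> \<phi> n y = 0" for n
  proof -
    obtain R where R: "\<forall>y. sq y \<le> ln (1 / (1 / real (Suc n))) / a \<longrightarrow> norm y \<le> R"
      using sq_coercive by blast
    show ?thesis
      unfolding \<phi>_def using R prof.P_supp by (intro exI[of _ R]) (meson not_le)
  qed
  then obtain R where R: "\<And>n y. R n < norm y \<Longrightarrow> \<phi> n y = 0" by metis
  have int\<phi>: "integrable lborel (\<lambda>y. rho c0 y * \<phi> n y * f y)" if "continuous_on UNIV f" for n f
    by (rule integrable_compact_support[where R = "R n"]) (auto intro!: continuous_intros rc \<phi>c that simp: R)

  let ?F = "\<lambda>n t y. rho c0 y * \<phi> n y * u (expc y) t"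
    and ?F' = "\<lambda>n t y. rho c0 y * \<phi> n y * deriv (u (expc y)) t"
    and ?Q = "\<lambda>n t y. rho c0 y * \<phi> n y * u (expc y) t powr q"
    and ?H = "\<lambda>n t y. \<phi> n y * (rho c0 y * generator (\<lambda>z. u z t) (expc y))"
    and ?W = "\<lambda>t y. rho c0 y * (u (expc y) t * E y)"
    and ?D = "\<lambda>n y. rho c0 y * (E y - \<phi> n y)"
  \<comment> \<open>The mass of the weight lost by truncation; it controls every error
    below.\<close>
  define \<delta> where "\<delta> n = (LINT y|lborel. ?D n y)" for n
  have intd: "integrable lborel (\<lambda>y. ?D n y)" for n
    using Bochner_Integration.integrable_diff[OF intE int\<phi>[of "\<lambda>_. 1" n]] by (simp add: right_diff_distrib)
  have \<delta>0: "\<delta> n \<ge> 0" for n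
    unfolding \<delta>_def using rn \<phi>E by (intro integral_nonneg_AE AE_I2) simp
  have \<delta>lim: "\<delta> \<longlonglongrightarrow> 0"
  proof -
    have "(\<lambda>n. LINT y|lborel. ?D n y) \<longlonglongrightarrow> (LINT (y::real^'n)|lborel. 0 :: real)"
    proof (rule integral_dominated_convergence[where w = "\<lambda>y. rho c0 y * E y"])
      show "AE y in lborel. (\<lambda>n. ?D n y) \<longlonglongrightarrow> 0"
      proof (rule AE_I2)
        fix y
        have "(\<lambda>n. ?D n y) \<longlonglongrightarrow> rho c0 y * (E y - E y)"
          unfolding \<phi>_def E_def by (intro tendsto_intros prof_tendsto)
        then show "(\<lambda>n. ?D n y) \<longlonglongrightarrow> 0" by simp
      qed
      show "AE y in lborel. norm (?D n y) \<le> rho c0 y * E y" for n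
        using rn \<phi>n \<phi>E by (intro AE_I2) (simp add: abs_mult mult_left_mono)
    qed (use intE intd in auto)
    then show ?thesis by (simp add: \<delta>_def[abs_def])
  qed

  \<comment> \<open>The truncated mean. For fixed \<open>n\<close> the integrand is supported in a
    fixed box, so joint continuity of the time derivative justifies differentiation under the
    integral.\<close>
  define \<Psi> where "\<Psi> n t = k * (LINT y|lborel. ?F n t y)" for n t
  define \<Psi>' where "\<Psi>' n t = k * (LINT y|lborel. rho c0 y * \<phi> n y * deriv (u (expc y)) t)" for n t
  have dUc: "continuous_on UNIV (\<lambda>y. deriv (u (expc y)) t)" if "0 < t" for t
  proof -
    have "continuous_on UNIV (\<lambda>y. (\<lambda>(y, t). deriv (u (expc y)) t) (y, t))"
      by (rule continuous_on_compose2[OF dcont]) (use that in \<open>auto intro!: continuous_intros\<close>)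
    then show ?thesis by simp
  qed
  obtain l h where lh: "\<And>n. cball (0::real^'n) (R n) \<subseteq> cbox (l n) (h n)"
  proof -
    have "\<exists>l h. cball (0::real^'n) (R n) \<subseteq> cbox l h" for n
      using bounded_subset_cbox_symmetric[OF bounded_cball] by blast
    then show ?thesis using that by metis
  qed
  have F: "(LINT y|lborel. ?F n t y) = integral (cbox (l n) (h n)) (?F n t)" if "t \<ge> 0" for n t
    by (rule LINT_eq_integral_cbox[OF _ _ lh]) (auto intro!: continuous_intros rc \<phi>c Ucont that simp: R)
  have F': "(LINT y|lborel. ?F' n t y) = integral (cbox (l n) (h n)) (?F' n t)" if "t > 0" for n t
    by (rule LINT_eq_integral_cbox[OF _ _ lh]) (auto intro!: continuous_intros rc \<phi>c dUc that simp: R)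
  have \<Psi>cont: "continuous_on {0..} (\<Psi> n)" for n
  proof -
    have "continuous_on {0..} (\<lambda>t. integral (cbox (l n) (h n)) (?F n t))"
    proof (rule integral_continuous_on_param)
      have "continuous_on ({0..} \<times> cbox (l n) (h n)) (\<lambda>p. (\<lambda>(x, t). u x t) (expc (snd p), fst p))"
        by (rule continuous_on_compose2[OF ucont])
          (auto intro!: continuous_intros continuous_on_compose2[OF expc_continuous[of UNIV]])
      then show "continuous_on ({0..} \<times> cbox (l n) (h n)) (\<lambda>(t, y). ?F n t y)"
        by (auto simp: split_beta intro!: continuous_intros continuous_on_compose2[OF rc] continuous_on_compose2[OF \<phi>c])
    qed
    then have "continuous_on {0..} (\<lambda>t. LINT y|lborel. ?F n t y)"
      by (rule continuous_on_eq) (simp add: F)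
    then show ?thesis unfolding \<Psi>_def[abs_def] by (intro continuous_intros)
  qed
  have \<Psi>D: "(\<Psi> n has_real_derivative \<Psi>' n t) (at t)" if t: "0 < t" for n t
  proof -
    have "((\<lambda>t. integral (cbox (l n) (h n)) (?F n t)) has_field_derivative
        integral (cbox (l n) (h n)) (?F' n t)) (at t within {0<..})"
    proof (rule leibniz_rule_field_derivative)
      show "((\<lambda>t. ?F n t y) has_field_derivative ?F' n s y) (at s within {0<..})" if "s \<in> {0<..}" for s y
      proof -
        have "(u (expc y) has_real_derivative deriv (u (expc y)) s) (at s)"
          using udiff[of s "expc y"] that by (simp add: DERIV_deriv_iff_real_differentiable)
        from DERIV_cmult[OF this, of "rho c0 y * \<phi> n y"] show ?thesis
          by (rule DERIV_subset) simp
      qed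
      show "?F n s integrable_on cbox (l n) (h n)" if "s \<in> {0<..}" for s
        by (rule integrable_continuous)
          (use that in \<open>auto intro!: continuous_intros continuous_on_subset[OF rc] continuous_on_subset[OF \<phi>c] continuous_on_subset[OF Ucont]\<close>)
      have "continuous_on ({0<..} \<times> cbox (l n) (h n)) (\<lambda>p. (\<lambda>(y, t). deriv (u (expc y)) t) (snd p, fst p))"
        by (rule continuous_on_compose2[OF dcont]) (auto intro!: continuous_intros)
      then show "continuous_on ({0<..} \<times> cbox (l n) (h n)) (\<lambda>(t, y). ?F' n t y)"
        by (auto simp: split_beta intro!: continuous_intros continuous_on_compose2[OF rc] continuous_on_compose2[OF \<phi>c])
    qed (use t in auto)
    then have "((\<lambda>t. integral (cbox (l n) (h n)) (?F n t)) has_field_derivative integral (cbox (l n) (h n)) (?F' n t)) (at t)"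
      using t by (simp add: at_within_open[of t "{0<..}"])
    then have "((\<lambda>t. LINT y|lborel. ?F n t y) has_field_derivative integral (cbox (l n) (h n)) (?F' n t)) (at t)"
      by (rule has_field_derivative_transform_within_open[where S = "{0<..}"]) (use t F in auto)
    then show ?thesis
      unfolding \<Psi>_def[abs_def] \<Psi>'_def F'[OF t] by (rule DERIV_cmult)
  qed

  \<comment> \<open>The part of the mean removed by truncation is at most the bound \<open>K\<close>
    times the lost mass.\<close>
  have compare: "\<Phi> t \<le> \<Psi> n t + k * K * \<delta> n" "integrable lborel (\<lambda>y. ?W t y)"
    if t: "0 \<le> t" and K: "0 \<le> K" "AE y in lborel. u (expc y) t \<le> K" for n t K
  proof -
    show int: "integrable lborel (\<lambda>y. ?W t y)"
    proof (rule Bochner_Integration.integrable_bound)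
      show "integrable lborel (\<lambda>y. K * (rho c0 y * E y))" using intE by simp
      show "(\<lambda>y. ?W t y) \<in> borel_measurable lborel"
        using t by (auto intro!: borel_measurable_continuous_onI continuous_intros rc Ec Ucont)
      show "AE y in lborel. norm (?W t y) \<le> norm (K * (rho c0 y * E y))"
        using K(2)
      proof eventually_elim
        fix y assume "u (expc y) t \<le> K"
        then have "u (expc y) t * (rho c0 y * E y) \<le> K * (rho c0 y * E y)"
          using rn by (intro mult_right_mono) (auto simp: E_def)
        then show "norm (?W t y) \<le> norm (K * (rho c0 y * E y))"
          using nonneg[OF t] K(1) rn by (simp add: abs_mult E_def mult_ac)
      qed
    qed
    have "(LINT y|lborel. ?W t y)
      \<le> (LINT y|lborel. ?F n t y + K * (?D n y))"
    proof (rule integral_mono_AE[OF int])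
      show "integrable lborel (\<lambda>y. ?F n t y + K * (?D n y))"
        using int\<phi>[OF Ucont[OF t]] intd by auto
      show "AE y in lborel. ?W t y \<le> ?F n t y + K * (?D n y)"
        using K(2)
      proof eventually_elim
        fix y assume "u (expc y) t \<le> K"
        then have "u (expc y) t * (?D n y) \<le> K * (?D n y)"
          using rn \<phi>E by (intro mult_right_mono) auto
        then show "?W t y \<le> ?F n t y + K * (?D n y)"
          by (simp add: algebra_simps)
      qed
    qed
    also have "\<dots> = (LINT y|lborel. ?F n t y) + K * \<delta> n"
      using int\<phi>[OF Ucont[OF t]] intd by (simp add: \<delta>_def)
    finally have "k * (LINT y|lborel. ?W t y)
      \<le> k * ((LINT y|lborel. ?F n t y) + K * \<delta> n)"
      using k0 by simp
    then show "\<Phi> t \<le> \<Psi> n t + k * K * \<delta> n" by (simp add: \<Phi>_def \<Psi>_def algebra_simps)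
  qed

  \<comment> \<open>The linear term comes with the full mean \<Phi>; replacing it by \<Psi> n costs
    \<open>lam * (k * K * \<delta> n)\<close>. Jensen's inequality is applied with the truncated
    weight.\<close>
  have \<Psi>ineq: "\<Psi>' n t \<ge> \<Psi> n t powr q - lam * \<Psi> n t - lam * (k * K * \<delta> n)"
    if t: "0 < t" and K: "0 \<le> K" "AE y in lborel. u (expc y) t \<le> K" for n t K
  proof -
    have t': "0 \<le> t" using t by simp
    have e: "1 / real (Suc n) > 0" by simp
    have gi: "integrable lborel (\<lambda>y. ?H n t y)"
      and ge: "- lam * (LINT y|lborel. ?W t y) \<le> (LINT y|lborel. ?H n t y)"
      unfolding \<phi>_def E_def
      by (intro prof_inequality[OF a e kap Cd lam uC2[OF t]] nonneg[OF t'] compare(2)[OF t' K, unfolded E_def])+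
    have pc: "continuous_on UNIV (\<lambda>y. u (expc y) t powr q)"
      using q nonneg[OF t'] by (intro continuous_on_powr' Ucont[OF t'] continuous_on_const) auto
    have "\<Psi>' n t = k * (LINT y|lborel. ?H n t y + ?Q n t y)"
      unfolding \<Psi>'_def by (simp add: pde[OF t] algebra_simps)
    also have "\<dots> = k * (LINT y|lborel. ?H n t y) + k * (LINT y|lborel. ?Q n t y)"
      using gi int\<phi>[OF pc] by (simp add: algebra_simps)
    finally have eq: "\<Psi>' n t = k * (LINT y|lborel. ?H n t y) + k * (LINT y|lborel. ?Q n t y)" .
    have "k * (- lam * (LINT y|lborel. ?W t y)) \<le> k * (LINT y|lborel. ?H n t y)"
      using ge k0 by (intro mult_left_mono) auto
    then have 1: "- lam * \<Phi> t \<le> k * (LINT y|lborel. ?H n t y)"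
      by (simp add: \<Phi>_def algebra_simps)
    have "(LINT y|lborel. rho c0 y * \<phi> n y) \<le> Z"
      unfolding Z_def using int\<phi>[of "\<lambda>_. 1" n] intE rn \<phi>E
      by (intro integral_mono) (auto intro!: mult_left_mono)
    then have kle: "k * (LINT y|lborel. rho c0 y * \<phi> n y) \<le> 1"
      using Z by (simp add: kZ)
    have 2: "\<Psi> n t powr q \<le> k * (LINT y|lborel. ?Q n t y)"
      unfolding \<Psi>_def
      by (rule jensen_powr[OF q k0 _ _ _ _ _ kle])
        (use int\<phi>[of "\<lambda>_. 1" n] int\<phi>[OF Ucont[OF t']] int\<phi>[OF pc] rn \<phi>n nonneg[OF t'] in auto)
    have "lam * \<Phi> t \<le> lam * (\<Psi> n t + k * K * \<delta> n)"
      using compare(1)[OF t' K] lam0 by (rule mult_left_mono)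
    with 1 2 eq show ?thesis by (simp add: algebra_simps)
  qed

  \<comment> \<open>A midpoint: strictly above the critical value, for the growth estimate, and
    strictly below \<Phi> 0, to leave room for the loss in \<Psi> n 0.\<close>
  define y1 where "y1 = (\<Phi> 0 + lam powr (1 / (q - 1))) / 2"
  have y1: "lam powr (1 / (q - 1)) < y1" "y1 < \<Phi> 0" using \<Phi>0 by (auto simp: y1_def)
  have y1p: "y1 > 0" using y1(1) powr_ge_zero[of lam "1 / (q - 1)"] by linarith
  have "(lam powr (1 / (q - 1))) powr (q - 1) < y1 powr (q - 1)"
    using y1 q by (intro powr_less_mono2) auto
  then have y1lam: "lam < y1 powr (q - 1)"
    using q lam0 by (simp add: powr_powr)
  define c where "c = 1 - lam / y1 powr (q - 1)"
  have c: "c > 0" using y1lam y1p by (simp add: c_def)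
  \<comment> \<open>Exactly the bound of \<open>blowup_time_bound\<close>, which is strict; it
    depends on neither \<open>K\<close> nor \<open>n\<close>, both chosen afterwards.\<close>
  define \<tau> where "\<tau> = 2 * y1 powr (1 - q) / ((q - 1) * c)"
  have \<tau>: "\<tau> > 0" unfolding \<tau>_def using y1p q c by simp
  \<comment> \<open>With \<open>\<tau> + 1\<close> the bound, obtained on a half-open interval,
    covers the closed interval up to \<tau>.\<close>
  have "ess_bounded (\<mu> \<Otimes>\<^sub>M restrict_space lborel {0<..<\<tau> + 1}) (\<lambda>(x, t). u x t)"
    using adm \<tau> by (simp add: admissible_solution_def)
  then obtain K where K: "K \<ge> 0" "AE y in lborel. \<forall>t\<in>{0..<\<tau> + 1}. u (expc y) t \<le> K"
    using bounded_of_ess_bounded[OF ucont, of "\<tau> + 1"] \<tau> by auto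
  have Kt: "AE y in lborel. u (expc y) t \<le> K" if "0 \<le> t" "t \<le> \<tau>" for t
    using K(2) by eventually_elim (use that in auto)
  have "(\<lambda>n. k * K * \<delta> n) \<longlonglongrightarrow> k * K * 0" "(\<lambda>n. lam * (k * K * \<delta> n)) \<longlonglongrightarrow> lam * (k * K * 0)"
    by (intro tendsto_intros \<delta>lim)+
  moreover have "k * K * 0 < \<Phi> 0 - y1" "lam * (k * K * 0) < c / 2 * y1 powr q"
    using y1 c y1p by auto
  ultimately have "\<forall>\<^sub>F n in sequentially. k * K * \<delta> n < \<Phi> 0 - y1"
    "\<forall>\<^sub>F n in sequentially. lam * (k * K * \<delta> n) < c / 2 * y1 powr q"
    by (blast dest: order_tendstoD(2))+
  then have "\<forall>\<^sub>F n in sequentially. k * K * \<delta> n < \<Phi> 0 - y1 \<and> lam * (k * K * \<delta> n) < c / 2 * y1 powr q"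
    by (rule eventually_conj)
  \<comment> \<open>The index lets \<Psi> n start above \<open>y1\<close> and keeps the error below
    the \<kappa> that \<open>blowup_time_bound\<close> tolerates.\<close>
  then obtain n where n: "k * K * \<delta> n < \<Phi> 0 - y1" "lam * (k * K * \<delta> n) < c / 2 * y1 powr q"
    unfolding eventually_sequentially by blast
  have "\<tau> < 2 * y1 powr (1 - q) / ((q - 1) * c)"
  proof (rule blowup_time_bound[OF q lam0 y1p y1lam \<tau>, of "\<Psi> n" "\<Psi>' n" "lam * (k * K * \<delta> n)"])
    show "continuous_on {0..\<tau>} (\<Psi> n)" by (rule continuous_on_subset[OF \<Psi>cont]) auto
    show "(\<Psi> n has_real_derivative \<Psi>' n t) (at t)" if "0 < t" for t using that by (rule \<Psi>D)
    show "\<Psi>' n t \<ge> \<Psi> n t powr q - lam * \<Psi> n t - lam * (k * K * \<delta> n)" if "0 < t" "t < \<tau>" for t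
      using that by (intro \<Psi>ineq K Kt) auto
    show "y1 < \<Psi> n 0" using compare(1)[of 0 K n] K(1) Kt[of 0] \<tau> n(1) by simp
    show "lam * (k * K * \<delta> n) \<le> c / 2 * y1 powr q" using n(2) by simp
  qed (rule c_def)
  then show False by (simp add: \<tau>_def)
qed

end

theorem theorem5p2:
  fixes A :: "('m::{t2_space, second_countable_topology}, 'n::finite) chart set"
    and g :: "('m, 'n) metric"
    and \<mu> :: "'m measure"
    and x\<^sub>0 :: 'm
    and b :: "'m \<Rightarrow> ('m, 'n) tvec"
    and r \<eta> u\<^sub>0 :: "'m \<Rightarrow> real"
    and \<beta> C\<^sub>1 q C\<^sub>d \<sigma> a lam k :: real
  assumes "cartan_hadamard A g"
    and "CARD('n) \<ge> 2"
    and "riemannian_volume A g \<mu>"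
    and "riem_pole A g x\<^sub>0"
    and r: "r = (\<lambda>x. riem_dist A g x x\<^sub>0)"
    and "\<beta> > 0"
    and "\<And>x. x \<noteq> x\<^sub>0 \<Longrightarrow>
           ricci A g x (radial_field A g x\<^sub>0 x) (radial_field A g x\<^sub>0 x)
             \<ge> - (real CARD('n) - 1) * (\<beta> / (1 + (r x)\<^sup>2))"
    and "C\<^sub>1 > 1"
    and "\<And>x. x \<noteq> x\<^sub>0 \<Longrightarrow> laplacian A g r x \<le> C\<^sub>1 * (real CARD('n) - 1) / r x"
    and "q > 1"
    and "C1_vector_field A b"
    and "ess_bounded \<mu> (\<lambda>x. tnorm g x (b x))"
    and "continuous_on UNIV u\<^sub>0" and "bounded (range u\<^sub>0)" and "\<And>x. u\<^sub>0 x \<ge> 0"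
    and "C\<^sub>d \<ge> 0" and "\<sigma> > 0"
    and "\<And>x. divergence A g b x \<le> C\<^sub>d"
    and "\<And>x. x \<noteq> x\<^sub>0 \<Longrightarrow> g x (b x) (radial_field A g x\<^sub>0 x) \<ge> - \<sigma> / r x"
    and "a > 0"
    and "lam \<ge> 2 * a * (1 + C\<^sub>1 * (real CARD('n) - 1) + \<sigma>) + C\<^sub>d"
    and \<eta>: "\<eta> = (\<lambda>x. exp (- a * (r x)\<^sup>2))"
    and k: "k = 1 / (LINT x|\<mu>. \<eta> x)"
    and "k * (LINT x|\<mu>. u\<^sub>0 x * \<eta> x) > lam powr (1 / (q - 1))"
  shows "\<not> (\<exists>u. admissible_solution A g \<mu> b q \<eta> u\<^sub>0 \<infinity> u)"
proof
  interpret drift_volume A g x\<^sub>0 b r C\<^sub>1 C\<^sub>d \<sigma> \<mu>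
    using assms by unfold_locales (auto simp: cartan_hadamard_def)
  have "kap \<ge> 0" using assms(2,8,17) by (simp add: kap_def add_nonneg_nonneg)
  moreover assume "\<exists>u. admissible_solution A g \<mu> b q \<eta> u\<^sub>0 \<infinity> u"
  ultimately show False
    using no_global_solution[OF _ \<open>C\<^sub>d \<ge> 0\<close> \<open>a > 0\<close> \<open>q > 1\<close> _ \<eta> k assms(24)] assms(21)
    by (auto simp: kap_def)
qed

end
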